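(* Let $p$ be a fixed odd prime, let $k$ be a fixed integer with $2\le k<p$, and let $s\ge 1$ be a fixed integer. For each $n$, let $\mathcal{F}_{k,s}$ be the collection of all nonempty sets of the form $V(f_1,\dots,f_s)\subseteq \mathbb{F}_p^n$, where $f_1,\dots,f_s\in\mathbb{F}_p[x_1,\dots,x_n]$ each have degree at most $k$. Let $M\subset\mathbb{F}_p^n$ be chosen uniformly at random among all subsets of $\mathbb{F}_p^n$ of a given size $|M|$ (which may depend on $n$). Set $$c_{k,s}=\frac{p^{(s-1)k}\log p}{\log\left(1+(p-1)^{-1}\right)}.$$ Then for every $\varepsilon>0$, as $n\to\infty$, $$\mathbb{P}\left(M\text{ pierces }\mathcal{F}_{k,s}\right)=\begin{cases}1-o(1), & |M|\ge (c_{k,s}+\varepsilon)\binom{n}{k},\\ o(1), & |M|\le (c_{k,s}-\varepsilon)\binom{n}{k}.\end{cases}$$ Moreover $c_{k,s}=(1+o_{p\to\infty}(1))\,p^{(s-1)k+1}\log p$.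
   Context: For polynomials $f_1,\dots,f_s\in\mathbb{F}_p[x_1,\dots,x_n]$, write $V(f_1,\dots,f_s)=\{x\in\mathbb{F}_p^n: f_1(x)=\dots=f_s(x)=0\}$ (a set of $\mathbb{F}_p$-points; no irreducibility is assumed). The zero polynomial counts as a polynomial of degree at most $k$. A set $M$ pierces a collection of sets $\mathcal{F}$ if $M\cap F\neq\emptyset$ for every $F\in\mathcal{F}$. The notation $o(1)$ is with respect to $n\to\infty$ with $p,k,s,\varepsilon$ fixed; $o_{p\to\infty}(1)$ is with respect to $p\to\infty$ with $k,s$ fixed. *)

theory Defs
  imports
    "HOL-Probability.Probability"
    "HOL-Library.Poly_Mapping"
    "HOL-Library.Landau_Symbols"
    "Berlekamp_Zassenhaus.Finite_Field"
begin

text \<open>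
  For a type \<open>'p\<close> of class \<open>prime_card\<close>, \<open>'p mod_ring\<close> is the field with \<open>CARD('p)\<close> elements, the
  integers modulo the prime \<open>CARD('p)\<close>. The number of variables must tend to infinity, so it cannot
  be encoded in a type: the \<open>n\<close> variables are indexed by \<open>{..<n}\<close>, and points are functions that
  take the value \<open>undefined\<close> outside \<open>{..<n}\<close>.
\<close>

definition affine_points :: "nat \<Rightarrow> (nat \<Rightarrow> 'a) set" where
  "affine_points n = {..<n} \<rightarrow>\<^sub>E UNIV"

text \<open>Monomials are finitely supported exponent vectors, polynomials are finitely supported maps
  from monomials to coefficients.\<close>

type_synonym 'a mpoly = "(nat \<Rightarrow>\<^sub>0 nat) \<Rightarrow>\<^sub>0 'a"

definition in_vars :: "nat \<Rightarrow> 'a::zero mpoly \<Rightarrow> bool" where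
  "in_vars n f \<longleftrightarrow> (\<forall>m \<in> Poly_Mapping.keys f. Poly_Mapping.keys m \<subseteq> {..<n})"

definition monom_degree :: "(nat \<Rightarrow>\<^sub>0 nat) \<Rightarrow> nat" where
  "monom_degree m = (\<Sum>i \<in> Poly_Mapping.keys m. Poly_Mapping.lookup m i)"

text \<open>The zero polynomial gets degree 0, hence has degree at most \<open>k\<close> for every \<open>k\<close>.\<close>

definition total_degree :: "'a::zero mpoly \<Rightarrow> nat" where
  "total_degree f = Max (insert 0 (monom_degree ` Poly_Mapping.keys f))"

definition eval_mpoly :: "'a::comm_semiring_1 mpoly \<Rightarrow> (nat \<Rightarrow> 'a) \<Rightarrow> 'a" where
  "eval_mpoly f x =
     (\<Sum>m \<in> Poly_Mapping.keys f. Poly_Mapping.lookup f m *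
        (\<Prod>i \<in> Poly_Mapping.keys m. x i ^ Poly_Mapping.lookup m i))"

definition variety :: "nat \<Rightarrow> nat \<Rightarrow> (nat \<Rightarrow> 'a::comm_semiring_1 mpoly) \<Rightarrow> (nat \<Rightarrow> 'a) set" where
  "variety n s f = {x \<in> affine_points n. \<forall>j<s. eval_mpoly (f j) x = 0}"

definition varieties :: "nat \<Rightarrow> nat \<Rightarrow> nat \<Rightarrow> (nat \<Rightarrow> 'a::comm_semiring_1) set set" where
  "varieties n k s =
     {V. V \<noteq> {} \<and> (\<exists>f. (\<forall>j<s. in_vars n (f j) \<and> total_degree (f j) \<le> k) \<and> V = variety n s f)}"

definition pierces :: "'a set \<Rightarrow> 'a set set \<Rightarrow> bool" where
  "pierces M \<F> \<longleftrightarrow> (\<forall>F \<in> \<F>. M \<inter> F \<noteq> {})"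

text \<open>\<open>pmf_of_set\<close> is meaningful only for a nonempty finite set, so this definition is to be used with
  \<open>N\<close> at most the number \<open>CARD('a) ^ n\<close> of points.\<close>

definition random_subset :: "nat \<Rightarrow> nat \<Rightarrow> (nat \<Rightarrow> 'a::finite) set pmf" where
  "random_subset n N = pmf_of_set {M. M \<subseteq> affine_points n \<and> card M = N}"

definition threshold_const :: "nat \<Rightarrow> nat \<Rightarrow> nat \<Rightarrow> real" where
  "threshold_const p k s =
     real p ^ ((s - 1) * k) * ln (real p) / ln (1 + inverse (real p - 1))"

end

theory Submission
  imports Defs "HOL-Algebra.Algebraic_Closure_Type" "HOL-Real_Asymp.Real_Asymp"
begin

text \<open>
  Call a polynomial of degree at most \<open>k\<close> biased if its values are not nearly equidistributed.
  Following Bogdanov and Viola, the value at \<open>x\<close> of a biased polynomial can be read off, up to an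
  additive constant, from the distribution of its values on \<open>x + H\<close> for a suitable small subspace
  \<open>H\<close> and for most \<open>x\<close>. So the polynomial is determined, up to a constant, by its derivatives in
  the directions of a basis of \<open>H\<close>, which have smaller degree, and there are only \<open>p ^ o(n ^ k)\<close>
  biased polynomials.

  Every variety can be defined by \<open>r\<close> biased polynomials and \<open>s - r\<close> polynomials all of whose
  combinations with each other and with the biased ones are unbiased. The zero set \<open>W\<close> of the
  former has density at least \<open>1 / p ^ (k * r)\<close> by Warning's second theorem, and the variety makes
  up a proportion \<open>1 / p ^ (s - r)\<close> of \<open>W\<close>. A union bound, whose dominant case is \<open>r = s - 1\<close>,
  shows that a random set above the threshold hits all varieties. Below the threshold, fix a
  subspace of codimension \<open>(s - 1) * k\<close> cut out by \<open>s - 1\<close> norm forms; by the second moment method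
  there is an unbiased polynomial without zeros among the random points of this subspace. In both
  cases the random set may be replaced by a sequence of independent points.
\<close>


section \<open>Polynomial functions\<close>

text \<open>The constant is a balance of entropy and avoidance. The functions of degree at most
  \<open>k\<close> number \<open>p ^ ((1 + o(1)) * (n choose k))\<close>. A set of density
  \<open>1 / p ^ ((s - 1) * k)\<close>, the smallest nonempty one that \<open>s - 1\<close>
  equations can define, contains about \<open>N / p ^ ((s - 1) * k)\<close> of \<open>N\<close>
  random points, and each of these misses the zero set of an unbiased polynomial with probability
  near \<open>1 - 1 / p\<close>, the reciprocal of \<open>1 + 1 / (p - 1)\<close>. Equating
  \<open>p ^ (n choose k)\<close> with the reciprocal of the probability that all miss gives
  \<open>threshold_const\<close>.

  The obstacle is that \<open>s\<close> equations need not behave independently, and a union bound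
  over all \<open>s\<close>-tuples at the worst possible density would lose too much. The split
  separates two costs: a biased equation may divide the density by \<open>p ^ k\<close> but adds
  nothing to the leading order of the count, while an unbiased one divides it by about
  \<open>p\<close> and adds a full \<open>n choose k\<close> to the exponent.

  Zero sets depend only on functions, so all counting concerns polynomial functions,
  \<open>d\<close> being an upper bound for the degree.\<close>

inductive poly_fun :: "nat \<Rightarrow> nat \<Rightarrow> ((nat \<Rightarrow> 'a::comm_ring_1) \<Rightarrow> 'a) \<Rightarrow> bool" for n where
  const: "poly_fun n d (\<lambda>_. c)"
| add: "poly_fun n d f \<Longrightarrow> poly_fun n d g \<Longrightarrow> poly_fun n d (\<lambda>x. f x + g x)"
| var_mult: "i < n \<Longrightarrow> poly_fun n d f \<Longrightarrow> poly_fun n (Suc d) (\<lambda>x. x i * f x)"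

lemma poly_fun_mono:
  assumes "poly_fun n d f" "n \<le> n'" "d \<le> d'"
  shows "poly_fun n' d' f"
  using assms
proof (induction arbitrary: d' rule: poly_fun.induct)
  case (var_mult i d f)
  then obtain e where "d' = Suc e" "d \<le> e" by (cases d') auto
  with var_mult show ?case by (auto intro: poly_fun.var_mult)
qed (auto intro: poly_fun.intros)

lemma poly_fun_cong:
  assumes "poly_fun n d f" "\<And>i. i < n \<Longrightarrow> x i = y i"
  shows "f x = f y"
  using assms by (induction rule: poly_fun.induct) auto

lemma poly_fun_cmult:
  assumes "poly_fun n d f"
  shows "poly_fun n d (\<lambda>x. c * f x)"
  using assms
proof (induction rule: poly_fun.induct)
  case (add d f g)
  then show ?case by (simp add: distrib_left poly_fun.add)
next
  case (var_mult i d f)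
  have "(\<lambda>x. c * (x i * f x)) = (\<lambda>x. x i * (c * f x))" by (auto simp: mult_ac)
  then show ?case using poly_fun.var_mult[OF var_mult(1,3)] by simp
qed (rule poly_fun.const)

lemma poly_fun_diff:
  assumes "poly_fun n d f" "poly_fun n d g"
  shows "poly_fun n d (\<lambda>x. f x - g x)"
  using poly_fun.add[OF assms(1) poly_fun_cmult[OF assms(2), of "-1"]] by simp

lemma poly_fun_sum:
  assumes "\<And>i. i \<in> I \<Longrightarrow> poly_fun n d (f i)"
  shows "poly_fun n d (\<lambda>x. \<Sum>i\<in>I. f i x)"
  using assms by (induction I rule: infinite_finite_induct) (auto intro: poly_fun.intros)

lemma poly_fun_mult:
  assumes "poly_fun n d f" "poly_fun n e g"
  shows "poly_fun n (d + e) (\<lambda>x. f x * g x)"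
  using assms
proof (induction rule: poly_fun.induct)
  case (const d c)
  then show ?case using poly_fun_mono[OF poly_fun_cmult] by fastforce
next
  case (add d f g')
  then show ?case by (simp add: distrib_right poly_fun.add)
next
  case (var_mult i d f)
  then show ?case using poly_fun.var_mult[OF var_mult(1), of "d + e"] by (simp add: mult.assoc)
qed

lemma poly_fun_power:
  "poly_fun n d f \<Longrightarrow> poly_fun n (m * d) (\<lambda>x. f x ^ m)"
  by (induction m) (auto intro: poly_fun.const poly_fun_mult)

lemma poly_fun_prod:
  assumes "finite I" "\<And>i. i \<in> I \<Longrightarrow> poly_fun n d (f i)"
  shows "poly_fun n (card I * d) (\<lambda>x. \<Prod>i\<in>I. f i x)"
  using assms by (induction I rule: finite_induct) (auto intro: poly_fun.const poly_fun_mult)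

lemma poly_fun_var: "i < n \<Longrightarrow> poly_fun n 1 (\<lambda>x. x i)"
  using poly_fun.var_mult[OF _ poly_fun.const[of n 0 1]] by simp

lemma poly_fun_const_deg0:
  assumes "poly_fun n d f" "d = 0"
  shows "\<exists>c. f = (\<lambda>_. c)"
  using assms by (induction rule: poly_fun.induct) auto

lemma poly_fun_const_vars0:
  assumes "poly_fun 0 d f"
  shows "\<exists>c. f = (\<lambda>_. c)"
  using assms by (induction rule: poly_fun.induct) auto

lemma poly_fun_shift:
  assumes "poly_fun n d f"
  shows "poly_fun n d (\<lambda>x. f (\<lambda>i. x i + h i))"
  using assms
proof (induction rule: poly_fun.induct)
  case (var_mult i d f)
  have "poly_fun n (Suc d) (\<lambda>x. x i * f (\<lambda>i. x i + h i) + h i * f (\<lambda>i. x i + h i))"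
    by (intro poly_fun.add poly_fun.var_mult var_mult poly_fun_cmult poly_fun_mono[OF var_mult(3)])
        auto
  then show ?case by (simp add: algebra_simps)
qed (auto intro: poly_fun.intros)

text \<open>For \<open>d = 0\<close> the difference must vanish, not merely be constant: in the step
  from \<open>f\<close> to \<open>x i * f\<close>, the product of \<open>x i\<close> with the
  difference has degree \<open>d\<close> only because the difference has degree
  \<open>d - 1\<close>, and for \<open>d = 0\<close> only because it is zero.\<close>

lemma poly_fun_derivative_aux:
  assumes "poly_fun n d f"
  shows "if d = 0 then \<forall>x. f (\<lambda>i. x i + h i) - f x = 0
    else poly_fun n (d - 1) (\<lambda>x. f (\<lambda>i. x i + h i) - f x)"
  using assms
proof (induction rule: poly_fun.induct)
  case (const d c)
  then show ?case by (auto intro: poly_fun.const)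
next
  case (add d f g)
  have *: "f (\<lambda>i. x i + h i) + g (\<lambda>i. x i + h i) - (f x + g x) =
     (f (\<lambda>i. x i + h i) - f x) + (g (\<lambda>i. x i + h i) - g x)" for x
    by (simp add: algebra_simps)
  show ?case using add.IH unfolding * by (cases "d = 0") (simp_all add: poly_fun.add)
next
  case (var_mult i d f)
  have *: "(x i + h i) * f (\<lambda>i. x i + h i) - x i * f x =
      x i * (f (\<lambda>i. x i + h i) - f x) + h i * f (\<lambda>i. x i + h i)" for x
    by (simp add: algebra_simps)
  have 1: "poly_fun n d (\<lambda>x. h i * f (\<lambda>i. x i + h i))"
    by (intro poly_fun_cmult poly_fun_shift var_mult)
  have 2: "poly_fun n d (\<lambda>x. x i * (f (\<lambda>i. x i + h i) - f x))"
  proof (cases d)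
    case 0
    with var_mult show ?thesis by (auto intro: poly_fun.const)
  next
    case (Suc e)
    with var_mult show ?thesis by (auto intro!: poly_fun.var_mult)
  qed
  from poly_fun.add[OF 2 1] show ?case unfolding * by simp
qed

lemma poly_fun_derivative:
  assumes "poly_fun n (Suc d) f"
  shows "poly_fun n d (\<lambda>x. f (\<lambda>i. x i + h i) - f x)"
  using poly_fun_derivative_aux[OF assms, of h] by simp

text \<open>The split mirrors Pascal's rule: \<open>g\<close> has lost a variable, \<open>h\<close>
  a degree. The cofactor \<open>h\<close> may still involve \<open>x n\<close>.\<close>

lemma poly_fun_split_last:
  assumes "poly_fun (Suc n) d f" "d = Suc e"
  shows "\<exists>g h. poly_fun n (Suc e) g \<and> poly_fun (Suc n) e h \<and> (\<forall>x. f x = g x + x n * h x)"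
  using assms
proof (induction arbitrary: e rule: poly_fun.induct)
  case (const d c)
  have "poly_fun n (Suc e) (\<lambda>_. c)" "poly_fun (Suc n) e (\<lambda>_. 0)"
    by (rule poly_fun.const)+
  then show ?case by (intro exI[of _ "\<lambda>_. c"] exI[of _ "\<lambda>_. 0"]) simp
next
  case (add d f g)
  obtain f1 f2 where f: "poly_fun n (Suc e) f1" "poly_fun (Suc n) e f2" "\<And>x. f x = f1 x
      + x n * f2 x"
    using add.IH(1)[OF add.prems] by blast
  obtain g1 g2 where g: "poly_fun n (Suc e) g1" "poly_fun (Suc n) e g2" "\<And>x. g x = g1 x
      + x n * g2 x"
    using add.IH(2)[OF add.prems] by blast
  have "f x + g x = (f1 x + g1 x) + x n * (f2 x + g2 x)" for x
    unfolding f(3) g(3) by (simp add: algebra_simps)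
  then show ?case
    using poly_fun.add[OF f(1) g(1)] poly_fun.add[OF f(2) g(2)] by blast
next
  case (var_mult i d f)
  have [simp]: "d = e" using var_mult.prems by simp
  show ?case
  proof (cases "i = n")
    case True
    have "poly_fun n (Suc e) (\<lambda>_. 0)" by (rule poly_fun.const)
    then show ?thesis using var_mult.hyps(2) True
      by (intro exI[of _ "\<lambda>_. 0"] exI[of _ f]) simp
  next
    case False
    then have i: "i < n" using var_mult.hyps(1) by simp
    show ?thesis
    proof (cases e)
      case 0
      then obtain c where c: "f = (\<lambda>_. c)" using poly_fun_const_deg0[OF var_mult.hyps(2)] by auto
      have "poly_fun n (Suc e) (\<lambda>x. x i * c)" "poly_fun (Suc n) e (\<lambda>_. 0)"
        using i by (auto intro: poly_fun.intros)
      then show ?thesis using c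
        by (intro exI[of _ "\<lambda>x. x i * c"] exI[of _ "\<lambda>_. 0"]) simp
    next
      case (Suc e')
      then obtain g h where gh: "poly_fun n (Suc e') g" "poly_fun (Suc n) e' h"
          "\<And>x. f x = g x + x n * h x"
        using var_mult.IH[of e'] by auto
      have "poly_fun n (Suc e) (\<lambda>x. x i * g x)" "poly_fun (Suc n) e (\<lambda>x. x i * h x)"
        using gh i Suc by (auto intro!: poly_fun.var_mult)
      moreover have "x i * f x = x i * g x + x n * (x i * h x)" for x
        unfolding gh(3) by (simp add: algebra_simps)
      ultimately show ?thesis by blast
    qed
  qed
qed

text \<open>Induction along Pascal's rule: each function is determined by the pair from the previous
  split, and the two exponents add up to \<open>(n + d) choose d\<close>. The pair need not be
  unique, which is harmless for an upper bound.\<close>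

lemma card_poly_fun_le:
  fixes T :: "'a::{finite, comm_ring_1} itself"
  shows "finite {f :: (nat \<Rightarrow> 'a) \<Rightarrow> 'a. poly_fun n d f} \<and>
    card {f :: (nat \<Rightarrow> 'a) \<Rightarrow> 'a. poly_fun n d f} \<le> CARD('a) ^ ((n + d) choose d)"
proof (induction "n + d" arbitrary: n d rule: less_induct)
  case less
  define S where "S = (\<lambda>n d. {f :: (nat \<Rightarrow> 'a) \<Rightarrow> 'a. poly_fun n d f})"
  show ?case
  proof (cases "n = 0 \<or> d = 0")
    case True
    then have sub: "S n d \<subseteq> range (\<lambda>c. \<lambda>_. c)"
      unfolding S_def using poly_fun_const_deg0 poly_fun_const_vars0
          by (auto simp: image_iff) blast+
    have "card (S n d) \<le> card (range (\<lambda>c :: 'a. \<lambda>_ :: nat \<Rightarrow> 'a. c))"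
      by (intro card_mono sub) auto
    also have "\<dots> \<le> CARD('a)" by (rule card_image_le) auto
    finally show ?thesis using True finite_subset[OF sub] by (auto simp: S_def)
  next
    case False
    then obtain m e where [simp]: "n = Suc m" "d = Suc e" by (cases n; cases d) auto
    have fin: "finite (S m (Suc e))" "finite (S (Suc m) e)"
      and c: "card (S m (Suc e)) \<le> CARD('a) ^ ((m + Suc e) choose Suc e)"
        "card (S (Suc m) e) \<le> CARD('a) ^ ((Suc m + e) choose e)"
      using less[of m "Suc e"] less[of "Suc m" e] by (auto simp: S_def)
    have sub: "S n d \<subseteq> (\<lambda>(g, h). \<lambda>x. g x + x m * h x) ` (S m (Suc e) \<times> S (Suc m) e)"
    proof
      fix f assume "f \<in> S n d"
      then obtain g h where "poly_fun m (Suc e) g" "poly_fun (Suc m) e h" "\<And>x. f x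
          = g x + x m * h x"
        using poly_fun_split_last[of m "Suc e" f e] by (auto simp: S_def)
      then show "f \<in> (\<lambda>(g, h). \<lambda>x. g x + x m * h x) ` (S m (Suc e) \<times> S (Suc m) e)"
        by (intro image_eqI[of _ _ "(g, h)"]) (auto simp: S_def)
    qed
    have "card (S n d) \<le> card ((\<lambda>(g, h). \<lambda>x. g x + x m * h x) ` (S m (Suc e) \<times> S (Suc m) e))"
      by (intro card_mono sub) (use fin in auto)
    also have "\<dots> \<le> card (S m (Suc e)) * card (S (Suc m) e)"
      using card_image_le[of "S m (Suc e) \<times> S (Suc m) e"] fin by (simp add: card_cartesian_product)
    also have "\<dots> \<le> CARD('a) ^ ((m + Suc e) choose Suc e) * CARD('a) ^ ((Suc m + e) choose e)"
      using c by (rule mult_mono) auto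
    also have "\<dots> = CARD('a) ^ ((n + d) choose d)"
      by (simp add: power_add[symmetric] add.commute)
    finally have "card (S n d) \<le> CARD('a) ^ ((n + d) choose d)" .
    moreover have "finite (S n d)" using finite_subset[OF sub] fin by auto
    ultimately show ?thesis by (simp add: S_def)
  qed
qed

lemmas finite_poly_fun = conjunct1[OF card_poly_fun_le]
  and card_poly_fun = conjunct2[OF card_poly_fun_le]

text \<open>The squarefree monomials of degree \<open>k\<close> are independent as functions: at the
  indicator vector of a \<open>k\<close>-set \<open>S\<close> only the monomial of \<open>S\<close>
  survives, because no other \<open>k\<close>-set is contained in \<open>S\<close>.\<close>

lemma card_poly_fun_ge:
  "CARD('a::{finite, comm_ring_1}) ^ (n choose k) \<le> card {f :: (nat \<Rightarrow> 'a) \<Rightarrow> 'a. poly_fun n k f}"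
proof -
  define I where "I = {S. S \<subseteq> {..<n} \<and> card S = k}"
  have finI: "finite I" unfolding I_def by (rule finite_subset[of _ "Pow {..<n}"]) auto
  define F where "F = (\<lambda>c :: nat set \<Rightarrow> 'a. \<lambda>x :: nat \<Rightarrow> 'a. \<Sum>S\<in>I. c S * (\<Prod>i\<in>S. x i))"
  have "inj_on F (I \<rightarrow>\<^sub>E UNIV)"
  proof (rule inj_onI)
    fix c c' assume c: "c \<in> I \<rightarrow>\<^sub>E UNIV" "c' \<in> I \<rightarrow>\<^sub>E UNIV" and eq: "F c = F c'"
    have val: "F c (\<lambda>i. if i \<in> S then 1 else 0) = c S" if S: "S \<in> I" for S c
    proof -
      have "(\<Prod>i\<in>S'. if i \<in> S then 1 else 0) = (if S' = S then 1 else 0 :: 'a)" if S': "S' \<in> I"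
          for S'
      proof (cases "S' \<subseteq> S")
        case True
        moreover have "finite S" "card S' = card S" using S S'
            by (auto simp: I_def intro: finite_subset)
        ultimately have "S' = S" by (simp add: card_subset_eq)
        then show ?thesis by simp
      next
        case False
        then obtain i where "i \<in> S'" "i \<notin> S" by auto
        moreover have "finite S'" using S' by (auto simp: I_def intro: finite_subset)
        ultimately have "(\<Prod>i\<in>S'. if i \<in> S then 1 else 0 :: 'a) = 0" by (intro prod_zero) auto
        then show ?thesis using False by auto
      qed
      then have "F c (\<lambda>i. if i \<in> S then 1 else 0) = (\<Sum>S'\<in>I. c S' * (if S' = S then 1 else 0))"
        unfolding F_def by (intro sum.cong) auto
      also have "\<dots> = (\<Sum>S'\<in>I. if S' = S then c S' else 0)" by (intro sum.cong) auto
      also have "\<dots> = c S" using S finI by (simp add: sum.delta)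
      finally show ?thesis .
    qed
    show "c = c'"
      by (rule PiE_ext[OF c]) (metis val eq)
  qed
  moreover have "F ` (I \<rightarrow>\<^sub>E UNIV) \<subseteq> {f. poly_fun n k f}"
  proof -
    have "poly_fun n k (\<lambda>x :: nat \<Rightarrow> 'a. \<Prod>i\<in>S. x i)" if "S \<in> I" for S
    proof -
      have S: "S \<subseteq> {..<n}" "card S = k" using that by (auto simp: I_def)
      show ?thesis using poly_fun_prod[of S n 1 "\<lambda>i x. x i"] poly_fun_var[of _ n] S finite_subset[OF
          S(1)] by auto
    qed
    then show ?thesis by (auto simp: F_def intro!: poly_fun_sum poly_fun_cmult)
  qed
  ultimately have "card (I \<rightarrow>\<^sub>E (UNIV :: 'a set)) \<le> card {f :: (nat \<Rightarrow> 'a) \<Rightarrow> 'a. poly_fun n k f}"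
    using finite_poly_fun card_inj_on_le by blast
  moreover have "card (I \<rightarrow>\<^sub>E (UNIV :: 'a set)) = CARD('a) ^ (n choose k)"
    using finI n_subsets[of "{..<n}" k] by (simp add: card_PiE I_def)
  ultimately show ?thesis by simp
qed

section \<open>Formal polynomials and the functions they define\<close>

definition monom_fun :: "(nat \<Rightarrow>\<^sub>0 nat) \<Rightarrow> (nat \<Rightarrow> 'a::comm_semiring_1) \<Rightarrow> 'a" where
  "monom_fun m x = (\<Prod>i \<in> Poly_Mapping.keys m. x i ^ Poly_Mapping.lookup m i)"

lemma monom_fun_superset:
  assumes "finite I" "Poly_Mapping.keys m \<subseteq> I"
  shows "monom_fun m x = (\<Prod>i\<in>I. x i ^ Poly_Mapping.lookup m i)"
  unfolding monom_fun_def using assms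
  by (intro prod.mono_neutral_left) (auto simp: in_keys_iff)

lemma monom_degree_superset:
  assumes "finite I" "Poly_Mapping.keys m \<subseteq> I"
  shows "monom_degree m = (\<Sum>i\<in>I. Poly_Mapping.lookup m i)"
  unfolding monom_degree_def using assms
  by (intro sum.mono_neutral_left) (auto simp: in_keys_iff)

lemma poly_fun_monom:
  assumes "Poly_Mapping.keys m \<subseteq> {..<n}"
  shows "poly_fun n (monom_degree m) (monom_fun m)"
proof -
  have "poly_fun n (\<Sum>i\<in>I. Poly_Mapping.lookup m i) (\<lambda>x. \<Prod>i\<in>I. x i ^ Poly_Mapping.lookup m i)"
    if "finite I" "I \<subseteq> {..<n}" for I
    using that
  proof (induction I rule: finite_induct)
    case (insert i I)
    have "poly_fun n (Poly_Mapping.lookup m i * 1) (\<lambda>x. x i ^ Poly_Mapping.lookup m i)"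
      using insert by (intro poly_fun_power poly_fun_var) auto
    then show ?case using insert by (auto intro: poly_fun_mult)
  qed (auto intro: poly_fun.const)
  from this[of "Poly_Mapping.keys m"] assms show ?thesis
    unfolding monom_degree_def monom_fun_def[abs_def] by auto
qed

lemma eval_mpoly_superset:
  assumes "finite I" "Poly_Mapping.keys f \<subseteq> I"
  shows "eval_mpoly f x = (\<Sum>m\<in>I. Poly_Mapping.lookup f m * monom_fun m x)"
  unfolding eval_mpoly_def monom_fun_def[symmetric] using assms
  by (intro sum.mono_neutral_left) (auto simp: in_keys_iff)

lemma total_degree_le_iff: "total_degree f \<le> k \<longleftrightarrow> (\<forall>m\<in>Poly_Mapping.keys f. monom_degree m \<le> k)"
  unfolding total_degree_def by (subst Max_le_iff) auto

lemma poly_fun_eval_mpoly: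
  assumes "in_vars n f" "total_degree f \<le> k"
  shows "poly_fun n k (eval_mpoly f)"
proof -
  have "poly_fun n k (\<lambda>x. Poly_Mapping.lookup f m * monom_fun m x)" if "m \<in> Poly_Mapping.keys f"
      for m
    using that assms
    by (intro poly_fun_cmult poly_fun_mono[OF poly_fun_monom[of m n]])
      (auto simp: in_vars_def total_degree_le_iff)
  then show ?thesis
    unfolding eval_mpoly_def[abs_def] monom_fun_def[symmetric] by (intro poly_fun_sum)
qed

lemma monom_fun_var_mult:
  "x i * monom_fun m x = monom_fun (m + Poly_Mapping.single i 1) x"
proof -
  let ?I = "insert i (Poly_Mapping.keys m)"
  have "monom_fun (m + Poly_Mapping.single i 1) x =
      (\<Prod>j\<in>?I. x j ^ Poly_Mapping.lookup (m + Poly_Mapping.single i 1) j)"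
    using Poly_Mapping.keys_add[of m "Poly_Mapping.single i 1"] by (intro monom_fun_superset) auto
  also have "\<dots> = (\<Prod>j\<in>?I. x j ^ Poly_Mapping.lookup m j * (if j = i then x i else 1))"
    by (intro prod.cong refl) (auto simp: lookup_add lookup_single power_add when_def)
  also have "\<dots> = (\<Prod>j\<in>?I. x j ^ Poly_Mapping.lookup m j) * x i"
    by (subst prod.distrib) (auto simp: prod.delta)
  also have "(\<Prod>j\<in>?I. x j ^ Poly_Mapping.lookup m j) = monom_fun m x"
    by (intro monom_fun_superset[symmetric]) auto
  finally show ?thesis by (simp add: mult.commute)
qed

lemma monom_degree_var_mult: "monom_degree (m + Poly_Mapping.single i 1) = Suc (monom_degree m)"
proof -
  let ?I = "insert i (Poly_Mapping.keys m)"
  have "monom_degree (m + Poly_Mapping.single i 1) =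
      (\<Sum>j\<in>?I. Poly_Mapping.lookup (m + Poly_Mapping.single i 1) j)"
    using Poly_Mapping.keys_add[of m "Poly_Mapping.single i 1"]
        by (intro monom_degree_superset) auto
  also have "\<dots> = (\<Sum>j\<in>?I. Poly_Mapping.lookup m j + (if j = i then 1 else 0))"
    by (intro sum.cong refl) (auto simp: lookup_add lookup_single when_def)
  also have "\<dots> = (\<Sum>j\<in>?I. Poly_Mapping.lookup m j) + 1"
    by (subst sum.distrib) (auto simp: sum.delta)
  also have "(\<Sum>j\<in>?I. Poly_Mapping.lookup m j) = monom_degree m"
    by (intro monom_degree_superset[symmetric]) auto
  finally show ?thesis by simp
qed

lemma in_vars_add: "in_vars n f \<Longrightarrow> in_vars n g \<Longrightarrow> in_vars n (f + g)"
  unfolding in_vars_def using Poly_Mapping.keys_add[of f g] by blast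

lemma total_degree_add_le: "total_degree f \<le> k \<Longrightarrow> total_degree g \<le> k \<Longrightarrow> total_degree (f + g) \<le> k"
  unfolding total_degree_le_iff using Poly_Mapping.keys_add[of f g] by blast

lemma eval_mpoly_add: "eval_mpoly (f + g) x = eval_mpoly f x + eval_mpoly g x"
proof -
  let ?I = "Poly_Mapping.keys f \<union> Poly_Mapping.keys g"
  have "eval_mpoly (f + g) x = (\<Sum>m\<in>?I. Poly_Mapping.lookup (f + g) m * monom_fun m x)"
    using Poly_Mapping.keys_add[of f g] by (intro eval_mpoly_superset) auto
  also have "\<dots> = eval_mpoly f x + eval_mpoly g x"
    by (simp add: lookup_add distrib_right sum.distrib eval_mpoly_superset[of ?I])
  finally show ?thesis .
qed

lemma eval_mpoly_single: "eval_mpoly (Poly_Mapping.single m c) x = c * monom_fun m x"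
  using eval_mpoly_superset[of "{m}" "Poly_Mapping.single m c" x] by (simp add: lookup_single)

definition mpoly_funs :: "nat \<Rightarrow> nat \<Rightarrow> ((nat \<Rightarrow> 'a::comm_ring_1) \<Rightarrow> 'a) set" where
  "mpoly_funs n k = {eval_mpoly f | f. in_vars n f \<and> total_degree f \<le> k}"

lemma mpoly_funs_add:
  assumes "f \<in> mpoly_funs n k" "g \<in> mpoly_funs n k"
  shows "(\<lambda>x. f x + g x) \<in> mpoly_funs n k"
proof -
  from assms obtain f' g' where "in_vars n f'" "total_degree f' \<le> k" "f = eval_mpoly f'"
    "in_vars n g'" "total_degree g' \<le> k" "g = eval_mpoly g'" unfolding mpoly_funs_def by auto
  then show ?thesis unfolding mpoly_funs_def
    by (auto intro!: exI[of _ "f' + g'"] simp: eval_mpoly_add in_vars_add total_degree_add_le)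
qed

lemma mpoly_funs_monom:
  assumes "Poly_Mapping.keys m \<subseteq> {..<n}" "monom_degree m \<le> k"
  shows "(\<lambda>x. c * monom_fun m x) \<in> mpoly_funs n k"
  unfolding mpoly_funs_def using assms
  by (auto intro!: exI[of _ "Poly_Mapping.single m c"] 
      simp: eval_mpoly_single fun_eq_iff in_vars_def total_degree_le_iff split: if_splits)

lemma mpoly_funs_sum:
  assumes "\<And>i. i \<in> I \<Longrightarrow> f i \<in> mpoly_funs n k"
  shows "(\<lambda>x. \<Sum>i\<in>I. f i x) \<in> mpoly_funs n k"
proof -
  have 0: "(\<lambda>x. 0) \<in> mpoly_funs n k"
    using mpoly_funs_monom[of 0 n k 0] by (simp add: monom_degree_def)
  show ?thesis
    using assms by (induction I rule: infinite_finite_induct) (auto intro: mpoly_funs_add 0)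
qed

lemma poly_fun_in_mpoly_funs:
  assumes "poly_fun n k f"
  shows "f \<in> mpoly_funs n k"
  using assms
proof (induction rule: poly_fun.induct)
  case (const d c)
  then show ?case
    using mpoly_funs_monom[of 0 n d c] by (simp add: monom_degree_def monom_fun_def)
next
  case (var_mult i d f)
  then obtain f' where f': "in_vars n f'" "total_degree f' \<le> d" "f = eval_mpoly f'"
    unfolding mpoly_funs_def by auto
  have "(\<lambda>x. x i * f x) = (\<lambda>x. \<Sum>m\<in>Poly_Mapping.keys f'. Poly_Mapping.lookup f' m *
      monom_fun (m + Poly_Mapping.single i 1) x)"
    unfolding f' eval_mpoly_superset[OF finite_keys subset_refl] monom_fun_var_mult[symmetric]
    by (auto simp: sum_distrib_left mult_ac)
  moreover have "\<dots> \<in> mpoly_funs n (Suc d)"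
  proof (intro mpoly_funs_sum mpoly_funs_monom)
    fix m assume m: "m \<in> Poly_Mapping.keys f'"
    then show "Poly_Mapping.keys (m + Poly_Mapping.single i 1) \<subseteq> {..<n}"
      using f'(1) var_mult(1) Poly_Mapping.keys_add[of m "Poly_Mapping.single i 1"]
      unfolding in_vars_def by fastforce
    show "monom_degree (m + Poly_Mapping.single i 1) \<le> Suc d"
      using m f'(2) by (simp add: monom_degree_var_mult total_degree_le_iff del: One_nat_def)
  qed
  ultimately show ?case by simp
qed (rule mpoly_funs_add)

definition zeros :: "nat \<Rightarrow> nat \<Rightarrow> (nat \<Rightarrow> (nat \<Rightarrow> 'a::comm_ring_1) \<Rightarrow> 'a) \<Rightarrow> (nat \<Rightarrow> 'a) set" where
  "zeros n s f = {x \<in> affine_points n. \<forall>j<s. f j x = 0}"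

text \<open>Formal polynomials disappear here: they define exactly the polynomial functions, with
  the same bound on the degree.\<close>

lemma varieties_eq:
  "varieties n k s = {V. V \<noteq> {} \<and> (\<exists>f. (\<forall>j<s. poly_fun n k (f j)) \<and> V = zeros n s f)}"
proof -
  have "(\<exists>f. (\<forall>j<s. in_vars n (f j) \<and> total_degree (f j) \<le> k) \<and> V = variety n s f) \<longleftrightarrow>
     (\<exists>f. (\<forall>j<s. poly_fun n k (f j)) \<and> V = zeros n s f)" for V :: "(nat \<Rightarrow> 'a) set"
  proof safe
    fix f :: "nat \<Rightarrow> 'a mpoly"
    assume "\<forall>j<s. in_vars n (f j) \<and> total_degree (f j) \<le> k" "V = variety n s f"
    then show "\<exists>f'. (\<forall>j<s. poly_fun n k (f' j)) \<and> variety n s f = zeros n s f'"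
      by (intro exI[of _ "\<lambda>j. eval_mpoly (f j)"])
        (auto simp: poly_fun_eval_mpoly variety_def zeros_def)
  next
    fix f :: "nat \<Rightarrow> (nat \<Rightarrow> 'a) \<Rightarrow> 'a"
    assume *: "\<forall>j<s. poly_fun n k (f j)" "V = zeros n s f"
    from *(1) have "\<forall>j<s. \<exists>f'. in_vars n f' \<and> total_degree f' \<le> k \<and> f j = eval_mpoly f'"
      using poly_fun_in_mpoly_funs unfolding mpoly_funs_def by blast
    then obtain f' where "\<forall>j<s. in_vars n (f' j) \<and> total_degree (f' j) \<le> k \<and> f j
        = eval_mpoly (f' j)"
      by metis
    then show "\<exists>f'. (\<forall>j<s. in_vars n (f' j) \<and> total_degree (f' j) \<le> k) \<and> zeros n s f
        = variety n s f'"
      by (intro exI[of _ f']) (auto simp: variety_def zeros_def)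
  qed
  then show ?thesis unfolding varieties_def by simp
qed

section \<open>The number of zeros\<close>

lemma finite_affine_points: "finite (affine_points n :: (nat \<Rightarrow> 'a::finite) set)"
  unfolding affine_points_def by (intro finite_PiE) auto

lemma card_affine_points: "card (affine_points n :: (nat \<Rightarrow> 'a::finite) set) = CARD('a) ^ n"
  unfolding affine_points_def by (simp add: card_PiE)

lemma affine_points_nonempty: "affine_points n \<noteq> {}"
  unfolding affine_points_def by (simp add: PiE_eq_empty_iff)

lemma bij_betw_affine_points_Suc:
  "bij_betw (\<lambda>(t, y). y(n := t)) (UNIV \<times> affine_points n) (affine_points (Suc n))"
  unfolding bij_betw_def affine_points_def lessThan_Suc PiE_insert_eq
  using inj_combinator[of n "{..<n}" "\<lambda>_. UNIV"] by simp

lemma two_le_CARD: "2 \<le> CARD('a::{finite, zero_neq_one})"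
proof -
  have "card {0, 1 :: 'a} \<le> CARD('a)" by (rule card_mono) auto
  then show ?thesis by simp
qed

text \<open>Powers of the last variable are reduced by \<open>x ^ CARD('a) = x\<close>, so fewer
  than \<open>CARD('a)\<close> of them occur, and the reduction never raises the degree. The bound
  on the exponents is what makes the root count in one variable nontrivial.\<close>

lemma poly_fun_expand_last:
  assumes "poly_fun (Suc n) d (f :: (nat \<Rightarrow> 'a::finite_field) \<Rightarrow> 'a)"
  shows "\<exists>g. (\<forall>j. if j \<le> d then poly_fun n (d - j) (g j) else g j = (\<lambda>_. 0)) \<and>
             (\<forall>x. f x = (\<Sum>j<CARD('a). x n ^ j * g j x))"
  using assms
proof (induction rule: poly_fun.induct)
  case (const d c)
  show ?case
  proof (intro exI conjI allI)
    fix j show "if j \<le> d then poly_fun n (d - j) (if j = 0 then \<lambda>_. c else (\<lambda>_. 0)) else (if j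
        = 0 then \<lambda>_. c else (\<lambda>_. 0)) = (\<lambda>_. 0)"
      by (auto intro: poly_fun.const)
  next
    fix x :: "nat \<Rightarrow> 'a"
    have "(\<Sum>j<CARD('a). x n ^ j * (if j = 0 then \<lambda>_. c else (\<lambda>_. 0)) x) = (\<Sum>j<CARD('a).
        if j = 0 then c else 0)"
      by (intro sum.cong) auto
    then show "c = (\<Sum>j<CARD('a). x n ^ j * (if j = 0 then \<lambda>_. c else (\<lambda>_. 0)) x)"
        by (simp add: sum.delta)
  qed
next
  case (add d f1 f2)
  obtain g1 where g1: "\<And>j. if j \<le> d then poly_fun n (d - j) (g1 j) else g1 j = (\<lambda>_. 0)"
      "\<And>x. f1 x = (\<Sum>j<CARD('a). x n ^ j * g1 j x)" using add.IH(1) by blast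
  obtain g2 where g2: "\<And>j. if j \<le> d then poly_fun n (d - j) (g2 j) else g2 j = (\<lambda>_. 0)"
      "\<And>x. f2 x = (\<Sum>j<CARD('a). x n ^ j * g2 j x)" using add.IH(2) by blast
  show ?case
  proof (intro exI conjI allI)
    fix j show "if j \<le> d then poly_fun n (d - j) ((\<lambda>j x. g1 j x + g2 j x) j) else (\<lambda>j x. g1 j x
        + g2 j x) j = (\<lambda>_. 0)"
      using g1(1)[of j] g2(1)[of j] by (auto intro: poly_fun.add split: if_splits)
  next
    fix x :: "nat \<Rightarrow> 'a"
    show "f1 x + f2 x = (\<Sum>j<CARD('a). x n ^ j * (\<lambda>j x. g1 j x + g2 j x) j x)"
      unfolding g1(2) g2(2) by (simp add: sum.distrib distrib_left)
  qed
next
  case (var_mult i d f)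
  obtain g where g: "\<And>j. if j \<le> d then poly_fun n (d - j) (g j) else g j = (\<lambda>_. 0)"
      "\<And>x. f x = (\<Sum>j<CARD('a). x n ^ j * g j x)" using var_mult.IH by blast
  show ?case
  proof (cases "i = n")
    case False
    then have i: "i < n" using var_mult.hyps(1) by simp
    show ?thesis
    proof (intro exI conjI allI)
      fix j show "if j \<le> Suc d then poly_fun n (Suc d - j) ((\<lambda>j x. x i * g j x) j) else (\<lambda>j x. x i
          * g j x) j = (\<lambda>_. 0)"
      proof (cases "j \<le> d")
        case True
        then have "poly_fun n (Suc (d - j)) (\<lambda>x. x i * g j x)"
          using g(1)[of j] i by (auto intro: poly_fun.var_mult)
        then show ?thesis using True by (simp add: Suc_diff_le)
      qed (use g(1)[of j] in \<open>auto intro: poly_fun.const\<close>)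
    next
      fix x :: "nat \<Rightarrow> 'a"
      show "x i * f x = (\<Sum>j<CARD('a). x n ^ j * (\<lambda>j x. x i * g j x) j x)"
        unfolding g(2) by (simp add: sum_distrib_left mult_ac)
    qed
  next
    case True
    obtain q where q: "CARD('a) = Suc q" "q \<ge> 1"
      using two_le_CARD[where 'a = 'a] by (cases "CARD('a)") auto
    \<comment> \<open>Multiplying by \<open>x n\<close> moves every coefficient up by one; the top
      one, now at \<open>x n ^ Suc q\<close>, wraps around to \<open>x n ^ 1\<close> by Fermat. Here
      \<open>Suc q\<close> is the order of the field.\<close>
    define g' where "g' = (\<lambda>j x. case j of 0 \<Rightarrow> 0 | Suc j' \<Rightarrow> g j' x + (if j' = 0 then g q x else 0))"
    show ?thesis
    proof (intro exI[of _ g'] conjI allI)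
      fix j show "if j \<le> Suc d then poly_fun n (Suc d - j) (g' j) else g' j = (\<lambda>_. 0)"
      proof (cases j)
        case 0
        then show ?thesis by (simp add: g'_def poly_fun.const)
      next
        case (Suc j')
        have *: "poly_fun n d (g q)" 
          using g(1)[of q] by (cases "q \<le> d") (auto intro: poly_fun_mono poly_fun.const)
        show ?thesis
        proof (cases "j' = 0")
          case True
          then show ?thesis using Suc g(1)[of 0] * by (simp add: g'_def poly_fun.add)
        next
          case False
          then show ?thesis using Suc g(1)[of j'] by (simp add: g'_def)
        qed
      qed
    next
      fix x :: "nat \<Rightarrow> 'a"
      have fermat: "x n ^ Suc q = x n"
        using finite_field_power_card_eq_same[of "x n"] by (simp only: q(1))
      have "x i * f x = (\<Sum>j<q. x n ^ Suc j * g j x) + x n ^ Suc q * g q x"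
        unfolding g(2) q(1) True by (simp add: sum_distrib_left distrib_left mult_ac)
      also have "x n ^ Suc q * g q x = (\<Sum>j<q. if j = 0 then x n * g q x else 0)"
        unfolding fermat using q(2) by (simp add: sum.delta)
      also have "(\<Sum>j<q. x n ^ Suc j * g j x) + \<dots> = (\<Sum>j<q. x n ^ Suc j * g' (Suc j) x)"
        unfolding sum.distrib[symmetric] by (intro sum.cong refl) (auto simp: g'_def algebra_simps)
      also have "\<dots> = (\<Sum>j<CARD('a). x n ^ j * g' j x)"
        unfolding q(1) by (subst sum.lessThan_Suc_shift) (simp add: g'_def)
      finally show "x i * f x = (\<Sum>j<CARD('a). x n ^ j * g' j x)" .
    qed
  qed
qed

text \<open>Convexity: the function \<open>p powr u\<close> lies below its chord over the unit
  interval, and at \<open>u = 1 - J / (p - 1)\<close> that chord has height \<open>p - J\<close>. So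
  a loss of \<open>J\<close> roots out of \<open>p\<close> values is paid for by \<open>J\<close>
  units of degree in the exponent of \<open>card_nonzeros_ge\<close>.\<close>

lemma powr_le_chord:
  fixes p J :: nat
  assumes "p \<ge> 2" "J < p"
  shows "real p powr (1 - real J / (real p - 1)) \<le> real (p - J)"
proof -
  define u where "u = real J / (real p - 1)"
  have p1: "real p - 1 > 0" using assms by simp
  have u: "0 \<le> u" "u \<le> 1" using assms p1 by (auto simp: u_def)
  have "exp ((1 - (1 - u)) *\<^sub>R 0 + (1 - u) *\<^sub>R ln (real p)) \<le> (1 - (1 - u)) * exp 0 + (1
      - u) * exp (ln (real p))"
    by (rule convex_onD[OF exp_convex]) (use u in auto)
  then have "real p powr (1 - u) \<le> u + (1 - u) * real p"
    using assms by (simp add: powr_def)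
  also have "\<dots> = real p - u * (real p - 1)" by (simp add: algebra_simps)
  also have "\<dots> = real (p - J)" using p1 assms by (simp add: u_def)
  finally show ?thesis by (simp add: u_def)
qed

lemma card_univariate_nonzeros_ge:
  fixes a :: "nat \<Rightarrow> 'a::finite_field"
  assumes "a J \<noteq> 0"
  shows "CARD('a) - J \<le> card {t. (\<Sum>j\<le>J. t ^ j * a j) \<noteq> 0}"
proof -
  define P where "P = (\<Sum>j\<le>J. Polynomial.monom (a j) j)"
  have coeff: "Polynomial.coeff P J = a J" by (simp add: P_def Polynomial.coeff_sum)
  then have "P \<noteq> 0" using assms by auto
  have "Polynomial.degree P \<le> J"
    unfolding P_def by (rule Polynomial.degree_sum_le) (auto intro: order_trans[OF
        Polynomial.degree_monom_le])
  have ev: "poly P t = (\<Sum>j\<le>J. t ^ j * a j)" for t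
    by (simp add: P_def poly_sum Polynomial.poly_monom mult.commute)
  have "card {t. poly P t = 0} \<le> J"
    using card_poly_roots_bound[OF \<open>P \<noteq> 0\<close>] \<open>Polynomial.degree P \<le> J\<close> by simp
  moreover have "{t. (\<Sum>j\<le>J. t ^ j * a j) \<noteq> 0} = UNIV - {t. poly P t = 0}" by (auto simp: ev)
  ultimately show ?thesis by (simp add: card_Diff_subset)
qed

text \<open>Induction on the number of variables. Over each \<open>y\<close> where the leading
  coefficient \<open>g J\<close> in the last variable is nonzero, at least \<open>p - J\<close>
  values of that variable give a nonzero value. As \<open>g J\<close> has degree at most
  \<open>d - J\<close>, the previous inequality makes the product of both bounds at least as large
  as claimed.\<close>

lemma card_nonzeros_ge:
  fixes f :: "(nat \<Rightarrow> 'a::finite_field) \<Rightarrow> 'a"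
  assumes "poly_fun n d f" "\<exists>x\<in>affine_points n. f x \<noteq> 0"
  shows "real CARD('a) powr (real n - real d / (real CARD('a) - 1))
      \<le> real (card {x \<in> affine_points n. f x \<noteq> 0})"
  using assms
proof (induction n arbitrary: d f)
  case 0
  have "{x \<in> affine_points 0. f x \<noteq> 0} = {\<lambda>_. undefined}"
    using 0(2) by (auto simp: affine_points_def)
  moreover have "real CARD('a) powr (- (real d / (real CARD('a) - 1))) \<le> real CARD('a) powr 0"
    using two_le_CARD[where 'a = 'a] by (intro powr_mono) auto
  ultimately show ?case by simp
next
  case (Suc n)
  define p where "p = CARD('a)"
  have p: "p \<ge> 2" using two_le_CARD[where 'a = 'a] by (simp add: p_def)
  define A where "A = (affine_points n :: (nat \<Rightarrow> 'a) set)"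
  obtain g where g: "\<And>j. if j \<le> d then poly_fun n (d - j) (g j) else g j = (\<lambda>_. 0)"
      "\<And>x. f x = (\<Sum>j<p. x n ^ j * g j x)"
    using poly_fun_expand_last[OF Suc.prems(1)] unfolding p_def by blast
  have gpf: "\<exists>d. poly_fun n d (g j)" for j
    using g(1)[of j] by (cases "j \<le> d") (auto intro: poly_fun.const)
  have g_upd: "g j (y(n := t)) = g j y" for j y t
    using gpf[of j] by (auto intro: poly_fun_cong)
  have f_upd: "f (y(n := t)) = (\<Sum>j<p. t ^ j * g j y)" for y t
    unfolding g(2) by (simp add: g_upd)
  define S where "S = {j. j < p \<and> (\<exists>y\<in>A. g j y \<noteq> 0)}"
  have finS: "finite S" by (simp add: S_def)
  have img: "affine_points (Suc n) = (\<lambda>(t, y). y(n := t)) ` (UNIV \<times> A)"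
    using bij_betw_affine_points_Suc[where 'a = 'a and n = n] by (simp add: bij_betw_def A_def)
  have "S \<noteq> {}"
  proof
    assume "S = {}"
    then have "f (y(n := t)) = 0" if "y \<in> A" for y t
      unfolding f_upd using that by (intro sum.neutral) (auto simp: S_def)
    then show False using Suc.prems(2) unfolding img by auto
  qed
  define J where "J = Max S"
  have "J \<in> S" using Max_in finS \<open>S \<noteq> {}\<close> by (simp add: J_def)
  then have J: "J < p" "\<exists>y\<in>A. g J y \<noteq> 0" by (auto simp: S_def)
  then have "g J \<noteq> (\<lambda>_. 0)" by auto
  then have Jd: "J \<le> d" "poly_fun n (d - J) (g J)" using g(1)[of J] by (auto split: if_splits)
  have above: "g j y = 0" if "j < p" "J < j" "y \<in> A" for j y
  proof -
    have "j \<notin> S" using that(2) Max_ge[OF finS, of j] by (auto simp: J_def)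
    then show ?thesis using that by (auto simp: S_def)
  qed
  have f_J: "f (y(n := t)) = (\<Sum>j\<le>J. t ^ j * g j y)" if "y \<in> A" for y t
    unfolding f_upd using J above that by (intro sum.mono_neutral_right) auto
  define Y where "Y = {y \<in> A. g J y \<noteq> 0}"
  have finA: "finite A" by (simp add: A_def finite_affine_points)
  have "real p powr (real (Suc n) - real d / (real p - 1)) =
      real p powr (1 - real J / (real p - 1)) * real p powr (real n - real (d - J) / (real p - 1))"
    using Jd(1) p by (simp add: powr_add[symmetric] of_nat_diff diff_divide_distrib algebra_simps)
  also have "\<dots> \<le> real (p - J) * real (card Y)"
    using powr_le_chord[OF p J(1)] Suc.IH[OF Jd(2)] J(2)
    by (intro mult_mono) (auto simp: Y_def A_def p_def)
  also have "(p - J) * card Y \<le> (\<Sum>y\<in>Y. card {t. f (y(n := t)) \<noteq> 0})"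
  proof -
    have "p - J \<le> card {t. f (y(n := t)) \<noteq> 0}" if "y \<in> Y" for y
      using card_univariate_nonzeros_ge[of "\<lambda>j. g j y" J] that by (simp add: Y_def f_J p_def)
    then have "(\<Sum>y\<in>Y. p - J) \<le> (\<Sum>y\<in>Y. card {t. f (y(n := t)) \<noteq> 0})" by (rule sum_mono)
    then show ?thesis by (simp add: mult.commute)
  qed
  then have "real (p - J) * real (card Y) \<le> real (\<Sum>y\<in>Y. card {t. f (y(n := t)) \<noteq> 0})"
    by (metis of_nat_le_iff of_nat_mult)
  also have "(\<Sum>y\<in>Y. card {t. f (y(n := t)) \<noteq> 0}) = card (SIGMA y:Y. {t. f (y(n := t)) \<noteq> 0})"
    using finA by (subst card_SigmaI) (auto simp: Y_def)
  also have "\<dots> \<le> card {x \<in> affine_points (Suc n). f x \<noteq> 0}"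
  proof (rule card_inj_on_le)
    show "inj_on (\<lambda>(y, t). y(n := t)) (SIGMA y:Y. {t. f (y(n := t)) \<noteq> 0})"
      using bij_betw_affine_points_Suc[where 'a = 'a and n = n]
      by (auto simp: bij_betw_def inj_on_def Y_def A_def)
    show "(\<lambda>(y, t). y(n := t)) ` (SIGMA y:Y. {t. f (y(n := t)) \<noteq> 0}) \<subseteq> {x \<in> affine_points (Suc n). f
        x \<noteq> 0}"
      unfolding img by (auto simp: Y_def)
  qed (simp add: finite_affine_points)
  finally show ?case by (simp add: p_def)
qed

text \<open>
  Warning's second theorem, by applying the previous bound to the indicator function of the
  variety.
\<close>

lemma card_zeros_ge:
  fixes f :: "nat \<Rightarrow> (nat \<Rightarrow> 'a::finite_field) \<Rightarrow> 'a"
  assumes "\<forall>j<s. poly_fun n k (f j)" "zeros n s f \<noteq> {}"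
  shows "real CARD('a) ^ n \<le> real CARD('a) ^ (k * s) * real (card (zeros n s f))"
proof -
  define p where "p = CARD('a)"
  have p: "p \<ge> 2" using two_le_CARD[where 'a = 'a] by (simp add: p_def)
  \<comment> \<open>By Fermat each factor is 1 on the zeros of \<open>f j\<close> and 0 elsewhere.
    The degree \<open>s * ((p - 1) * k)\<close> contains the factor \<open>p - 1\<close> that the
    bound on nonzeros divides out again.\<close>
  define F where "F = (\<lambda>x. \<Prod>j<s. 1 - f j x ^ (p - 1))"
  have "poly_fun n ((p - 1) * k) (\<lambda>x. 1 - f j x ^ (p - 1))" if "j < s" for j
    using assms that by (intro poly_fun_diff poly_fun.const poly_fun_power) auto
  then have pF: "poly_fun n (s * ((p - 1) * k)) F"
    using poly_fun_prod[of "{..<s}" n "(p - 1) * k" "\<lambda>j x. 1 - f j x ^ (p - 1)"]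
        by (simp add: F_def)
  have unit: "a ^ (p - 1) = 1" if "a \<noteq> 0" for a :: 'a
  proof -
    have "a * a ^ (p - 1) = a * 1"
      using finite_field_power_card_eq_same[of a] p unfolding p_def[symmetric]
      by (metis Suc_diff_1 less_le_trans mult.right_neutral pos2 power_Suc)
    then show ?thesis using that by simp
  qed
  have "F x \<noteq> 0 \<longleftrightarrow> (\<forall>j<s. f j x = 0)" for x
    using p unit by (auto simp: F_def zero_power)
  then have Z: "zeros n s f = {x \<in> affine_points n. F x \<noteq> 0}" by (auto simp: zeros_def)
  have e: "real (s * ((p - 1) * k)) / (real p - 1) = real (k * s)"
    using p by (simp add: of_nat_diff field_simps)
  have "real p powr (real n - real (k * s)) \<le> real (card (zeros n s f))"
    using card_nonzeros_ge[OF pF] assms(2) e unfolding Z by (auto simp: p_def)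
  moreover have "real p powr (real n - real (k * s)) = real p ^ n / real p ^ (k * s)"
    unfolding powr_diff using p by (simp only: powr_realpow)
  ultimately have "real p ^ n / real p ^ (k * s) \<le> real (card (zeros n s f))" by simp
  then show ?thesis using p by (simp add: pos_divide_le_eq p_def mult.commute)
qed

text \<open>If \<open>f x\<close> differs from \<open>c\<close>, the level set of \<open>f\<close>
  through \<open>x\<close> is a nonempty hypersurface of degree \<open>k\<close>; Warning's bound
  makes it too large to fit into the exceptional set.\<close>

lemma poly_fun_eq_constI:
  fixes f :: "(nat \<Rightarrow> 'a::finite_field) \<Rightarrow> 'a"
  assumes "poly_fun n k f" "CARD('a) ^ k * card {x \<in> affine_points n. f x \<noteq> c} < CARD('a) ^ n"
    and "x \<in> affine_points n"
  shows "f x = c"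
proof (rule ccontr)
  assume "f x \<noteq> c"
  let ?Z = "zeros n 1 (\<lambda>_ y. f y - f x)"
  have "real CARD('a) ^ n \<le> real CARD('a) ^ (k * 1) * real (card ?Z)"
    using assms by (intro card_zeros_ge) (auto simp: zeros_def intro!: poly_fun_diff poly_fun.const)
  also have "card ?Z \<le> card {x \<in> affine_points n. f x \<noteq> c}"
    using \<open>f x \<noteq> c\<close> by (intro card_mono) (auto simp: zeros_def finite_affine_points)
  finally have "real (CARD('a) ^ n) \<le> real (CARD('a) ^ k * card {x \<in> affine_points n. f x \<noteq> c})"
    by (simp add: mult_left_mono)
  then show False using assms(2) by linarith
qed

section \<open>Counting biased polynomials\<close>

text \<open>Primality of the order in the form in which it is used: 1 generates the additive group.
  Hence periods and near-periods propagate to all multiples, and the characteristic equals the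
  order.\<close>

class prime_field = finite_field +
  assumes ex_of_nat: "\<exists>i<card (UNIV :: 'a set). x = of_nat i"

instance mod_ring :: (prime_card) prime_field
proof
  fix x :: "'a mod_ring"
  show "\<exists>i<card (UNIV :: 'a mod_ring set). x = of_nat i"
    using surj_of_nat_mod_ring[of x] by simp
qed

lemma CARD_real_ge_2: "2 \<le> real CARD('a::{finite, zero_neq_one})"
  using two_le_CARD[where 'a = 'a] by simp

section \<open>Averages along random lines\<close>

definition shift :: "nat \<Rightarrow> (nat \<Rightarrow> 'a::comm_ring_1) \<Rightarrow> 'a \<Rightarrow> (nat \<Rightarrow> 'a) \<Rightarrow> nat \<Rightarrow> 'a" where
  "shift n h c x = (\<lambda>i\<in>{..<n}. x i + c * h i)"

lemma shift_in [simp]: "shift n h c x \<in> affine_points n"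
  by (simp add: shift_def affine_points_def)

lemma affine_points_eqI:
  "x \<in> affine_points n \<Longrightarrow> y \<in> affine_points n \<Longrightarrow> (\<And>i. i < n \<Longrightarrow> x i = y i) \<Longrightarrow> x = y"
  unfolding affine_points_def by (rule PiE_ext) auto

lemma shift_shift: "shift n h c' (shift n h c x) = shift n h (c + c') x"
  unfolding shift_def by (rule ext) (auto simp: algebra_simps)

lemma shift_0: "x \<in> affine_points n \<Longrightarrow> shift n h 0 x = x"
  by (rule affine_points_eqI[OF shift_in]) (auto simp: shift_def)

lemma bij_betw_shift_point: "bij_betw (shift n h c) (affine_points n) (affine_points n)"
  by (rule bij_betwI[of _ _ _ "shift n h (-c)"]) (auto simp: shift_shift shift_0)

lemma bij_betw_shift_direction:
  fixes c :: "'a::field"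
  assumes "c \<noteq> 0"
  shows "bij_betw (\<lambda>h. shift n h c x) (affine_points n) (affine_points n)"
proof (rule bij_betwI[of _ _ _ "\<lambda>y. \<lambda>i\<in>{..<n}. (y i - x i) / c"])
  fix h :: "nat \<Rightarrow> 'a" assume "h \<in> affine_points n"
  then show "(\<lambda>i\<in>{..<n}. (shift n h c x i - x i) / c) = h"
    using assms by (intro affine_points_eqI[of _ n]) (auto simp: affine_points_def shift_def)
next
  fix y :: "nat \<Rightarrow> 'a" assume "y \<in> affine_points n"
  then show "shift n (\<lambda>i\<in>{..<n}. (y i - x i) / c) c x = y"
    using assms by (intro affine_points_eqI[OF shift_in]) (auto simp: shift_def)
qed (auto, auto simp: affine_points_def)

definition avg :: "nat \<Rightarrow> (nat \<Rightarrow> 'a::finite_field) \<Rightarrow> ((nat \<Rightarrow> 'a) \<Rightarrow> real) \<Rightarrow> (nat \<Rightarrow> 'a) \<Rightarrow> real" where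
  "avg n h \<phi> x = (\<Sum>c\<in>UNIV. \<phi> (shift n h c x)) / real CARD('a)"

lemma sum_shift_point:
  "(\<Sum>x\<in>affine_points n. \<phi> (shift n h c x)) = (\<Sum>x\<in>affine_points n. \<phi> x)"
  by (rule sum.reindex_bij_betw[OF bij_betw_shift_point])

lemma sum_avg:
  fixes \<phi> :: "(nat \<Rightarrow> 'a::finite_field) \<Rightarrow> real"
  shows "(\<Sum>x\<in>affine_points n. avg n h \<phi> x) = (\<Sum>x\<in>affine_points n. \<phi> x)"
  unfolding avg_def sum_divide_distrib[symmetric]
  by (subst sum.swap) (simp add: sum_shift_point)

text \<open>The points of a random line are pairwise independent, so the cross terms vanish.\<close>

lemma sum_avg_square:
  fixes \<phi> :: "(nat \<Rightarrow> 'a::finite_field) \<Rightarrow> real" and n :: nat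
  defines "A \<equiv> affine_points n"
  assumes mean: "(\<Sum>x\<in>A. \<phi> x) = 0"
  shows "(\<Sum>h\<in>A. \<Sum>x\<in>A. (avg n h \<phi> x)\<^sup>2) = real (card A) / real CARD('a) * (\<Sum>x\<in>A. (\<phi> x)\<^sup>2)"
proof -
  define q where "q = real CARD('a)"
  have q: "q > 0" using CARD_real_ge_2[where 'a = 'a] by (simp add: q_def)
  define V where "V = (\<Sum>x\<in>A. (\<phi> x)\<^sup>2)"
  have S: "(\<Sum>h\<in>A. \<Sum>x\<in>A. \<phi> (shift n h c x) * \<phi> (shift n h c' x)) = (if c' = c then real (card A)
      * V else 0)" for c c'
  proof -
    have "(\<Sum>x\<in>A. \<phi> (shift n h c x) * \<phi> (shift n h c' x)) = (\<Sum>x\<in>A. \<phi> x * \<phi> (shift n h (c' - c) x))"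
        for h
      using sum_shift_point[of "\<lambda>x. \<phi> x * \<phi> (shift n h (c' - c) x)" n h c]
      by (simp add: shift_shift A_def)
    then have "(\<Sum>h\<in>A. \<Sum>x\<in>A. \<phi> (shift n h c x) * \<phi> (shift n h c' x)) =
        (\<Sum>h\<in>A. \<Sum>x\<in>A. \<phi> x * \<phi> (shift n h (c' - c) x))" by simp
    also have "\<dots> = (\<Sum>x\<in>A. \<Sum>h\<in>A. \<phi> x * \<phi> (shift n h (c' - c) x))" by (rule sum.swap)
    also have "\<dots> = (\<Sum>x\<in>A. \<phi> x * (\<Sum>h\<in>A. \<phi> (shift n h (c' - c) x)))"
      by (simp only: sum_distrib_left)
    also have "\<dots> = (if c' = c then real (card A) * V else 0)"
    proof (cases "c' = c")
      case True
      then have "(\<Sum>x\<in>A. \<phi> x * (\<Sum>h\<in>A. \<phi> (shift n h (c' - c) x))) = (\<Sum>x\<in>A. real (card A) * (\<phi> x)\<^sup>2)"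
        by (intro sum.cong) (auto simp: A_def shift_0 power2_eq_square)
      then show ?thesis using True by (simp add: V_def sum_distrib_left)
    next
      case False
      then have "(\<Sum>h\<in>A. \<phi> (shift n h (c' - c) x)) = 0" for x
        using mean sum.reindex_bij_betw[OF bij_betw_shift_direction[of "c' - c" n x], of \<phi>]
            by (simp add: A_def)
      then show ?thesis using False by simp
    qed
    finally show ?thesis .
  qed
  have "(\<Sum>h\<in>A. \<Sum>x\<in>A. (avg n h \<phi> x)\<^sup>2) =
      (\<Sum>h\<in>A. \<Sum>x\<in>A. (\<Sum>c\<in>UNIV. \<Sum>c'\<in>UNIV. \<phi> (shift n h c x) * \<phi> (shift n h c' x)) / q\<^sup>2)"
    unfolding avg_def q_def power_divide by (simp add: power2_eq_square sum_product)
  also have "\<dots> = (\<Sum>c\<in>UNIV. \<Sum>c'\<in>UNIV. \<Sum>h\<in>A. \<Sum>x\<in>A. \<phi> (shift n h c x) * \<phi> (shift n h c' x)) / q\<^sup>2"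
    (is "_ = sum ?G UNIV / _")
  proof -
    have "(\<Sum>x\<in>A. \<Sum>c\<in>UNIV. \<Sum>c'\<in>UNIV. \<phi> (shift n h c x) * \<phi> (shift n h c' x)) =
        (\<Sum>c\<in>UNIV. \<Sum>c'\<in>UNIV. \<Sum>x\<in>A. \<phi> (shift n h c x) * \<phi> (shift n h c' x))" for h
      by (subst sum.swap, intro sum.cong refl sum.swap)
    then have "(\<Sum>h\<in>A. \<Sum>x\<in>A. \<Sum>c\<in>UNIV. \<Sum>c'\<in>UNIV. \<phi> (shift n h c x) * \<phi> (shift n h c' x)) =
        (\<Sum>h\<in>A. \<Sum>c\<in>UNIV. \<Sum>c'\<in>UNIV. \<Sum>x\<in>A. \<phi> (shift n h c x) * \<phi> (shift n h c' x))" by simp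
    also have "\<dots> = sum ?G UNIV"
      by (subst sum.swap, intro sum.cong refl sum.swap)
    finally show ?thesis by (simp only: sum_divide_distrib[symmetric])
  qed
  also have "\<dots> = (q * (real (card A) * V)) / q\<^sup>2"
    by (simp add: S sum.delta' q_def)
  also have "\<dots> = real (card A) / q * V" using q by (simp add: power2_eq_square)
  finally show ?thesis by (simp add: q_def V_def)
qed

text \<open>The average over \<open>x + H\<close>, where \<open>H\<close> is spanned by the list,
  written as an average over all coefficient vectors. In this form linearly dependent directions
  need no special treatment.\<close>

primrec avgs :: "nat \<Rightarrow> (nat \<Rightarrow> 'a::finite_field) list \<Rightarrow> ((nat \<Rightarrow> 'a) \<Rightarrow> real) \<Rightarrow> (nat \<Rightarrow> 'a) \<Rightarrow> real"
    where
  "avgs n [] \<phi> = \<phi>"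
| "avgs n (h # hs) \<phi> = avg n h (avgs n hs \<phi>)"

lemma sum_avgs: "(\<Sum>x\<in>affine_points n. avgs n hs \<phi> x) = (\<Sum>x\<in>affine_points n. \<phi> x)"
  by (induction hs) (auto simp: sum_avg)

lemma avgs_diff_const: "avgs n hs (\<lambda>x. \<phi> x - c) = (\<lambda>x. avgs n hs \<phi> x - c)"
  by (induction hs) (auto simp: avg_def fun_eq_iff sum_subtractf diff_divide_distrib)

text \<open>As \<open>e\<close> is constant along the directions, the average at \<open>x\<close>
  only sees points of the level set of \<open>e\<close> through \<open>x\<close>, so the two
  functions have to agree on that level set alone.\<close>

lemma avgs_cong:
  assumes "\<And>h c x. h \<in> set hs \<Longrightarrow> x \<in> affine_points n \<Longrightarrow> e (shift n h c x) = e x"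
    and "\<And>x. x \<in> affine_points n \<Longrightarrow> e x = a \<Longrightarrow> \<phi> x = \<psi> x"
    and "x \<in> affine_points n" "e x = a"
  shows "avgs n hs \<phi> x = avgs n hs \<psi> x"
  using assms
proof (induction hs arbitrary: x)
  case (Cons h hs)
  have "avgs n hs \<phi> (shift n h c x) = avgs n hs \<psi> (shift n h c x)" for c
    using Cons.prems by (intro Cons.IH) auto
  then show ?case by (simp add: avg_def)
qed simp

text \<open>One more averaging along a uniformly random direction divides the total of squares by
  \<open>CARD('a)\<close> in the mean, by \<open>sum_avg_square\<close>. Summing over
  \<open>v\<close> before choosing the direction yields one list that serves all
  \<open>v\<close>.\<close>

lemma ex_avgs_small:
  fixes \<phi> :: "'b::finite \<Rightarrow> (nat \<Rightarrow> 'a::finite_field) \<Rightarrow> real" and n :: nat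
  defines "A \<equiv> affine_points n"
  assumes mean: "\<And>v. (\<Sum>x\<in>A. \<phi> v x) = 0"
  shows "\<exists>hs. length hs = d \<and> set hs \<subseteq> A \<and>
    (\<Sum>v\<in>UNIV. \<Sum>x\<in>A. (avgs n hs (\<phi> v) x)\<^sup>2) \<le> (\<Sum>v\<in>UNIV. \<Sum>x\<in>A. (\<phi> v x)\<^sup>2) / real CARD('a) ^ d"
proof (induction d)
  case (Suc d)
  then obtain hs where hs: "length hs = d" "set hs \<subseteq> A"
    "(\<Sum>v\<in>UNIV. \<Sum>x\<in>A. (avgs n hs (\<phi> v) x)\<^sup>2) \<le> (\<Sum>v\<in>UNIV. \<Sum>x\<in>A. (\<phi> v x)\<^sup>2) / real CARD('a) ^ d"
    by blast
  define q where "q = real CARD('a)"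
  have q: "q > 0" using CARD_real_ge_2[where 'a = 'a] by (simp add: q_def)
  define \<psi> where "\<psi> = (\<lambda>v. avgs n hs (\<phi> v))"
  define V where "V = (\<Sum>v\<in>UNIV. \<Sum>x\<in>A. (\<psi> v x)\<^sup>2)"
  define F where "F = (\<lambda>h. \<Sum>v\<in>UNIV. \<Sum>x\<in>A. (avg n h (\<psi> v) x)\<^sup>2)"
  have finA: "finite A" "A \<noteq> {}" by (auto simp: A_def finite_affine_points affine_points_nonempty)
  have "(\<Sum>h\<in>A. F h) = (\<Sum>v\<in>UNIV. \<Sum>h\<in>A. \<Sum>x\<in>A. (avg n h (\<psi> v) x)\<^sup>2)"
    unfolding F_def by (rule sum.swap)
  also have "\<dots> = (\<Sum>v\<in>UNIV. real (card A) / q * (\<Sum>x\<in>A. (\<psi> v x)\<^sup>2))"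
    unfolding A_def q_def
    by (intro sum.cong refl sum_avg_square) (use mean in \<open>simp add: \<psi>_def sum_avgs A_def\<close>)
  also have "\<dots> = real (card A) / q * V" unfolding V_def by (rule sum_distrib_left[symmetric])
  also have "\<dots> = (\<Sum>h\<in>A. V / q)" by simp
  finally have "\<not> (\<forall>h\<in>A. V / q < F h)"
    using sum_strict_mono[of A "\<lambda>_. V / q" F] finA by auto
  then obtain h where h: "h \<in> A" "F h \<le> V / q" by force
  have "V / q \<le> ((\<Sum>v\<in>UNIV. \<Sum>x\<in>A. (\<phi> v x)\<^sup>2) / q ^ d) / q"
    using hs(3) q by (intro divide_right_mono) (auto simp: V_def \<psi>_def q_def)
  also have "\<dots> = (\<Sum>v\<in>UNIV. \<Sum>x\<in>A. (\<phi> v x)\<^sup>2) / q ^ Suc d" by (simp add: mult.commute)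
  finally have "F h \<le> (\<Sum>v\<in>UNIV. \<Sum>x\<in>A. (\<phi> v x)\<^sup>2) / q ^ Suc d" using h(2) by linarith
  then show ?case using hs h(1)
    by (intro exI[of _ "h # hs"]) (auto simp: F_def \<psi>_def q_def)
qed auto

section \<open>Frequencies of values, bias, and reconstruction from derivatives\<close>

definition freq :: "nat \<Rightarrow> ((nat \<Rightarrow> 'a::finite) \<Rightarrow> 'b) \<Rightarrow> 'b \<Rightarrow> real" where
  "freq n f v = real (card {x \<in> affine_points n. f x = v}) / real (card (affine_points n :: (nat \<Rightarrow>
      'a) set))"

definition biased :: "nat \<Rightarrow> real \<Rightarrow> ((nat \<Rightarrow> 'a::finite) \<Rightarrow> 'a) \<Rightarrow> bool" where
  "biased n \<delta> f \<longleftrightarrow> (\<exists>v. \<bar>freq n f v - 1 / real CARD('a)\<bar> > \<delta>)"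

lemma card_affine_points_pos: "0 < card (affine_points n :: (nat \<Rightarrow> 'a::finite) set)"
  by (simp add: card_gt_0_iff finite_affine_points affine_points_nonempty)

lemma freq_nonneg: "0 \<le> freq n f v" by (simp add: freq_def)

lemma freq_le_1: "freq n f v \<le> 1"
  unfolding freq_def using card_affine_points_pos
  by (auto simp: divide_le_eq_1 intro!: card_mono finite_affine_points)

lemma sum_freq: "(\<Sum>v\<in>UNIV. freq n (f :: (nat \<Rightarrow> 'a::finite) \<Rightarrow> 'b::finite) v) = 1"
proof -
  have "(\<Sum>v\<in>UNIV. card {x \<in> affine_points n. f x = v}) = card (\<Union>v. {x \<in> affine_points n. f x = v})"
    by (rule card_UN_disjoint[symmetric]) (auto simp: finite_affine_points)
  also have "(\<Union>v. {x \<in> affine_points n. f x = v}) = affine_points n" by auto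
  finally show ?thesis using card_affine_points_pos[where 'a = 'a and n = n]
    by (simp add: freq_def sum_divide_distrib[symmetric] of_nat_sum[symmetric] del: of_nat_sum)
qed

lemma sum_centered_indicator:
  "(\<Sum>x\<in>affine_points n. of_bool (f x = v) - freq n (f :: (nat \<Rightarrow> 'a::finite) \<Rightarrow> 'b) v) = 0"
proof -
  have "(\<Sum>x\<in>affine_points n. of_bool (f x = v)) = real (card {x \<in> affine_points n. f x = v})"
    by (simp add: of_bool_def sum.If_cases finite_affine_points Int_def)
  then show ?thesis
    using card_affine_points_pos[where 'a = 'a and n = n] by (simp add: sum_subtractf freq_def)
qed

text \<open>Since the field is prime, all values are reached from one another by steps of size \<open>b\<close>.\<close>

lemma not_biasedI:
  fixes f :: "(nat \<Rightarrow> 'a::prime_field) \<Rightarrow> 'a"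
  assumes "b \<noteq> 0" "\<And>v. \<bar>freq n f (v + b) - freq n f v\<bar> \<le> \<delta> / real CARD('a)"
  shows "\<not> biased n \<delta> f"
proof -
  define q where "q = real CARD('a)"
  have q: "q > 0" using CARD_real_ge_2[where 'a = 'a] by (simp add: q_def)
  have "0 \<le> \<delta> / q" using order_trans[OF abs_ge_zero assms(2)[of 0]] by (simp add: q_def)
  then have \<delta>: "\<delta> \<ge> 0" using q by (simp add: zero_le_divide_iff)
  have step: "\<bar>freq n f (v + of_nat j * b) - freq n f v\<bar> \<le> real j * (\<delta> / q)" for j v
  proof (induction j)
    case (Suc j)
    have "\<bar>freq n f (v + of_nat j * b + b) - freq n f (v + of_nat j * b)\<bar> \<le> \<delta> / q"
      using assms(2) by (simp add: q_def)
    then show ?case using Suc by (simp add: algebra_simps)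
  qed simp
  have near: "\<bar>freq n f u - freq n f v\<bar> \<le> \<delta>" for u v
  proof -
    obtain j where j: "j < CARD('a)" "(u - v) / b = of_nat j" using ex_of_nat by metis
    then have "u = v + of_nat j * b" using assms(1) by (simp add: field_simps)
    then have "\<bar>freq n f u - freq n f v\<bar> \<le> real j * (\<delta> / q)" using step by simp
    also have "\<dots> \<le> q * (\<delta> / q)" using j(1) q \<delta> by (intro mult_right_mono) (auto simp: q_def)
    also have "\<dots> = \<delta>" using q by simp
    finally show ?thesis .
  qed
  have "\<bar>freq n f v - 1 / q\<bar> \<le> \<delta>" for v
  proof -
    have "\<bar>q * freq n f v - 1\<bar> = \<bar>\<Sum>u\<in>UNIV. freq n f v - freq n f u\<bar>"
      by (simp add: sum_subtractf sum_freq q_def)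
    also have "\<dots> \<le> (\<Sum>u\<in>(UNIV :: 'a set). \<delta>)"
      by (rule order_trans[OF sum_abs sum_mono]) (use near in auto)
    also have "\<dots> = q * \<delta>" by (simp add: q_def)
    finally have "\<bar>q * freq n f v - 1\<bar> / q \<le> \<delta>" using q by (simp add: pos_divide_le_eq mult.commute)
    moreover have "\<bar>q * freq n f v - 1\<bar> / q = \<bar>(q * freq n f v - 1) / q\<bar>" using q by simp
    moreover have "(q * freq n f v - 1) / q = freq n f v - 1 / q" using q by (simp add: field_simps)
    ultimately show ?thesis by simp
  qed
  then show ?thesis by (auto simp: biased_def q_def not_less)
qed

lemma invariant_of_derivative_eq_0:
  fixes e :: "(nat \<Rightarrow> 'a::prime_field) \<Rightarrow> 'a"
  assumes "poly_fun n k e" "\<And>x. e (\<lambda>i. x i + h i) = e x"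
  shows "e (shift n h c x) = e x"
proof -
  have *: "e (\<lambda>i. x i + of_nat j * h i) = e x" for j x
  proof (induction j arbitrary: x)
    case (Suc j)
    have "e (\<lambda>i. x i + of_nat (Suc j) * h i) = e (\<lambda>i. (x i + of_nat j * h i) + h i)"
      by (simp add: algebra_simps)
    then show ?case by (simp only: assms(2) Suc)
  qed simp
  obtain j where "c = of_nat j" using ex_of_nat by metis
  moreover have "e (shift n h c x) = e (\<lambda>i. x i + c * h i)"
    by (rule poly_fun_cong[OF assms(1)]) (simp add: shift_def)
  ultimately show ?thesis using * by simp
qed

definition bad_points :: "nat \<Rightarrow> real \<Rightarrow> (nat \<Rightarrow> 'a::finite_field) list \<Rightarrow> ((nat \<Rightarrow> 'a) \<Rightarrow> 'a) \<Rightarrow> (nat \<Rightarrow>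
    'a) set" where
  "bad_points n \<theta> hs f =
     {x \<in> affine_points n. \<exists>v. \<theta> < \<bar>avgs n hs (\<lambda>y. of_bool (f y = v)) x - freq n f v\<bar>}"

text \<open>Chebyshev's inequality for the averages of the centred indicators of the values. Each
  squared deviation is at most 1 before averaging, so the \<open>CARD('a)\<close> values contribute
  at most \<open>CARD('a) * CARD('a) ^ n\<close> in total.\<close>

lemma ex_few_bad_points:
  fixes f :: "(nat \<Rightarrow> 'a::finite_field) \<Rightarrow> 'a"
  assumes "\<theta> > 0"
  shows "\<exists>hs. length hs = d \<and> set hs \<subseteq> affine_points n \<and>
    real (card (bad_points n \<theta> hs f)) * (\<theta>\<^sup>2 * real CARD('a) ^ d)
        \<le> real CARD('a) * real CARD('a) ^ n"
proof -
  define A where "A = (affine_points n :: (nat \<Rightarrow> 'a) set)"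
  have finA: "finite A" by (auto simp: A_def finite_affine_points)
  define q where "q = real CARD('a)"
  have q: "q > 0" using CARD_real_ge_2[where 'a = 'a] by (simp add: q_def)
  define \<phi> where "\<phi> = (\<lambda>v x. of_bool (f x = v) - freq n f v)"
  obtain hs where hs: "length hs = d" "set hs \<subseteq> A"
     "(\<Sum>v\<in>UNIV. \<Sum>x\<in>A. (avgs n hs (\<phi> v) x)\<^sup>2) \<le> (\<Sum>v\<in>UNIV. \<Sum>x\<in>A. (\<phi> v x)\<^sup>2) / q ^ d"
    using ex_avgs_small[where n = n and \<phi> = \<phi> and d = d] sum_centered_indicator[of f _ n]
    unfolding A_def q_def \<phi>_def by blast
  define B where "B = bad_points n \<theta> hs f"
  have "real (card B) * \<theta>\<^sup>2 = (\<Sum>x\<in>B. \<theta>\<^sup>2)" by simp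
  also have "\<dots> \<le> (\<Sum>x\<in>B. \<Sum>v\<in>UNIV. (avgs n hs (\<phi> v) x)\<^sup>2)"
  proof (rule sum_mono)
    fix x assume "x \<in> B"
    then obtain v where "\<theta> < \<bar>avgs n hs (\<phi> v) x\<bar>"
      by (auto simp: B_def bad_points_def \<phi>_def avgs_diff_const)
    then have "\<theta>\<^sup>2 \<le> (avgs n hs (\<phi> v) x)\<^sup>2"
      using assms by (metis abs_le_square_iff abs_of_pos less_imp_le)
    also have "\<dots> \<le> (\<Sum>v\<in>UNIV. (avgs n hs (\<phi> v) x)\<^sup>2)" by (rule member_le_sum) auto
    finally show "\<theta>\<^sup>2 \<le> (\<Sum>v\<in>UNIV. (avgs n hs (\<phi> v) x)\<^sup>2)" .
  qed
  also have "\<dots> \<le> (\<Sum>x\<in>A. \<Sum>v\<in>UNIV. (avgs n hs (\<phi> v) x)\<^sup>2)"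
    using finA by (intro sum_mono2) (auto simp: B_def bad_points_def A_def intro: sum_nonneg)
  also have "\<dots> = (\<Sum>v\<in>UNIV. \<Sum>x\<in>A. (avgs n hs (\<phi> v) x)\<^sup>2)" by (rule sum.swap)
  also have "\<dots> \<le> (\<Sum>v\<in>UNIV. \<Sum>x\<in>A. (\<phi> v x)\<^sup>2) / q ^ d" by (rule hs)
  also have "\<dots> \<le> (\<Sum>v\<in>(UNIV :: 'a set). \<Sum>x\<in>A. 1) / q ^ d"
  proof (intro divide_right_mono sum_mono)
    fix v x show "(\<phi> v x)\<^sup>2 \<le> 1"
      using freq_nonneg[of n f v] freq_le_1[of n f v] unfolding \<phi>_def
          by (auto simp: abs_square_le_1)
  qed (use q in auto)
  also have "\<dots> = q * q ^ n / q ^ d" by (simp add: q_def A_def card_affine_points)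
  finally have "real (card B) * (\<theta>\<^sup>2 * q ^ d) \<le> q * q ^ n"
    using q by (simp add: field_simps)
  then show ?thesis using hs by (auto simp: A_def B_def q_def)
qed

text \<open>The difference \<open>e = f - g\<close> is invariant along the directions, so on
  \<open>x\<close> plus their span the function \<open>f\<close> is \<open>g\<close> plus the
  constant \<open>e x\<close>. At a point that is good for both, the value distribution of
  \<open>f\<close> is therefore close to that of \<open>g\<close> shifted by \<open>e x\<close>. Two
  different values of \<open>e\<close> at good points would make the distribution of
  \<open>g\<close> almost invariant under a nonzero shift, and \<open>g\<close> would not be biased.
  So \<open>e\<close> is constant off a small set, hence everywhere by Warning's bound.\<close>

lemma eq_up_to_const_if_same_derivatives:
  fixes f g :: "(nat \<Rightarrow> 'a::prime_field) \<Rightarrow> 'a"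
  assumes f: "poly_fun n k f" and g: "poly_fun n k g" and bias: "biased n \<delta> g"
    and \<theta>: "4 * \<theta> * real CARD('a) \<le> \<delta>"
    and same: "\<And>h x. h \<in> set hs \<Longrightarrow> f (\<lambda>i. x i + h i) - f x = g (\<lambda>i. x i + h i) - g x"
    and few: "real CARD('a) ^ k * real (card (bad_points n \<theta> hs f)) < real CARD('a) ^ n / 2"
      "real CARD('a) ^ k * real (card (bad_points n \<theta> hs g)) < real CARD('a) ^ n / 2"
  shows "\<exists>a. f = (\<lambda>x. g x + a)"
proof -
  define q where "q = real CARD('a)"
  have q: "q > 0" using CARD_real_ge_2[where 'a = 'a] by (simp add: q_def)
  define A where "A = (affine_points n :: (nat \<Rightarrow> 'a) set)"
  have finA: "finite A" by (auto simp: A_def finite_affine_points)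
  define e where "e = (\<lambda>x. f x - g x)"
  have pe: "poly_fun n k e" unfolding e_def by (rule poly_fun_diff[OF f g])
  have "e (\<lambda>i. x i + h i) = e x" if "h \<in> set hs" for h x
    using same[OF that, of x] by (simp add: e_def algebra_simps)
  then have inv: "e (shift n h c x) = e x" if "h \<in> set hs" for h c x
    using invariant_of_derivative_eq_0[OF pe] that by blast
  define B where "B = bad_points n \<theta> hs f \<union> bad_points n \<theta> hs g"
  have close: "\<bar>freq n f v - freq n g (v - e x)\<bar> \<le> 2 * \<theta>" if x: "x \<in> A - B" for x v
  proof -
    have "avgs n hs (\<lambda>y. of_bool (f y = v)) x = avgs n hs (\<lambda>y. of_bool (g y = v - e x)) x"
      using x inv by (intro avgs_cong[of hs n e "e x"]) (auto simp: A_def e_def algebra_simps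
          of_bool_def)
    moreover have "\<bar>avgs n hs (\<lambda>y. of_bool (f y = v)) x - freq n f v\<bar> \<le> \<theta>"
      "\<bar>avgs n hs (\<lambda>y. of_bool (g y = v - e x)) x - freq n g (v - e x)\<bar> \<le> \<theta>"
      using x by (auto simp: B_def bad_points_def A_def not_less)
    ultimately show ?thesis by linarith
  qed
  have const: "e x = e y" if "x \<in> A - B" "y \<in> A - B" for x y
  proof (rule ccontr)
    assume neq: "e x \<noteq> e y"
    \<comment> \<open>Both points compare \<open>g\<close> with the same number
      \<open>freq n f (v + e x)\<close>, at cost \<open>2 * \<theta>\<close> each; the sum
      \<open>4 * \<theta>\<close> is what \<open>not_biasedI\<close> tolerates.\<close>
    have "\<bar>freq n g (v + (e x - e y)) - freq n g v\<bar> \<le> \<delta> / q" for v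
    proof -
      have "\<bar>freq n f (v + e x) - freq n g v\<bar> \<le> 2 * \<theta>"
        using close[OF that(1), of "v + e x"] by simp
      moreover have "\<bar>freq n f (v + e x) - freq n g (v + (e x - e y))\<bar> \<le> 2 * \<theta>"
        using close[OF that(2), of "v + e x"] by (simp add: algebra_simps)
      moreover have "4 * \<theta> \<le> \<delta> / q" using \<theta> q by (simp add: q_def pos_le_divide_eq)
      ultimately show ?thesis by linarith
    qed
    then show False using not_biasedI[of "e x - e y" n g \<delta>] neq bias by (simp add: q_def)
  qed
  have cardB: "q ^ k * real (card B) < q ^ n"
  proof -
    have "real (card B) \<le> real (card (bad_points n \<theta> hs f)) + real (card (bad_points n \<theta> hs g))"
      unfolding B_def by (metis card_Un_le of_nat_add of_nat_le_iff)
    then have "q ^ k * real (card B) \<le> q ^ k * (real (card (bad_points n \<theta> hs f))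
        + real (card (bad_points n \<theta> hs g)))"
      using q by (intro mult_left_mono) auto
    also have "\<dots> < q ^ n" using few by (simp add: q_def distrib_left)
    finally show ?thesis .
  qed
  have BA: "B \<subseteq> A" by (auto simp: B_def bad_points_def A_def)
  have "A - B \<noteq> {}"
  proof
    assume "A - B = {}"
    then have "card B = CARD('a) ^ n" using BA by (metis A_def Diff_eq_empty_iff card_affine_points
        subset_antisym)
    then have B: "real (card B) = q ^ n" by (simp add: q_def)
    have "q \<ge> 1" using CARD_real_ge_2[where 'a = 'a] by (simp add: q_def)
    then have "1 \<le> q ^ k" by (rule one_le_power)
    then have "1 * q ^ n \<le> q ^ k * q ^ n" using q by (intro mult_right_mono) auto
    then show False using cardB B by simp
  qed
  then obtain x0 where x0: "x0 \<in> A - B" by blast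
  have "{x \<in> A. e x \<noteq> e x0} \<subseteq> B" using const x0 by blast
  then have "card {x \<in> A. e x \<noteq> e x0} \<le> card B"
    using finite_subset[OF BA finA] by (intro card_mono)
  then have "q ^ k * real (card {x \<in> A. e x \<noteq> e x0}) \<le> q ^ k * real (card B)"
    using q by (intro mult_left_mono) auto
  then have "q ^ k * real (card {x \<in> A. e x \<noteq> e x0}) < q ^ n" using cardB by (rule le_less_trans)
  then have "real (CARD('a) ^ k * card {x \<in> A. e x \<noteq> e x0}) < real (CARD('a) ^ n)"
    by (simp add: q_def)
  then have "e x = e x0" if "x \<in> A" for x
    using poly_fun_eq_constI[OF pe, of "e x0" x] that by (simp only: of_nat_less_iff A_def)
  \<comment> \<open>The claim concerns functions on all of \<open>nat \<Rightarrow> 'a\<close>, but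
    only the first \<open>n\<close> coordinates matter.\<close>
  moreover have "e x = e (restrict x {..<n})" for x
    by (rule poly_fun_cong[OF pe]) simp
  moreover have "restrict x {..<n} \<in> A" for x by (simp add: A_def affine_points_def)
  ultimately have "e x = e x0" for x by metis
  then have "f x = g x + e x0" for x unfolding e_def by (metis diff_eq_eq add.commute)
  then show ?thesis by blast
qed

text \<open>Up to an additive constant a biased polynomial is encoded by \<open>d\<close> directions
  and the derivatives along them, which have degree \<open>k\<close>. The three factors count the
  constant, a direction and a derivative; \<open>d\<close> must be large enough to leave few bad
  points.\<close>

lemma card_biased_le:
  assumes "\<delta> > 0" "32 * real CARD('a::prime_field) ^ (k + 4) < real CARD('a) ^ d * \<delta>\<^sup>2"
  shows "card {f :: (nat \<Rightarrow> 'a) \<Rightarrow> 'a. poly_fun n (Suc k) f \<and> biased n \<delta> f}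
    \<le> CARD('a) * (CARD('a) ^ n * CARD('a) ^ ((n + k) choose k)) ^ d"
proof -
  define q where "q = real CARD('a)"
  have q: "q > 0" using CARD_real_ge_2[where 'a = 'a] by (simp add: q_def)
  define \<theta> where "\<theta> = \<delta> / (4 * q)"
  have \<theta>: "\<theta> > 0" "4 * \<theta> * q \<le> \<delta>" using assms(1) q by (auto simp: \<theta>_def)
  define B where "B = {f :: (nat \<Rightarrow> 'a) \<Rightarrow> 'a. poly_fun n (Suc k) f \<and> biased n \<delta> f}"
  have "\<exists>hs. length hs = d \<and> set hs \<subseteq> affine_points n \<and> q ^ Suc k * real (card (bad_points n \<theta> hs
      f)) < q ^ n / 2"
    for f :: "(nat \<Rightarrow> 'a) \<Rightarrow> 'a"
  proof -
    obtain hs where hs: "length hs = d" "set hs \<subseteq> affine_points n"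
      "real (card (bad_points n \<theta> hs f)) * (\<theta>\<^sup>2 * q ^ d) \<le> q * q ^ n"
      using ex_few_bad_points[OF \<theta>(1), of d n f] unfolding q_def by blast
    \<comment> \<open>Since \<open>\<theta>\<^sup>2 = \<delta>\<^sup>2 / (16 * q\<^sup>2)\<close>,
      this is the hypothesis on \<open>d\<close>. It leaves fewer than
      \<open>q ^ n / (2 * q ^ (k + 1))\<close> bad points, half of what Warning's bound tolerates in
      degree \<open>Suc k\<close>, because two polynomials will be compared.\<close>
    have "2 * q ^ (k + 2) < \<theta>\<^sup>2 * q ^ d"
      using assms(2) q unfolding \<theta>_def power_divide q_def[symmetric]
      by (simp add: field_simps power_add power2_eq_square eval_nat_numeral)
    then have *: "real (card (bad_points n \<theta> hs f)) * (2 * q ^ (k + 2)) \<le> q * q ^ n"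
      using hs(3) by (meson less_imp_le mult_left_mono of_nat_0_le_iff order_trans)
    have "q ^ Suc k * real (card (bad_points n \<theta> hs f)) < q ^ n / 2"
    proof (cases "card (bad_points n \<theta> hs f) = 0")
      case False
      then have "real (card (bad_points n \<theta> hs f)) * (2 * q ^ (k + 2))
          < real (card (bad_points n \<theta> hs f)) * (\<theta>\<^sup>2 * q ^ d)"
        using \<open>2 * q ^ (k + 2) < \<theta>\<^sup>2 * q ^ d\<close> by (intro mult_strict_left_mono) auto
      then have "real (card (bad_points n \<theta> hs f)) * (2 * q ^ (k + 2)) < q * q ^ n" using hs(3)
          by linarith
      then have "q * (2 * (q ^ Suc k * real (card (bad_points n \<theta> hs f)))) < q * q ^ n"
        by (simp add: mult_ac)
      then show ?thesis using q by (simp add: mult_less_cancel_left_pos)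
    qed (use q in simp)
    then show ?thesis using hs by blast
  qed
  then have "\<forall>f :: (nat \<Rightarrow> 'a) \<Rightarrow> 'a. \<exists>hs. length hs = d \<and> set hs \<subseteq> affine_points n \<and>
      q ^ Suc k * real (card (bad_points n \<theta> hs f)) < q ^ n / 2" by blast
  from choice[OF this] obtain hs :: "((nat \<Rightarrow> 'a) \<Rightarrow> 'a) \<Rightarrow> (nat \<Rightarrow> 'a) list"
    where hs: "\<And>f. length (hs f) = d" "\<And>f. set (hs f) \<subseteq> affine_points n"
      "\<And>f. q ^ Suc k * real (card (bad_points n \<theta> (hs f) f)) < q ^ n / 2" by blast
  define D where "D = (\<lambda>(f :: (nat \<Rightarrow> 'a) \<Rightarrow> 'a) (h :: nat \<Rightarrow> 'a) x. f (\<lambda>i. x i + h i) - f x)"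
  define key where "key = (\<lambda>f. map (\<lambda>h. (h, D f h)) (hs f))"
  define K where "K = {ks. set ks \<subseteq> (affine_points n :: (nat \<Rightarrow> 'a) set) \<times> {f :: (nat \<Rightarrow> 'a) \<Rightarrow> 'a.
      poly_fun n k f} \<and> length ks = d}"
  have finK0: "finite ((affine_points n :: (nat \<Rightarrow> 'a) set) \<times> {f :: (nat \<Rightarrow> 'a) \<Rightarrow> 'a. poly_fun n k
      f})"
    by (intro finite_cartesian_product finite_affine_points finite_poly_fun)
  have finK: "finite K" unfolding K_def by (rule finite_lists_length_eq[OF finK0])
  have keyK: "key f \<in> K" if "f \<in> B" for f
    using that hs(1,2)[of f] unfolding key_def K_def B_def D_def
    by (auto intro: poly_fun_derivative)
  have same: "\<exists>a. f = (\<lambda>x. g x + a)" if "f \<in> B" "g \<in> B" "key f = key g" for f g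
  proof -
    have hs_eq: "hs f = hs g"
      using arg_cong[OF that(3), of "map fst"] by (simp add: key_def o_def)
    then have "D f h = D g h" if "h \<in> set (hs f)" for h
      using \<open>key f = key g\<close> that unfolding key_def by auto
    then have D: "f (\<lambda>i. x i + h i) - f x = g (\<lambda>i. x i + h i) - g x" if "h \<in> set (hs f)" for h x
      using that unfolding D_def by meson
    show ?thesis
    proof (rule eq_up_to_const_if_same_derivatives[of n "Suc k" f g \<delta> \<theta> "hs f"])
      show "real CARD('a) ^ Suc k * real (card (bad_points n \<theta> (hs f) g)) < real CARD('a) ^ n / 2"
        using hs(3)[of g] unfolding hs_eq q_def by simp
    qed (use that \<theta> D hs(3)[of f] in \<open>auto simp: B_def q_def\<close>)
  qed
  \<comment> \<open>One representative per code; every polynomial with the same code differs from it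
    by a constant, recorded by \<open>a\<close>.\<close>
  define rep where "rep = (\<lambda>ks. SOME f. f \<in> B \<and> key f = ks)"
  have rep: "rep (key f) \<in> B \<and> key (rep (key f)) = key f" if "f \<in> B" for f
    unfolding rep_def by (rule someI[of _ f]) (use that in auto)
  have "\<exists>a. f = (\<lambda>x. rep (key f) x + a)" if "f \<in> B" for f
    using same[of f "rep (key f)"] rep[OF that] that by auto
  then obtain a where a: "\<And>f. f \<in> B \<Longrightarrow> f = (\<lambda>x. rep (key f) x + a f)" by metis
  have "inj_on (\<lambda>f. (a f, key f)) B"
  proof (rule inj_onI)
    fix f g assume fg: "f \<in> B" "g \<in> B" "(a f, key f) = (a g, key g)"
    have "f = (\<lambda>x. rep (key f) x + a f)" by (rule a) fact
    also have "\<dots> = (\<lambda>x. rep (key g) x + a g)" using fg(3) by simp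
    also have "\<dots> = g" by (rule a[symmetric]) fact
    finally show "f = g" .
  qed
  then have "card B \<le> card ((UNIV :: 'a set) \<times> K)"
    using keyK finK by (intro card_inj_on_le) auto
  also have "\<dots> = CARD('a) * (CARD('a) ^ n * card {f :: (nat \<Rightarrow> 'a) \<Rightarrow> 'a. poly_fun n k f}) ^ d"
    unfolding card_cartesian_product K_def card_lists_length_eq[OF finK0]
    by (simp add: card_affine_points)
  also have "\<dots> \<le> CARD('a) * (CARD('a) ^ n * CARD('a) ^ ((n + k) choose k)) ^ d"
    by (intro mult_left_mono power_mono mult_left_mono card_poly_fun) auto
  finally show ?thesis unfolding B_def .
qed

section \<open>Bases of biased and unbiased polynomials\<close>

lemma card_dot_eq:
  fixes y :: "nat \<Rightarrow> 'a::finite_field"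
  assumes "j < s" "y j \<noteq> 0"
  shows "CARD('a) * card {l \<in> affine_points s. (\<Sum>i<s. l i * y i) = 0} = CARD('a) ^ s"
proof -
  define F where "F = (\<lambda>v. {l \<in> affine_points s. (\<Sum>i<s. l i * y i) = v})"
  define e where "e = (\<lambda>i. if i = j then 1 / y j else 0)"
  have dot: "(\<Sum>i<s. shift s e c l i * y i) = (\<Sum>i<s. l i * y i) + c" for c l
  proof -
    have "(\<Sum>i<s. shift s e c l i * y i) = (\<Sum>i<s. l i * y i + (if i = j then c else 0))"
      using assms by (intro sum.cong) (auto simp: shift_def e_def algebra_simps)
    then show ?thesis using assms by (simp add: sum.distrib sum.delta)
  qed
  have "card (F v) = card (F 0)" for v
  proof (rule bij_betw_same_card[of "shift s e (- v)"])
    show "bij_betw (shift s e (- v)) (F v) (F 0)"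
      by (rule bij_betwI[of _ _ _ "shift s e v"]) (auto simp: F_def dot shift_shift shift_0)
  qed
  then have "(\<Sum>v\<in>UNIV. card (F v)) = (\<Sum>v\<in>(UNIV :: 'a set). card (F 0))" by (intro sum.cong refl)
  then have "CARD('a) * card (F 0) = (\<Sum>v\<in>UNIV. card (F v))" by simp
  also have "\<dots> = card (\<Union>v. F v)"
    by (rule card_UN_disjoint[symmetric]) (auto simp: F_def finite_affine_points)
  also have "(\<Union>v. F v) = affine_points s" by (auto simp: F_def)
  finally show ?thesis by (simp add: F_def card_affine_points)
qed

text \<open>An orthogonality relation that replaces additive characters: each nonzero
  \<open>y\<close> is annihilated by exactly a proportion \<open>1 / q\<close> of the coefficient
  vectors, so the centred sum detects \<open>y = 0\<close>.\<close>

lemma sum_dot_indicator: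
  fixes y :: "nat \<Rightarrow> 'a::finite_field"
  defines "q \<equiv> real CARD('a)"
  shows "(\<Sum>l\<in>affine_points s. of_bool ((\<Sum>i<s. l i * y i) = 0) - 1 / q) =
    q ^ s * (1 - 1 / q) * of_bool (\<forall>i<s. y i = 0)"
proof -
  have q: "q > 0" using CARD_real_ge_2[where 'a = 'a] by (simp add: q_def)
  have "(\<Sum>l\<in>affine_points s. of_bool ((\<Sum>i<s. l i * y i) = 0) - 1 / q) =
     real (card {l \<in> affine_points s. (\<Sum>i<s. l i * y i) = 0}) - q ^ s / q"
    by (simp add: sum_subtractf of_bool_def sum.If_cases finite_affine_points Int_def
        card_affine_points q_def)
  also have "\<dots> = q ^ s * (1 - 1 / q) * of_bool (\<forall>i<s. y i = 0)"
  proof (cases "\<forall>i<s. y i = 0")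
    case True
    then have "{l \<in> affine_points s. (\<Sum>i<s. l i * y i) = 0} = affine_points s" by auto
    then show ?thesis using True by (simp add: card_affine_points q_def algebra_simps)
  next
    case False
    then obtain j where j: "j < s" "y j \<noteq> 0" by auto
    define N where "N = card {l \<in> affine_points s. (\<Sum>i<s. l i * y i) = 0}"
    have "CARD('a) * N = CARD('a) ^ s"
      unfolding N_def by (rule card_dot_eq[of j s y, OF j])
    then have "real (CARD('a) * N) = real (CARD('a) ^ s)" by simp
    then have "real N = q ^ s / q" using q by (simp add: q_def field_simps)
    then show ?thesis using False unfolding N_def[symmetric] by simp
  qed
  finally show ?thesis .
qed

definition comb :: "nat \<Rightarrow> (nat \<Rightarrow> 'a) \<Rightarrow> (nat \<Rightarrow> 'b \<Rightarrow> 'a::comm_ring_1) \<Rightarrow> 'b \<Rightarrow> 'a" where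
  "comb s l g x = (\<Sum>j<s. l j * g j x)"

lemma sum_comb_zeros:
  fixes g :: "nat \<Rightarrow> (nat \<Rightarrow> 'a::finite_field) \<Rightarrow> 'a"
  defines "q \<equiv> real CARD('a)"
  shows "(\<Sum>l\<in>affine_points s. freq n (comb s l g) 0 - 1 / q) * q ^ n =
     q ^ s * (1 - 1 / q) * real (card (zeros n s g))"
proof -
  have q: "q > 0" using CARD_real_ge_2[where 'a = 'a] by (simp add: q_def)
  let ?A = "affine_points n :: (nat \<Rightarrow> 'a) set"
  have freq: "(freq n f 0 - 1 / q) * q ^ n = (\<Sum>x\<in>?A. of_bool (f x = 0) - 1 / q)"
      for f :: "(nat \<Rightarrow> 'a) \<Rightarrow> 'a"
  proof -
    have "(\<Sum>x\<in>?A. of_bool (f x = 0) - 1 / q) = real (card {x \<in> ?A. f x = 0}) - q ^ n / q"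
      by (simp add: sum_subtractf of_bool_def sum.If_cases finite_affine_points Int_def
        card_affine_points q_def)
    then show ?thesis
      using q by (simp add: freq_def card_affine_points q_def left_diff_distrib)
  qed
  have "(\<Sum>l\<in>affine_points s. freq n (comb s l g) 0 - 1 / q) * q ^ n =
      (\<Sum>l\<in>affine_points s. \<Sum>x\<in>?A. of_bool ((\<Sum>i<s. l i * g i x) = 0) - 1 / q)"
    unfolding sum_distrib_right freq comb_def ..
  also have "\<dots> = (\<Sum>x\<in>?A. \<Sum>l\<in>affine_points s. of_bool ((\<Sum>i<s. l i * g i x) = 0) - 1 / q)"
    by (rule sum.swap)
  also have "\<dots> = (\<Sum>x\<in>?A. q ^ s * (1 - 1 / q) * of_bool (\<forall>i<s. g i x = 0))"
    unfolding q_def by (intro sum.cong refl sum_dot_indicator)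
  also have "\<dots> = q ^ s * (1 - 1 / q) * (\<Sum>x\<in>?A. of_bool (\<forall>i<s. g i x = 0))"
    by (rule sum_distrib_left[symmetric])
  also have "(\<Sum>x\<in>?A. of_bool (\<forall>i<s. g i x = 0)) = real (card (zeros n s g))"
    by (simp add: of_bool_def sum.If_cases finite_affine_points Int_def zeros_def)
  finally show ?thesis .
qed

text \<open>In the identity \<open>sum_comb_zeros\<close> the coefficient vectors supported on the
  first \<open>r\<close> entries reproduce exactly the identity for \<open>r\<close> equations. The
  remaining vectors, at most \<open>q ^ s\<close> of them, contribute at most
  \<open>\<delta> * q ^ n\<close> each. Dividing by \<open>q ^ s * (1 - 1 / q)\<close> and using
  \<open>q \<ge> 2\<close> gives the factor 2.\<close>

lemma card_zeros_approx:
  fixes g :: "nat \<Rightarrow> (nat \<Rightarrow> 'a::finite_field) \<Rightarrow> 'a"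
  defines "q \<equiv> real CARD('a)"
  assumes "r \<le> s" "\<delta> \<ge> 0"
    and unb: "\<And>l j. l \<in> affine_points s \<Longrightarrow> r \<le> j \<Longrightarrow> j < s \<Longrightarrow> l j \<noteq> 0 \<Longrightarrow> \<not> biased n \<delta> (comb s l g)"
  shows "\<bar>real (card (zeros n s g)) - real (card (zeros n r g)) / q ^ (s - r)\<bar> \<le> 2 * \<delta> * q ^ n"
proof -
  have q2: "q \<ge> 2" using CARD_real_ge_2[where 'a = 'a] by (simp add: q_def)
  then have q: "q > 0" by simp
  define F where "F = (\<lambda>l. freq n (comb s l g) 0 - 1 / q)"
  define L :: "(nat \<Rightarrow> 'a) set" where "L = {l \<in> affine_points s. \<forall>j. r \<le> j \<longrightarrow> j < s \<longrightarrow> l j = 0}"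
  have finA: "finite (affine_points s :: (nat \<Rightarrow> 'a) set)" by (rule finite_affine_points)
  have "(\<Sum>l\<in>L. F l) = (\<Sum>l\<in>affine_points r. freq n (comb r l g) 0 - 1 / q)"
  proof (rule sum.reindex_bij_witness[of _ "\<lambda>l. \<lambda>i\<in>{..<s}.
      if i < r then l i else 0" "\<lambda>l. restrict l {..<r}"])
    fix l assume l: "l \<in> L"
    show "(\<lambda>i\<in>{..<s}. if i < r then restrict l {..<r} i else 0) = l"
      using l by (intro affine_points_eqI[of _ s]) (auto simp: L_def affine_points_def)
    have "comb r (restrict l {..<r}) g x = comb s l g x" for x
      unfolding comb_def using l \<open>r \<le> s\<close> by (intro sum.mono_neutral_cong_left) (auto simp: L_def)
    then have "comb r (restrict l {..<r}) g = comb s l g" by (rule ext)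
    then show "freq n (comb r (restrict l {..<r}) g) 0 - 1 / q = F l" unfolding F_def
        by (rule arg_cong)
  next
    fix l :: "nat \<Rightarrow> 'a" assume l: "l \<in> affine_points r"
    show "restrict (\<lambda>i\<in>{..<s}. if i < r then l i else 0) {..<r} = l"
      using l \<open>r \<le> s\<close> by (intro affine_points_eqI[of _ r]) (auto simp: affine_points_def)
  qed (use \<open>r \<le> s\<close> in \<open>auto simp: affine_points_def L_def\<close>)
  then have L: "(\<Sum>l\<in>L. F l) * q ^ n = q ^ r * (1 - 1 / q) * real (card (zeros n r g))"
    by (simp add: sum_comb_zeros q_def)
  have all: "(\<Sum>l\<in>affine_points s. F l) * q ^ n = q ^ s * (1 - 1 / q) * real (card (zeros n s g))"
    unfolding F_def q_def by (rule sum_comb_zeros)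
  have "\<bar>\<Sum>l\<in>affine_points s - L. F l\<bar> \<le> (\<Sum>l\<in>affine_points s - L. \<delta>)"
    by (rule order_trans[OF sum_abs sum_mono])
      (use unb in \<open>force simp: L_def F_def biased_def q_def not_less\<close>)
  also have "\<dots> \<le> (\<Sum>l\<in>(affine_points s :: (nat \<Rightarrow> 'a) set). \<delta>)"
    using \<open>\<delta> \<ge> 0\<close> finA by (intro sum_mono2) auto
  also have "\<dots> = q ^ s * \<delta>" by (simp add: card_affine_points q_def)
  finally have "\<bar>\<Sum>l\<in>affine_points s - L. F l\<bar> \<le> q ^ s * \<delta>" .
  then have "\<bar>(\<Sum>l\<in>affine_points s. F l) - (\<Sum>l\<in>L. F l)\<bar> * q ^ n \<le> q ^ s * \<delta> * q ^ n"
    using finA q by (intro mult_right_mono) (auto simp: sum_diff L_def)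
  then have "\<bar>q ^ s * (1 - 1 / q) * real (card (zeros n s g)) - q ^ r * (1
      - 1 / q) * real (card (zeros n r g))\<bar>
      \<le> q ^ s * \<delta> * q ^ n"
  proof -
    have "q ^ s * (1 - 1 / q) * real (card (zeros n s g)) - q ^ r * (1
        - 1 / q) * real (card (zeros n r g)) =
        ((\<Sum>l\<in>affine_points s. F l) - (\<Sum>l\<in>L. F l)) * q ^ n"
      by (simp only: left_diff_distrib all L)
    moreover have "\<bar>((\<Sum>l\<in>affine_points s. F l) - (\<Sum>l\<in>L. F l)) * q ^ n\<bar> =
        \<bar>(\<Sum>l\<in>affine_points s. F l) - (\<Sum>l\<in>L. F l)\<bar> * q ^ n"
      using q by (simp add: abs_mult)
    ultimately show ?thesis
      using \<open>\<bar>(\<Sum>l\<in>affine_points s. F l) - (\<Sum>l\<in>L. F l)\<bar> * q ^ n \<le> q ^ s * \<delta> * q ^ n\<close> by simp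
  qed
  also have "q ^ s * (1 - 1 / q) * real (card (zeros n s g)) - q ^ r * (1
      - 1 / q) * real (card (zeros n r g)) =
     q ^ s * ((1 - 1 / q) * (real (card (zeros n s g)) - real (card (zeros n r g)) / q ^ (s - r)))"
  proof -
    have "q ^ s = q ^ r * q ^ (s - r)" using \<open>r \<le> s\<close> by (simp flip: power_add)
    then have "q ^ r = q ^ s / q ^ (s - r)" using q by simp
    then show ?thesis using q by (simp add: algebra_simps)
  qed
  finally have "q ^ s * \<bar>(1 - 1 / q) * (real (card (zeros n s g)) - real (card (zeros n r g))
      / q ^ (s - r))\<bar>
      \<le> q ^ s * (\<delta> * q ^ n)"
    using q by (simp add: abs_mult[of "q ^ s"] mult.assoc)
  then have "\<bar>(1 - 1 / q) * (real (card (zeros n s g)) - real (card (zeros n r g)) / q ^ (s - r))\<bar>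
      \<le> \<delta> * q ^ n"
    using q by (simp add: mult_le_cancel_left_pos)
  then have *: "(1 - 1 / q) * \<bar>real (card (zeros n s g)) - real (card (zeros n r g)) / q ^ (s - r)\<bar>
      \<le> \<delta> * q ^ n"
    using q2 by (simp add: abs_mult)
  have "1 / q \<le> 1 / 2" using q2 by (simp add: field_simps)
  then have "(1 / 2) * \<bar>real (card (zeros n s g)) - real (card (zeros n r g)) / q ^ (s - r)\<bar>
     \<le> (1 - 1 / q) * \<bar>real (card (zeros n s g)) - real (card (zeros n r g)) / q ^ (s - r)\<bar>"
    by (intro mult_right_mono) auto
  from order_trans[OF this *] show ?thesis by (simp add: mult_ac)
qed

lemma poly_fun_comb:
  "(\<And>j. j < s \<Longrightarrow> poly_fun n k (g j)) \<Longrightarrow> poly_fun n k (comb s l g)"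
  unfolding comb_def[abs_def] by (intro poly_fun_sum poly_fun_cmult) auto

text \<open>
  As long as some combination involving one of the \<open>g\<^sub>j\<close>, \<open>j \<ge> r\<close>, is biased, it can be exchanged
  for \<open>g\<^sub>j\<close> and moved to position \<open>r\<close>.
\<close>

lemma ex_biased_basis_aux:
  fixes g :: "nat \<Rightarrow> (nat \<Rightarrow> 'a::finite_field) \<Rightarrow> 'a"
  assumes "r \<le> s" "\<forall>j<s. poly_fun n k (g j)" "\<forall>j<r. biased n \<delta> (g j)"
  shows "\<exists>g' r'. r' \<le> s \<and> (\<forall>j<s. poly_fun n k (g' j)) \<and> (\<forall>j<r'. biased n \<delta> (g' j)) \<and>
    zeros n s g' = zeros n s g \<and>
    (\<forall>l\<in>affine_points s. \<forall>j. r' \<le> j \<longrightarrow> j < s \<longrightarrow> l j \<noteq> 0 \<longrightarrow> \<not> biased n \<delta> (comb s l g'))"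
  using assms
proof (induction "s - r" arbitrary: r g rule: less_induct)
  case less
  show ?case
  proof (cases "\<forall>l\<in>affine_points s. \<forall>j. r \<le> j \<longrightarrow> j < s \<longrightarrow> l j \<noteq> 0 \<longrightarrow> \<not> biased n \<delta> (comb s l g)")
    case True
    then show ?thesis using less.prems by blast
  next
    case False
    then obtain l j where l: "r \<le> j" "j < s" "l j \<noteq> 0" "biased n \<delta> (comb s l g)" by blast
    \<comment> \<open>The biased combination takes position \<open>r\<close>, and the displaced
      \<open>g r\<close> takes the place of \<open>g j\<close>, which can be recovered because
      \<open>l j \<noteq> 0\<close>. For \<open>j = r\<close> the combination simply replaces
      \<open>g r\<close>.\<close>
    define g' where "g' = (\<lambda>i. if i = r then comb s l g else if i = j then g r else g i)"
    have "zeros n s g' = zeros n s g"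
    proof (intro equalityI subsetI)
      fix x assume x: "x \<in> zeros n s g"
      then have "comb s l g x = 0" by (auto simp: zeros_def comb_def)
      then show "x \<in> zeros n s g'" using x l by (auto simp: zeros_def g'_def)
    next
      fix x assume x: "x \<in> zeros n s g'"
      then have x': "g' i x = 0" if "i < s" for i using that by (simp add: zeros_def)
      have other: "g i x = 0" if "i < s" "i \<noteq> j" for i
        using x'[of i] x'[of j] l that by (cases "i = r") (auto simp: g'_def split: if_splits)
      have "comb s l g x = 0" using x'[of r] l by (simp add: g'_def)
      moreover have "comb s l g x = l j * g j x + (\<Sum>i\<in>{..<s} - {j}. l i * g i x)"
        unfolding comb_def using l by (intro sum.remove) auto
      moreover have "(\<Sum>i\<in>{..<s} - {j}. l i * g i x) = 0"
        using other by (intro sum.neutral) auto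
      ultimately have "g j x = 0" using l by simp
      then show "x \<in> zeros n s g" using x other by (auto simp: zeros_def)
    qed
    moreover have "\<forall>i<s. poly_fun n k (g' i)"
      using less.prems l by (auto simp: g'_def intro!: poly_fun_comb)
    moreover have "\<forall>i<Suc r. biased n \<delta> (g' i)"
      using less.prems l by (auto simp: g'_def less_Suc_eq)
    ultimately show ?thesis using less.hyps[of "Suc r" g'] l by auto
  qed
qed

text \<open>Only the lower bound for the size is kept, since a union bound has to guard against
  varieties that are too small.\<close>

lemma ex_biased_basis:
  fixes f :: "nat \<Rightarrow> (nat \<Rightarrow> 'a::finite_field) \<Rightarrow> 'a"
  assumes "\<forall>j<s. poly_fun n k (f j)" "\<delta> \<ge> 0"
  obtains g r where "r \<le> s" "\<forall>j<s. poly_fun n k (g j)" "\<forall>j<r. biased n \<delta> (g j)"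
    "zeros n s g = zeros n s f"
    "real (card (zeros n s g)) \<ge> real (card (zeros n r g)) / real CARD('a) ^ (s - r)
        - 2 * \<delta> * real CARD('a) ^ n"
proof -
  obtain g r where g: "r \<le> s" "\<forall>j<s. poly_fun n k (g j)" "\<forall>j<r. biased n \<delta> (g j)"
    "zeros n s g = zeros n s f"
    and unb: "\<forall>l\<in>affine_points s. \<forall>j. r \<le> j \<longrightarrow> j < s \<longrightarrow> l j \<noteq> 0 \<longrightarrow> \<not> biased n \<delta> (comb s l g)"
    using ex_biased_basis_aux[of 0 s n k f \<delta>] assms by auto
  have "\<bar>real (card (zeros n s g)) - real (card (zeros n r g)) / real CARD('a) ^ (s - r)\<bar>
      \<le> 2 * \<delta> * real CARD('a) ^ n"
    by (rule card_zeros_approx) (use g assms unb in auto)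
  with that[of r g] g show thesis by force
qed

section \<open>Pairs of unbiased polynomials\<close>

definition unbiased_pair :: "nat \<Rightarrow> real \<Rightarrow> ((nat \<Rightarrow> 'a::finite_field) \<Rightarrow> 'a) \<Rightarrow> ((nat \<Rightarrow> 'a) \<Rightarrow> 'a) \<Rightarrow>
    bool" where
  "unbiased_pair n \<delta> f g \<longleftrightarrow> (\<forall>a b. (a, b) \<noteq> (0, 0) \<longrightarrow> \<not> biased n \<delta> (\<lambda>x. a * f x + b * g x))"

lemma biased_cmult:
  fixes f :: "(nat \<Rightarrow> 'a::finite_field) \<Rightarrow> 'a"
  assumes "c \<noteq> 0" "biased n \<delta> (\<lambda>x. c * f x)"
  shows "biased n \<delta> f"
proof -
  obtain v where v: "\<bar>freq n (\<lambda>x. c * f x) v - 1 / real CARD('a)\<bar> > \<delta>"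
    using assms(2) by (auto simp: biased_def)
  have "(c * y = v) = (y = v / c)" for y using assms(1) by (auto simp: field_simps)
  then have "freq n (\<lambda>x. c * f x) v = freq n f (v / c)" by (simp add: freq_def)
  then show ?thesis using v by (auto simp: biased_def)
qed

lemma card_zero_approx:
  fixes f :: "(nat \<Rightarrow> 'a::finite_field) \<Rightarrow> 'a"
  assumes "\<not> biased n \<delta> f"
  shows "\<bar>real (card {x \<in> affine_points n. f x = 0}) - real CARD('a) ^ n / real CARD('a)\<bar>
      \<le> \<delta> * real CARD('a) ^ n"
proof -
  have "\<bar>freq n f 0 - 1 / real CARD('a)\<bar> \<le> \<delta>" using assms by (auto simp: biased_def not_less)
  then have "\<bar>freq n f 0 - 1 / real CARD('a)\<bar> * real CARD('a) ^ n \<le> \<delta> * real CARD('a) ^ n"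
    by (rule mult_right_mono) simp
  moreover have "\<bar>freq n f 0 - 1 / real CARD('a)\<bar> * real CARD('a) ^ n = \<bar>(freq n f 0
      - 1 / real CARD('a)) * real CARD('a) ^ n\<bar>"
    by (simp add: abs_mult)
  moreover have "(freq n f 0 - 1 / real CARD('a)) * real CARD('a) ^ n =
      real (card {x \<in> affine_points n. f x = 0}) - real CARD('a) ^ n / real CARD('a)"
    by (simp add: freq_def card_affine_points left_diff_distrib)
  ultimately show ?thesis by simp
qed

text \<open>Inclusion-exclusion: each of the two zero sets contributes an error
  \<open>\<delta>\<close>, and the common zeros, estimated as a system with \<open>r = 0\<close>,
  contribute \<open>2 * \<delta>\<close>. An upper bound is all that a second moment
  requires.\<close>

lemma card_both_nonzero_le:
  fixes f g :: "(nat \<Rightarrow> 'a::finite_field) \<Rightarrow> 'a"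
  defines "q \<equiv> real CARD('a)"
  assumes "unbiased_pair n \<delta> f g" "\<delta> \<ge> 0"
  shows "real (card {x \<in> affine_points n. f x \<noteq> 0 \<and> g x \<noteq> 0}) \<le> ((1 - 1 / q)\<^sup>2 + 4 * \<delta>) * q ^ n"
proof -
  have q2: "q \<ge> 2" using CARD_real_ge_2[where 'a = 'a] by (simp add: q_def)
  let ?A = "affine_points n :: (nat \<Rightarrow> 'a) set"
  let ?Z = "\<lambda>f. {x \<in> ?A. f x = 0}"
  have finA: "finite ?A" by (rule finite_affine_points)
  have "\<not> biased n \<delta> f" "\<not> biased n \<delta> g"
    using assms(2) unfolding unbiased_pair_def by (force dest: spec[of _ 1] spec[of _ 0])+
  then have 1: "real (card (?Z f)) \<ge> q ^ n / q - \<delta> * q ^ n" "real (card (?Z g)) \<ge> q ^ n / q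
      - \<delta> * q ^ n"
    using card_zero_approx[of n \<delta> f] card_zero_approx[of n \<delta> g] by (auto simp: q_def)
  define h where "h = (\<lambda>j :: nat. if j = 0 then f else g)"
  have "\<bar>real (card (zeros n 2 h)) - real (card (zeros n 0 h)) / q ^ (2 - 0)\<bar> \<le> 2 * \<delta> * q ^ n"
    unfolding q_def
  proof (rule card_zeros_approx)
    fix l :: "nat \<Rightarrow> 'a" and j assume "j < 2" "l j \<noteq> 0"
    then have "(l 0, l 1) \<noteq> (0, 0)" by (auto simp: less_2_cases_iff)
    moreover have "comb 2 l h = (\<lambda>x. l 0 * f x + l 1 * g x)"
      by (auto simp: comb_def h_def eval_nat_numeral)
    ultimately show "\<not> biased n \<delta> (comb 2 l h)" using assms(2) unfolding unbiased_pair_def by metis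
  qed (use assms in auto)
  moreover have "zeros n 2 h = ?Z f \<inter> ?Z g"
    by (auto simp: zeros_def h_def less_2_cases_iff)
  moreover have "card (zeros n 0 h) = CARD('a) ^ n" by (simp add: zeros_def card_affine_points)
  ultimately have 2: "real (card (?Z f \<inter> ?Z g)) \<le> q ^ n / q\<^sup>2 + 2 * \<delta> * q ^ n" by (simp add: q_def)
  have "{x \<in> ?A. f x \<noteq> 0 \<and> g x \<noteq> 0} = ?A - (?Z f \<union> ?Z g)" by auto
  then have "real (card {x \<in> ?A. f x \<noteq> 0 \<and> g x \<noteq> 0}) = real (card ?A) - real (card (?Z f \<union> ?Z g))"
    using finA by (simp add: card_Diff_subset of_nat_diff card_mono)
  also have "real (card (?Z f \<union> ?Z g)) = real (card (?Z f)) + real (card (?Z g))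
      - real (card (?Z f \<inter> ?Z g))"
    using card_Un_Int[of "?Z f" "?Z g"] finA by simp
  also have "real (card ?A) = q ^ n" by (simp add: card_affine_points q_def)
  finally have "real (card {x \<in> ?A. f x \<noteq> 0 \<and> g x \<noteq> 0}) \<le>
      q ^ n - (q ^ n / q - \<delta> * q ^ n) - (q ^ n / q - \<delta> * q ^ n) + (q ^ n / q\<^sup>2 + 2 * \<delta> * q ^ n)"
    using 1 2 by linarith
  also have "\<dots> = ((1 - 1 / q)\<^sup>2 + 4 * \<delta>) * q ^ n"
    using q2 by (simp add: field_simps power2_eq_square)
  finally show ?thesis .
qed

text \<open>A correlated pair \<open>(f, g)\<close> has a biased combination
  \<open>a * f + b * g\<close> with \<open>b \<noteq> 0\<close>, as \<open>f\<close> alone is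
  unbiased. Then \<open>g\<close> can be recovered from \<open>a\<close>, \<open>b\<close>,
  \<open>f\<close> and this combination.\<close>

lemma card_not_unbiased_pairs_le:
  fixes n k \<delta>
  defines "P \<equiv> {f :: (nat \<Rightarrow> 'a::finite_field) \<Rightarrow> 'a. poly_fun n k f}"
  defines "Q \<equiv> {f \<in> P. \<not> biased n \<delta> f}"
  shows "card {(f, g) \<in> Q \<times> Q. \<not> unbiased_pair n \<delta> f g} \<le> CARD('a) ^ 2 * card {f \<in> P. biased n \<delta> f}
      * card Q"
proof -
  define D where "D = {(f, g) \<in> Q \<times> Q. \<not> unbiased_pair n \<delta> f g}"
  have fin: "finite P" "finite Q" unfolding Q_def P_def using finite_poly_fun[of n k, where 'a = 'a]
      by auto
  have "\<exists>a b. b \<noteq> 0 \<and> biased n \<delta> (\<lambda>x. a * f x + b * g x)" if "(f, g) \<in> D" for f g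
  proof -
    have "\<not> unbiased_pair n \<delta> f g" using that by (simp add: D_def)
    then obtain a b where ab: "(a, b) \<noteq> (0, 0)" "biased n \<delta> (\<lambda>x. a * f x + b * g x)"
      unfolding unbiased_pair_def by blast
    have "b \<noteq> 0"
    proof
      assume "b = 0"
      then have "biased n \<delta> f" using ab biased_cmult[of a n \<delta> f] by auto
      then show False using that by (auto simp: D_def Q_def)
    qed
    then show ?thesis using ab by blast
  qed
  then have "\<forall>z\<in>D. \<exists>ab. snd ab \<noteq> 0 \<and> biased n \<delta> (\<lambda>x. fst ab * fst z x + snd ab * snd z x)"
    by fastforce
  then obtain w where w: "\<And>z. z \<in> D \<Longrightarrow> snd (w z) \<noteq> 0"
    "\<And>z. z \<in> D \<Longrightarrow> biased n \<delta> (\<lambda>x. fst (w z) * fst z x + snd (w z) * snd z x)" by metis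
  define \<Phi> where "\<Phi> = (\<lambda>z. (w z, (\<lambda>x. fst (w z) * fst z x + snd (w z) * snd z x), fst z))"
  have "inj_on \<Phi> D"
  proof (rule inj_onI)
    fix z z' assume z: "z \<in> D" "z' \<in> D" and eq: "\<Phi> z = \<Phi> z'"
    then have e: "w z = w z'" "fst z = fst z'"
      "(\<lambda>x. fst (w z) * fst z x + snd (w z) * snd z x) = (\<lambda>x. fst (w z') * fst z' x + snd (w z')
          * snd z' x)"
      by (auto simp: \<Phi>_def)
    have "snd z x = snd z' x" for x
      using fun_cong[OF e(3), of x] e(1,2) w(1)[OF z(1)] by simp
    then show "z = z'" using e(2) by (intro prod_eqI) auto
  qed
  moreover have "\<Phi> ` D \<subseteq> UNIV \<times> {f \<in> P. biased n \<delta> f} \<times> Q"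
    using w(2) by (auto simp: \<Phi>_def D_def Q_def P_def intro!: poly_fun.add poly_fun_cmult) 
  ultimately have "card D \<le> card ((UNIV :: ('a \<times> 'a) set) \<times> {f \<in> P. biased n \<delta> f} \<times> Q)"
    using fin by (intro card_inj_on_le) auto
  then show ?thesis by (simp add: D_def card_cartesian_product power2_eq_square mult.assoc)
qed

section \<open>Norm forms\<close>

lemma CHAR_prime_field: "CHAR('a::prime_field) = CARD('a)"
proof -
  have pos: "CHAR('a) > 0" by simp
  have "UNIV \<subseteq> (of_nat :: nat \<Rightarrow> 'a) ` {..<CHAR('a)}"
  proof
    fix x :: 'a
    obtain i where "x = of_nat i" using ex_of_nat by metis
    then have "x = of_nat (i mod CHAR('a))" by (simp add: of_nat_eq_iff_cong_CHAR cong_def)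
    then show "x \<in> of_nat ` {..<CHAR('a)}" using pos
        by (intro image_eqI[of _ _ "i mod CHAR('a)"]) auto
  qed
  then have "CARD('a) \<le> card ((of_nat :: nat \<Rightarrow> 'a) ` {..<CHAR('a)})" by (intro card_mono) auto
  also have "\<dots> \<le> CHAR('a)" using card_image_le[of "{..<CHAR('a)}"] by simp
  finally show ?thesis using dvd_imp_le[OF CHAR_dvd_CARD[where 'a = 'a]] by simp
qed

lemma card_roots_alg_closed:
  fixes P :: "'a::alg_closed_field poly"
  assumes "\<And>a. poly P a = 0 \<Longrightarrow> poly (pderiv P) a \<noteq> 0" "P \<noteq> 0"
  shows "card {a. poly P a = 0} = Polynomial.degree P"
proof -
  obtain A c where A: "size A = Polynomial.degree P" "P = Polynomial.smult c (\<Prod>x\<in>#A. [:-x, 1:])"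
    using alg_closed_imp_factorization[OF assms(2)] by blast
  then have "c \<noteq> 0" using assms(2) by auto
  have roots: "{a. poly P a = 0} = set_mset A"
    using \<open>c \<noteq> 0\<close> unfolding A(2) by (auto simp: poly_prod_mset)
  have "count A a = 1" if a: "a \<in># A" for a
  proof (rule ccontr)
    assume "count A a \<noteq> 1"
    with a have "count A a \<ge> 2" by (metis One_nat_def Suc_leI count_greater_zero_iff
        le_neq_implies_less numeral_2_eq_2)
    then have "replicate_mset 2 a \<subseteq># A" by (simp add: count_le_replicate_mset_subset_eq)
    then obtain B where "A = {#a, a#} + B" by (metis mset_subset_eq_exists_conv numeral_2_eq_2
        replicate_mset_0 replicate_mset_Suc)
    then have "P = [:-a, 1:] * ([:-a, 1:] * Polynomial.smult c (\<Prod>x\<in>#B. [:-x, 1:]))"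
      unfolding A(2) by simp
    then obtain R where "P = [:-a, 1:] * ([:-a, 1:] * R)" by blast
    then have "poly (pderiv P) a = 0" by (simp add: pderiv_mult del: mult_pCons_left)
    moreover have "poly P a = 0" using a roots by blast
    ultimately show False using assms(1) by blast
  qed
  then have "size A = card (set_mset A)" by (simp add: size_multiset_overloaded_eq)
  then show ?thesis using A(1) roots by simp
qed

lemma alg_closure_power_CARD_sum:
  fixes y :: "'b \<Rightarrow> 'a::prime_field alg_closure"
  shows "(\<Sum>i\<in>I. y i) ^ (CARD('a) ^ j) = (\<Sum>i\<in>I. y i ^ (CARD('a) ^ j))"
  by (rule freshmans_dream_sum') (simp_all add: CHAR_prime_field[symmetric])

lemma to_ac_power_CARD: "to_ac (c :: 'a::finite_field) ^ (CARD('a) ^ j) = to_ac c"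
  by (metis finite_field_power_card_power_eq_same to_ac_power)

text \<open>The elements counted here form the subfield of order \<open>q ^ k\<close>.\<close>

lemma card_frobenius_fixed:
  assumes "k > 0"
  shows "card {y :: 'a::prime_field alg_closure. y ^ (CARD('a) ^ k) = y} = CARD('a) ^ k"
proof -
  define Q where "Q = CARD('a) ^ k"
  have Q2: "Q \<ge> 2"
    using two_le_CARD[where 'a = 'a] assms self_le_power[of "CARD('a)" k] by (simp add: Q_def)
  define P :: "'a alg_closure poly" where "P = Polynomial.monom 1 Q - Polynomial.monom 1 1"
  have Q0: "(of_nat Q :: 'a alg_closure) = 0"
    unfolding of_nat_eq_0_iff_char_dvd using assms by (simp add: Q_def CHAR_prime_field dvd_power)
  have ev: "poly P y = y ^ Q - y" for y by (simp add: P_def Polynomial.poly_monom)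
  have deg: "Polynomial.degree P = Q"
    unfolding P_def diff_conv_add_uminus using Q2
    by (subst Polynomial.degree_add_eq_left) (auto simp: Polynomial.degree_monom_eq)
  then have "P \<noteq> 0" using Q2 by auto
  have "poly (pderiv P) y = - 1" for y
    by (simp add: P_def pderiv_diff pderiv_monom Q0 Polynomial.poly_monom)
  then have "card {y. poly P y = 0} = Q"
    using card_roots_alg_closed[of P] \<open>P \<noteq> 0\<close> deg by simp
  then show ?thesis by (simp add: ev Q_def)
qed

text \<open>The base field already supplies all \<open>CARD('a)\<close> solutions.\<close>

lemma frobenius_fixed_in_base:
  fixes y :: "'a::prime_field alg_closure"
  assumes "y ^ CARD('a) = y"
  shows "y \<in> range to_ac"
proof -
  let ?S = "{y :: 'a alg_closure. y ^ CARD('a) = y}"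
  have c: "card ?S = CARD('a)" using card_frobenius_fixed[of 1, where 'a = 'a] by simp
  then have "finite ?S" by (metis card.infinite finite_UNIV_card_ge_0 finite_code less_irrefl)
  moreover have "range (to_ac :: 'a \<Rightarrow> _) \<subseteq> ?S" using to_ac_power_CARD[where j = 1 and 'a = 'a]
      by auto
  moreover have "card (range (to_ac :: 'a \<Rightarrow> _)) = CARD('a)"
    by (simp add: card_image inj_to_ac)
  ultimately have "range (to_ac :: 'a \<Rightarrow> _) = ?S" using c by (intro card_subset_eq) auto
  then show ?thesis using assms by blast
qed

text \<open>For \<open>j = k\<close> this is a basis of the field of order
  \<open>CARD('a) ^ k\<close> over the base field, obtained by counting: \<open>j < k\<close>
  elements span at most \<open>CARD('a) ^ j\<close> elements, so some fixed element lies outside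
  their span.\<close>

lemma ex_independent_frobenius_fixed:
  assumes "k > 0" "j \<le> k"
  shows "\<exists>\<beta> :: nat \<Rightarrow> 'a::prime_field alg_closure. (\<forall>i. \<beta> i ^ (CARD('a) ^ k) = \<beta> i) \<and>
    (\<forall>x. (\<Sum>i<j. to_ac (x i) * \<beta> i) = 0 \<longrightarrow> (\<forall>i<j. x i = 0))"
  using assms(2)
proof (induction j)
  case 0
  show ?case
  proof (intro exI[of _ "\<lambda>_. 0"] conjI allI impI)
    have "CARD('a) ^ k \<noteq> 0" by simp
    then show "(0 :: 'a alg_closure) ^ (CARD('a) ^ k) = 0"
        by (rule power_0_left[THEN trans, OF if_not_P])
  qed simp
next
  case (Suc j)
  let ?S = "{y :: 'a alg_closure. y ^ (CARD('a) ^ k) = y}"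
  from Suc.IH[OF Suc_leD[OF Suc.prems]] obtain \<beta> :: "nat \<Rightarrow> 'a alg_closure"
    where b: "(\<forall>i. \<beta> i ^ (CARD('a) ^ k) = \<beta> i) \<and>
      (\<forall>x. (\<Sum>i<j. to_ac (x i) * \<beta> i) = 0 \<longrightarrow> (\<forall>i<j. x i = 0))" by (elim exE)
  have \<beta>1: "\<beta> i ^ (CARD('a) ^ k) = \<beta> i" for i
    by (rule spec[OF conjunct1[OF b]])
  have \<beta>2: "x i = 0" if "(\<Sum>i<j. to_ac (x i) * \<beta> i) = 0" "i < j" for x i
    using mp[OF spec[OF conjunct2[OF b]] that(1)] that(2) by simp
  define span where "span = (\<lambda>x. \<Sum>i<j. to_ac (x i) * \<beta> i) ` (affine_points j :: (nat \<Rightarrow> 'a) set)"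
  have "card span \<le> card (affine_points j :: (nat \<Rightarrow> 'a) set)"
    unfolding span_def by (rule card_image_le[OF finite_affine_points])
  also have "\<dots> = CARD('a) ^ j" by (rule card_affine_points)
  also have "\<dots> < CARD('a) ^ k"
    using Suc.prems two_le_CARD[where 'a = 'a] by (intro power_strict_increasing) auto
  also have "\<dots> = card ?S" using card_frobenius_fixed[OF assms(1)] by metis
  finally have "\<not> ?S \<subseteq> span" using card_mono[of span ?S]
      by (auto simp: span_def finite_affine_points)
  then obtain b where bb: "b ^ (CARD('a) ^ k) = b" "b \<notin> span" by blast
  have in_span: "(\<Sum>i<j. to_ac (x i) * \<beta> i) \<in> span" for x
    unfolding span_def by (rule image_eqI[of _ _ "restrict x {..<j}"]) (auto simp:
        affine_points_def)
  show ?case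
  proof (intro exI[of _ "\<beta>(j := b)"] conjI allI impI)
    fix i show "(\<beta>(j := b)) i ^ (CARD('a) ^ k) = (\<beta>(j := b)) i" using \<beta>1 bb(1) by simp
  next
    fix x :: "nat \<Rightarrow> 'a" and i
    assume 0: "(\<Sum>i<Suc j. to_ac (x i) * (\<beta>(j := b)) i) = 0" and i: "i < Suc j"
    have "(\<Sum>i<j. to_ac (x i) * (\<beta>(j := b)) i) = (\<Sum>i<j. to_ac (x i) * \<beta> i)"
      by (intro sum.cong) auto
    then have eq: "(\<Sum>i<j. to_ac (x i) * \<beta> i) + to_ac (x j) * b = 0" using 0 by simp
    have xj: "x j = 0"
    proof (rule ccontr)
      assume "x j \<noteq> 0"
      have "(\<Sum>i<j. to_ac (x i) * \<beta> i) = - (to_ac (x j) * b)"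
        using eq by (simp add: eq_neg_iff_add_eq_0)
      moreover have "- (to_ac (x j) * b) * to_ac (- 1 / x j) = b"
        using \<open>x j \<noteq> 0\<close> by simp
      ultimately have "b = (\<Sum>i<j. to_ac (x i) * \<beta> i) * to_ac (- 1 / x j)" by (simp only:)
      also have "\<dots> = (\<Sum>i<j. to_ac (- x i / x j) * \<beta> i)"
        unfolding sum_distrib_right by (intro sum.cong refl) simp
      finally show False using in_span bb(2) by metis
    qed
    then have "(\<Sum>i<j. to_ac (x i) * \<beta> i) = 0" using eq by simp
    then show "x i = 0" using \<beta>2[of x i] xj i by (auto simp: less_Suc_eq)
  qed
qed

definition ac_linear :: "('a::field alg_closure \<Rightarrow> 'a) \<Rightarrow> bool" where
  "ac_linear \<pi> \<longleftrightarrow> (\<forall>u v. \<pi> (u + v) = \<pi> u + \<pi> v) \<and> (\<forall>c u. \<pi> (to_ac c * u) = c * \<pi> u)"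

text \<open>Extends 1 to a basis of the closure over the base field. The retraction carries the
  norm, whose values lie in the image of the base field, back to a polynomial function with values
  in the base field.\<close>

lemma ex_ac_linear_retraction: "\<exists>\<pi> :: 'a::field alg_closure \<Rightarrow> 'a. ac_linear \<pi> \<and> (\<forall>c. \<pi> (to_ac c)
    = c)"
proof -
  interpret vector_space_pair "\<lambda>(c :: 'a) v. to_ac c * v" "\<lambda>(c :: 'a) v. c * v"
    by unfold_locales (simp_all add: algebra_simps)
  have "vs1.independent {1}" by simp
  from linear_independent_extend[OF this, of "\<lambda>_. 1"] obtain g where
    g: "Vector_Spaces.linear (\<lambda>c v. to_ac c * v) (*) g" "g 1 = (1 :: 'a)" by auto
  then have "ac_linear g"
    by (auto simp: ac_linear_def Vector_Spaces.linear_iff)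
  moreover have "g (to_ac c) = c" for c
    using \<open>ac_linear g\<close> g(2) unfolding ac_linear_def by (metis mult.right_neutral)
  ultimately show ?thesis by blast
qed

text \<open>
  A function with values in the algebraic closure is a polynomial function over the closure iff
  all its coordinates with respect to a basis over the base field are polynomial functions.
\<close>

definition ac_poly_fun :: "nat \<Rightarrow> nat \<Rightarrow> ((nat \<Rightarrow> 'a::field) \<Rightarrow> 'a alg_closure) \<Rightarrow> bool" where
  "ac_poly_fun n d F \<longleftrightarrow> (\<forall>\<pi>. ac_linear \<pi> \<longrightarrow> poly_fun n d (\<lambda>x. \<pi> (F x)))"

lemma ac_linear_cmult: "ac_linear \<pi> \<Longrightarrow> ac_linear (\<lambda>u. \<pi> (b * u))"
  unfolding ac_linear_def by (metis distrib_left mult.left_commute)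

text \<open>The coefficients \<open>\<beta> i\<close> may lie outside the base field but can be
  absorbed into the functional: \<open>\<lambda>u. \<pi> (\<beta> i * u)\<close> is again linear, so
  each coordinate of the product is a sum of variables times coordinates of
  \<open>F\<close>.\<close>

lemma ac_poly_fun_linear_mult:
  assumes "ac_poly_fun n d F" "\<And>i. i < k \<Longrightarrow> a + i < n"
  shows "ac_poly_fun n (Suc d) (\<lambda>x. (\<Sum>i<k. to_ac (x (a + i)) * \<beta> i) * F x)"
  unfolding ac_poly_fun_def
proof (intro allI impI)
  fix \<pi> :: "'a alg_closure \<Rightarrow> 'a" assume \<pi>: "ac_linear \<pi>"
  have "\<pi> 0 = 0" using \<pi> unfolding ac_linear_def by (metis mult_zero_left to_ac_0)
  then have sum: "\<pi> (\<Sum>i<m. u i) = (\<Sum>i<m. \<pi> (u i))" for u and m :: nat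
    using \<pi> by (induction m) (auto simp: ac_linear_def)
  have "\<pi> ((\<Sum>i<k. to_ac (x (a + i)) * \<beta> i) * F x) = (\<Sum>i<k. x (a + i) * \<pi> (\<beta> i * F x))" for x
    unfolding sum_distrib_right sum using \<pi> by (simp add: ac_linear_def mult.assoc)
  moreover have "poly_fun n (Suc d) (\<lambda>x. \<Sum>i<k. x (a + i) * \<pi> (\<beta> i * F x))"
    using assms ac_linear_cmult[OF \<pi>]
    by (intro poly_fun_sum poly_fun.var_mult) (auto simp: ac_poly_fun_def)
  ultimately show "poly_fun n (Suc d) (\<lambda>x. \<pi> ((\<Sum>i<k. to_ac (x (a + i)) * \<beta> i) * F x))" by simp
qed

text \<open>The norm of the generic element \<open>y x\<close> of the field of order
  \<open>q ^ k\<close>, that is, the product of its \<open>k\<close> conjugates under Frobenius.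
  Since Frobenius fixes the coordinates, every conjugate is a linear form, and the product has
  degree \<open>k\<close>; it vanishes only where \<open>y x = 0\<close>, that is, where all
  \<open>k\<close> coordinates vanish. So one equation of degree \<open>k\<close> cuts out
  codimension \<open>k\<close>, the extreme case of Warning's bound.\<close>

lemma ex_norm_form:
  assumes "k > 0" "a + k \<le> n"
  shows "\<exists>f :: (nat \<Rightarrow> 'a::prime_field) \<Rightarrow> 'a. poly_fun n k f \<and> (\<forall>x. f x = 0 \<longleftrightarrow> (\<forall>i<k. x (a + i) = 0))"
proof -
  define q where "q = CARD('a)"
  obtain \<beta> :: "nat \<Rightarrow> 'a alg_closure" where \<beta>: "\<And>i. \<beta> i ^ (q ^ k) = \<beta> i"
    "\<And>x i. (\<Sum>i<k. to_ac (x i) * \<beta> i) = 0 \<Longrightarrow> i < k \<Longrightarrow> x i = 0"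
    using ex_independent_frobenius_fixed[OF assms(1) order_refl, where 'a = 'a] unfolding q_def
        by blast
  define y where "y = (\<lambda>x. \<Sum>i<k. to_ac (x (a + i)) * \<beta> i)"
  define N where "N = (\<lambda>x. \<Prod>j<k. y x ^ (q ^ j))"
  have pow: "y x ^ (q ^ j) = (\<Sum>i<k. to_ac (x (a + i)) * \<beta> i ^ (q ^ j))" for x j
    unfolding y_def q_def alg_closure_power_CARD_sum power_mult_distrib to_ac_power_CARD ..
  have y_fixed: "y x ^ (q ^ k) = y x" for x unfolding pow \<beta>(1) by (simp add: y_def)
  \<comment> \<open>Frobenius permutes the conjugates cyclically and hence fixes their
    product.\<close>
  have N_fixed: "N x ^ q = N x" for x
  proof -
    obtain m where m: "k = Suc m" using assms(1) by (cases k) auto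
    have "N x ^ q = (\<Prod>j<k. y x ^ (q ^ Suc j))"
      by (simp add: N_def prod_power_distrib power_mult[symmetric] mult.commute)
    also have "\<dots> = (\<Prod>j<m. y x ^ (q ^ Suc j)) * y x ^ (q ^ k)" by (simp add: m)
    also have "\<dots> = y x ^ (q ^ 0) * (\<Prod>j<m. y x ^ (q ^ Suc j))" unfolding y_fixed by simp
    also have "\<dots> = N x" unfolding N_def m by (subst prod.lessThan_Suc_shift) simp
    finally show ?thesis .
  qed
  have N0: "N x = 0 \<longleftrightarrow> (\<forall>i<k. x (a + i) = 0)" for x
  proof -
    have "N x = 0 \<longleftrightarrow> y x = 0" using assms(1) two_le_CARD[where 'a = 'a] by (auto simp: N_def q_def)
    also have "\<dots> \<longleftrightarrow> (\<forall>i<k. x (a + i) = 0)" using \<beta>(2)[of "\<lambda>i. x (a + i)"] by (auto simp: y_def)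
    finally show ?thesis .
  qed
  have "ac_poly_fun n j (\<lambda>x. \<Prod>i<j. y x ^ (q ^ i))" for j
  proof (induction j)
    case 0
    then show ?case by (auto simp: ac_poly_fun_def intro: poly_fun.const)
  next
    case (Suc j)
    have "ac_poly_fun n (Suc j) (\<lambda>x. (\<Sum>i<k. to_ac (x (a + i)) * \<beta> i ^ (q ^ j)) * (\<Prod>i<j. y x ^ (q ^
        i)))"
      using assms(2) by (intro ac_poly_fun_linear_mult Suc) auto
    then show ?case by (simp add: pow mult.commute)
  qed
  then have pN: "ac_poly_fun n k N" unfolding N_def .
  obtain \<pi> :: "'a alg_closure \<Rightarrow> 'a" where \<pi>: "ac_linear \<pi>" "\<And>c. \<pi> (to_ac c) = c"
    using ex_ac_linear_retraction by blast
  show ?thesis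
  proof (intro exI[of _ "\<lambda>x. \<pi> (N x)"] conjI allI)
    show "poly_fun n k (\<lambda>x. \<pi> (N x))" using pN \<pi>(1) by (auto simp: ac_poly_fun_def)
    fix x
    have "N x \<in> range to_ac" using N_fixed by (intro frobenius_fixed_in_base) (simp add: q_def)
    then obtain c where "N x = to_ac c" by blast
    then show "\<pi> (N x) = 0 \<longleftrightarrow> (\<forall>i<k. x (a + i) = 0)" using N0[of x] \<pi>(2) by auto
  qed
qed

section \<open>Random sequences\<close>

lemma sum_prod_sequences:
  fixes h :: "'b \<Rightarrow> real"
  assumes "finite A"
  shows "(\<Sum>x\<in>{..<N} \<rightarrow>\<^sub>E A. \<Prod>i<N. h (x i)) = (\<Sum>a\<in>A. h a) ^ N"
  using prod_sum_PiE[of "{..<N}" "\<lambda>_. A" "\<lambda>_. h"] assms by simp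

text \<open>Counts indices, not points: a repeated point counts once for each occurrence, which
  makes the number a sum of independent variables.\<close>

definition hits :: "nat \<Rightarrow> (nat \<Rightarrow> 'b) \<Rightarrow> 'b set \<Rightarrow> nat" where
  "hits N x W = card {i. i < N \<and> x i \<in> W}"

lemma prod_weight_hits: "(\<Prod>i<N. if x i \<in> W then c else 1) = (c :: real) ^ hits N x W"
  by (simp add: prod.If_cases hits_def Int_def lessThan_def)

lemma sum_if_subset:
  fixes c :: real
  assumes "finite A" "W \<subseteq> A"
  shows "(\<Sum>a\<in>A. if a \<notin> W then 1 else if R a then 0 else c) =
    real (card A) - real (card W) + c * real (card {a \<in> W. \<not> R a})"
proof -
  have finW: "finite W" using assms finite_subset by blast
  have "(\<Sum>a\<in>A. if a \<notin> W then 1 else if R a then 0 else c) =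
      (\<Sum>a\<in>A - W. if a \<notin> W then 1 else if R a then 0 else c) + (\<Sum>a\<in>W. if a \<notin> W then 1 else
          if R a then 0 else c)"
    using assms by (simp add: sum.subset_diff)
  also have "(\<Sum>a\<in>A - W. if a \<notin> W then 1 else if R a then 0 else c) = (\<Sum>a\<in>A - W. 1)"
    by (intro sum.cong) auto
  also have "(\<Sum>a\<in>W. if a \<notin> W then 1 else if R a then 0 else c) = (\<Sum>a\<in>W. if R a then 0 else c)"
    by (intro sum.cong) auto
  also have "\<dots> = (\<Sum>a\<in>{a \<in> W. \<not> R a}. c)"
    using finW by (intro sum.mono_neutral_cong_right) auto
  finally show ?thesis
    using assms finW by (simp add: card_Diff_subset of_nat_diff card_mono mult.commute)
qed

text \<open>Markov's inequality for a product weight, whose mean factorises because the points are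
  independent: the event forces the weight to be at least \<open>1 / K\<close>, while its mean is at
  most \<open>exp (real N * e)\<close>.\<close>

lemma card_sequences_le:
  fixes h :: "'b \<Rightarrow> real"
  assumes A: "finite A" and h0: "\<And>a. h a \<ge> 0" and h: "(\<Sum>a\<in>A. h a) \<le> real (card A) * exp e"
      and "K \<ge> 0"
    and E: "\<And>x. x \<in> {..<N} \<rightarrow>\<^sub>E A \<Longrightarrow> E x \<Longrightarrow> 1 \<le> K * (\<Prod>i<N. h (x i))"
  shows "real (card {x \<in> {..<N} \<rightarrow>\<^sub>E A. E x}) \<le> real (card A) ^ N * (K * exp (real N * e))"
proof -
  let ?F = "{..<N} \<rightarrow>\<^sub>E A"
  have finF: "finite ?F" using A by (intro finite_PiE) auto
  have "real (card {x \<in> ?F. E x}) = (\<Sum>x\<in>{x \<in> ?F. E x}. 1)" by simp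
  also have "\<dots> \<le> (\<Sum>x\<in>{x \<in> ?F. E x}. K * (\<Prod>i<N. h (x i)))"
    by (intro sum_mono E) simp_all
  also have "\<dots> \<le> (\<Sum>x\<in>?F. K * (\<Prod>i<N. h (x i)))"
    using finF h0 \<open>K \<ge> 0\<close> by (intro sum_mono2) (auto intro!: mult_nonneg_nonneg prod_nonneg)
  also have "\<dots> = K * (\<Sum>a\<in>A. h a) ^ N"
    using sum_prod_sequences[OF A(1), where h = h and N = N]
        by (simp add: sum_distrib_left[symmetric])
  also have "\<dots> \<le> K * (real (card A) * exp e) ^ N"
    using h0 h \<open>K \<ge> 0\<close> by (intro mult_left_mono power_mono sum_nonneg)
  also have "\<dots> = real (card A) ^ N * (K * exp (real N * e))"
    by (simp add: power_mult_distrib exp_of_nat_mult[symmetric])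
  finally show ?thesis .
qed

text \<open>Chernoff's bound for the lower tail, with weight \<open>1 / \<beta>\<close> for every
  hit.\<close>

lemma card_few_hits_le:
  fixes W :: "'b set"
  assumes A: "finite A" "W \<subseteq> A" and W: "w * real (card A) \<le> real (card W)" and \<beta>: "\<beta> \<ge> 1"
  shows "real (card {x \<in> {..<N} \<rightarrow>\<^sub>E A. real (hits N x W) < m})
    \<le> real (card A) ^ N * (\<beta> powr m * exp (real N * - (w * (1 - 1 / \<beta>))))"
proof (rule card_sequences_le[where h = "\<lambda>a. if a \<in> W then 1 / \<beta> else 1"])
  have "(\<Sum>a\<in>A. if a \<in> W then 1 / \<beta> else 1) = (\<Sum>a\<in>A. if a \<notin> W then 1 else
      if False then 0 else 1 / \<beta>)"
    by (intro sum.cong) auto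
  also have "\<dots> = real (card A) - real (card W) * (1 - 1 / \<beta>)"
    unfolding sum_if_subset[OF A] by (simp add: algebra_simps)
  also have "\<dots> \<le> real (card A) - w * real (card A) * (1 - 1 / \<beta>)"
    using W \<beta> by (intro diff_left_mono mult_right_mono) auto
  also have "\<dots> = real (card A) * (1 + - (w * (1 - 1 / \<beta>)))" by (simp add: algebra_simps)
  also have "\<dots> \<le> real (card A) * exp (- (w * (1 - 1 / \<beta>)))"
    by (intro mult_left_mono exp_ge_add_one_self) auto
  finally show "(\<Sum>a\<in>A. if a \<in> W then 1 / \<beta> else 1) \<le> real (card A) * exp (- (w * (1 - 1 / \<beta>)))" .
next
  fix x assume "real (hits N x W) < m"
  then have "\<beta> powr real (hits N x W) \<le> \<beta> powr m" using \<beta> by (intro powr_mono) auto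
  then have "\<beta> ^ hits N x W \<le> \<beta> powr m" using \<beta> by (simp add: powr_realpow)
  then show "1 \<le> \<beta> powr m * (\<Prod>i<N. if x i \<in> W then 1 / \<beta> else 1)"
    using \<beta> unfolding prod_weight_hits by (simp add: power_one_over field_simps)
qed (use A \<beta> in auto)

text \<open>Weight 0 on \<open>V\<close> and \<tau> on the rest of \<open>W\<close>: a sequence that
  avoids \<open>V\<close> and hits \<open>W\<close> at least \<open>m\<close> times has weight at
  least \<open>\<tau> powr m\<close>, while the hypothesis keeps the mean weight of a point at most
  \<open>1 + \<eta>\<close>. With \<tau> the reciprocal of the proportion of \<open>W\<close>
  outside \<open>V\<close>, this is the expected probability of avoidance, obtained without
  conditioning on the number of hits.\<close>

lemma card_avoiding_le:
  fixes W :: "'b set"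
  assumes A: "finite A" "V \<subseteq> W" "W \<subseteq> A" and \<tau>: "\<tau> \<ge> 1"
    and V: "\<tau> * (real (card W) - real (card V)) \<le> real (card W) + \<eta> * real (card A)"
  shows "real (card {x \<in> {..<N} \<rightarrow>\<^sub>E A. x ` {..<N} \<inter> V = {} \<and> m \<le> real (hits N x W)})
    \<le> real (card A) ^ N * (\<tau> powr (- m) * exp (real N * \<eta>))"
proof (rule card_sequences_le[where h = "\<lambda>a. if a \<notin> W then 1 else if a \<in> V then 0 else \<tau>"])
  have fin: "finite W" "finite V" using A(1) finite_subset[OF A(3)] finite_subset[OF A(2)] by auto
  have "{a \<in> W. a \<notin> V} = W - V" by auto
  then have cV: "real (card {a \<in> W. a \<notin> V}) = real (card W) - real (card V)"
    using fin A(2) by (simp add: card_Diff_subset of_nat_diff card_mono)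
  have "(\<Sum>a\<in>A. if a \<notin> W then 1 else if a \<in> V then 0 else \<tau>) \<le> real (card A) * (1 + \<eta>)"
    unfolding sum_if_subset[OF A(1,3)] cV using V by (simp add: algebra_simps)
  also have "\<dots> \<le> real (card A) * exp \<eta>" by (intro mult_left_mono exp_ge_add_one_self) auto
  finally show "(\<Sum>a\<in>A. if a \<notin> W then 1 else if a \<in> V then 0 else \<tau>) \<le> real (card A) * exp \<eta>" .
next
  fix x assume x: "x ` {..<N} \<inter> V = {} \<and> m \<le> real (hits N x W)"
  have "(\<Prod>i<N. if x i \<notin> W then 1 else if x i \<in> V then 0 else \<tau>) = (\<Prod>i<N. if x i \<in> W then \<tau> else 1)"
    using x by (intro prod.cong) auto
  also have "\<dots> = \<tau> powr real (hits N x W)"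
    unfolding prod_weight_hits using \<tau> by (simp add: powr_realpow)
  also have "\<dots> \<ge> \<tau> powr m" using x \<tau> by (intro powr_mono) auto
  finally show "1 \<le> \<tau> powr (- m) * (\<Prod>i<N. if x i \<notin> W then 1 else if x i \<in> V then 0 else \<tau>)"
    using \<tau> by (simp add: powr_minus field_simps)
qed (use A \<tau> in auto)

section \<open>From sequences to random subsets\<close>

lemma card_injective_sequences:
  assumes "finite A"
  shows "card {x \<in> {..<N} \<rightarrow>\<^sub>E A. inj_on x {..<N} \<and> P (x ` {..<N})} =
    fact N * card {M. M \<subseteq> A \<and> card M = N \<and> P M}"
proof -
  let ?S = "{M. M \<subseteq> A \<and> card M = N \<and> P M}"
  have finS: "finite ?S" by (rule finite_subset[of _ "Pow A"]) (use assms in auto)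
  have finM: "finite M" if "M \<in> ?S" for M using that assms finite_subset by auto
  have split: "{x \<in> {..<N} \<rightarrow>\<^sub>E A. inj_on x {..<N} \<and> P (x ` {..<N})} =
      (\<Union>M\<in>?S. {x \<in> {..<N} \<rightarrow>\<^sub>E M. inj_on x {..<N}})" (is "?L = ?R")
  proof (intro equalityI subsetI)
    fix x assume "x \<in> ?L"
    then have x: "x \<in> {..<N} \<rightarrow>\<^sub>E A" "inj_on x {..<N}" "P (x ` {..<N})" by simp_all
    have "x ` {..<N} \<subseteq> A" using PiE_mem[OF x(1)] by blast
    moreover have "card (x ` {..<N}) = N" using card_image[OF x(2)] by simp
    moreover have "x \<in> {..<N} \<rightarrow>\<^sub>E x ` {..<N}"
      using PiE_arb[OF x(1)] by (intro PiE_I) simp_all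
    ultimately show "x \<in> ?R" using x by blast
  next
    fix x assume "x \<in> ?R"
    then obtain M where M: "M \<in> ?S" "x \<in> {..<N} \<rightarrow>\<^sub>E M" "inj_on x {..<N}" by auto
    have "x ` {..<N} \<subseteq> M" using PiE_mem[OF M(2)] by blast
    then have eq: "x ` {..<N} = M"
      using finM[OF M(1)] M(1) card_image[OF M(3)] by (intro card_subset_eq) simp_all
    have "x \<in> {..<N} \<rightarrow>\<^sub>E A" using M(1,2) PiE_mono[of "{..<N}" "\<lambda>_. M" "\<lambda>_. A"] by blast
    then show "x \<in> ?L" using M eq by simp
  qed
  have "card (\<Union>M\<in>?S. {x \<in> {..<N} \<rightarrow>\<^sub>E M. inj_on x {..<N}}) =
      (\<Sum>M\<in>?S. card {x \<in> {..<N} \<rightarrow>\<^sub>E M. inj_on x {..<N}})"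
  proof (rule card_UN_disjoint[OF finS])
    show "\<forall>M\<in>?S. finite {x \<in> {..<N} \<rightarrow>\<^sub>E M. inj_on x {..<N}}"
    proof
      fix M assume "M \<in> ?S"
      then have "finite M" by (rule finM)
      then have "finite ({..<N} \<rightarrow>\<^sub>E M)" by (intro finite_PiE finite_lessThan)
      then show "finite {x \<in> {..<N} \<rightarrow>\<^sub>E M. inj_on x {..<N}}" by (rule rev_finite_subset) blast
    qed
    show "\<forall>M\<in>?S. \<forall>M'\<in>?S. M \<noteq> M' \<longrightarrow> {x \<in> {..<N} \<rightarrow>\<^sub>E M. inj_on x {..<N}} \<inter> {x \<in> {..<N} \<rightarrow>\<^sub>E M'. inj_on x
        {..<N}} = {}"
    proof (intro ballI impI)
      fix M M' assume M: "M \<in> ?S" "M' \<in> ?S" "M \<noteq> M'"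
      have im: "x ` {..<N} = M" if "M \<in> ?S" "x \<in> {..<N} \<rightarrow>\<^sub>E M" "inj_on x {..<N}" for x M
      proof -
        have "x ` {..<N} \<subseteq> M" using PiE_mem[OF that(2)] by blast
        then show ?thesis
          using finM[OF that(1)] that(1) card_image[OF that(3)] by (intro card_subset_eq) auto
      qed
      show "{x \<in> {..<N} \<rightarrow>\<^sub>E M. inj_on x {..<N}} \<inter> {x \<in> {..<N} \<rightarrow>\<^sub>E M'. inj_on x {..<N}} = {}"
      proof (rule equals0I)
        fix x assume "x \<in> {x \<in> {..<N} \<rightarrow>\<^sub>E M. inj_on x {..<N}} \<inter> {x \<in> {..<N} \<rightarrow>\<^sub>E M'. inj_on x
            {..<N}}"
        then have x: "x \<in> {..<N} \<rightarrow>\<^sub>E M" "x \<in> {..<N} \<rightarrow>\<^sub>E M'" "inj_on x {..<N}" by simp_all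
        show False using im[OF M(1) x(1,3)] im[OF M(2) x(2,3)] M(3) by simp
      qed
    qed
  qed
  also have "\<dots> = (\<Sum>M\<in>?S. fact N)"
  proof (intro sum.cong refl)
    fix M assume M: "M \<in> ?S"
    have "finite M" using M by (rule finM)
    moreover have "card M = N" using M by blast
    ultimately show "card {x \<in> {..<N} \<rightarrow>\<^sub>E M. inj_on x {..<N}} = fact N"
      using card_inj_on_subset_funcset[of "{..<N}" M "{..<N}"] fact_prod_rev[of N, where 'a = nat]
          by simp
  qed
  finally show ?thesis unfolding split by simp
qed

lemma fact_binomial_ge:
  assumes "N \<le> T" "m \<le> N"
  shows "(T - N) ^ m \<le> fact m * (T choose m)"
  using assms(2)
proof (induction m)
  case (Suc m)
  obtain T' where T': "T = Suc T'" using Suc.prems assms(1) by (cases T) auto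
  have "(T - N) ^ Suc m \<le> (T - m) * (fact m * (T choose m))"
    unfolding power_Suc using Suc assms(1) by (intro mult_mono) auto
  also have "\<dots> = fact m * (Suc m * (T choose Suc m))"
    using Suc_times_binomial_eq[of T' m] binomial_absorb_comp[of T m] unfolding T'
    by (simp add: mult_ac)
  also have "\<dots> = fact (Suc m) * (T choose Suc m)" by (simp add: algebra_simps)
  finally show ?case .
qed simp

lemma prob_random_subset:
  fixes P :: "(nat \<Rightarrow> 'a::finite) set \<Rightarrow> bool"
  assumes "N \<le> CARD('a) ^ n"
  shows "measure_pmf.prob (random_subset n N) {M. P M} =
    real (card {M. M \<subseteq> (affine_points n :: (nat \<Rightarrow> 'a) set) \<and> card M = N
        \<and> P M}) / real (CARD('a) ^ n choose N)"
proof -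
  let ?A = "affine_points n :: (nat \<Rightarrow> 'a) set"
  let ?S = "{M. M \<subseteq> ?A \<and> card M = N}"
  have c: "card ?S = (CARD('a) ^ n choose N)"
    using n_subsets[OF finite_affine_points[where 'a = 'a and n = n], of N]
        by (simp add: card_affine_points)
  then have "card ?S > 0" using assms by (simp add: zero_less_binomial)
  then have "?S \<noteq> {}" "finite ?S" by (auto simp: card_gt_0_iff)
  then have "measure_pmf.prob (random_subset n N) {M. P M} = real (card (?S \<inter> {M. P M}))
      / real (card ?S)"
    unfolding random_subset_def by (simp add: measure_pmf_of_set)
  also have "?S \<inter> {M. P M} = {M. M \<subseteq> ?A \<and> card M = N \<and> P M}" by auto
  finally show ?thesis by (simp add: c)
qed

text \<open>Every \<open>N\<close>-subset comes from \<open>fact N\<close> injective sequences. By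
  Bernoulli's inequality at least half of all sequences are injective once \<open>2 * N ^ 2\<close>
  is at most the number of points, so excluding repetitions costs a factor 2.\<close>

lemma prob_random_subset_le_sequences:
  fixes P :: "(nat \<Rightarrow> 'a::finite) set \<Rightarrow> bool"
  assumes "2 * N ^ 2 \<le> CARD('a) ^ n"
  shows "measure_pmf.prob (random_subset n N) {M. P M} \<le>
    2 * (real (card {x \<in> {..<N} \<rightarrow>\<^sub>E (affine_points n :: (nat \<Rightarrow> 'a) set). P (x ` {..<N})})
        / (real CARD('a) ^ n) ^ N)"
proof -
  let ?A = "affine_points n :: (nat \<Rightarrow> 'a) set"
  define T where "T = CARD('a) ^ n"
  have T: "T > 0" by (simp add: T_def)
  have NT: "N \<le> T" using assms self_le_power[of N 2] by (cases "N = 0") (auto simp: T_def)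
  let ?E = "{x \<in> {..<N} \<rightarrow>\<^sub>E ?A. P (x ` {..<N})}"
  have finE: "finite ?E" by (rule finite_subset[of _ "{..<N} \<rightarrow>\<^sub>E ?A"]) (auto intro!: finite_PiE
      finite_affine_points)
  let ?c = "card {M. M \<subseteq> ?A \<and> card M = N \<and> P M}"
  have "fact N * ?c = card {x \<in> {..<N} \<rightarrow>\<^sub>E ?A. inj_on x {..<N} \<and> P (x ` {..<N})}"
    by (rule card_injective_sequences[OF finite_affine_points, symmetric])
  also have "\<dots> \<le> card ?E" by (rule card_mono[OF finE]) auto
  finally have "real (fact N * ?c) \<le> real (card ?E)" by (simp only: of_nat_le_iff)
  then have 1: "fact N * real ?c \<le> real (card ?E)" by simp
  have "real T ^ N / 2 \<le> real T ^ N * (1 + real N * (- (real N / real T)))"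
  proof -
    have "real (2 * N ^ 2) \<le> real T" using assms unfolding T_def by (simp only: of_nat_le_iff)
    then have "1 / 2 \<le> 1 + real N * (- (real N / real T))" using T
        by (simp add: field_simps power2_eq_square)
    then show ?thesis using T mult_left_mono[of "1 / 2" _ "real T ^ N"] by fastforce
  qed
  also have "\<dots> \<le> real T ^ N * (1 + - (real N / real T)) ^ N"
    using NT T by (intro mult_left_mono Bernoulli_inequality) (auto simp: field_simps)
  also have "\<dots> = (real T - real N) ^ N"
    using T by (simp add: power_mult_distrib[symmetric] algebra_simps)
  also have "\<dots> = real ((T - N) ^ N)" using NT by (simp add: of_nat_diff)
  also have "\<dots> \<le> real (fact N * (T choose N))"
    using fact_binomial_ge[OF NT order_refl] by (simp only: of_nat_le_iff)
  finally have 2: "real T ^ N / 2 \<le> fact N * real (T choose N)" by simp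
  have "measure_pmf.prob (random_subset n N) {M. P M} = fact N * real ?c / (fact N
      * real (T choose N))"
    using NT by (subst prob_random_subset) (auto simp: T_def)
  also have "\<dots> \<le> real (card ?E) / (real T ^ N / 2)"
    using 1 2 T by (intro frac_le) auto
  finally show ?thesis by (simp add: T_def mult.commute)
qed

text \<open>Double counting of one-point extensions: an \<open>m\<close>-set has
  \<open>T - m\<close> of them, and a set of size \<open>Suc m\<close> arises from at most
  \<open>Suc m\<close> sets in this way.\<close>

lemma prob_random_subset_mono:
  fixes P :: "(nat \<Rightarrow> 'a::finite) set \<Rightarrow> bool"
  assumes mono: "\<And>M M'. M \<subseteq> M' \<Longrightarrow> P M \<Longrightarrow> P M'" and "N \<le> N'" "N' \<le> CARD('a) ^ n"
  shows "measure_pmf.prob (random_subset n N) {M. P M} \<le> measure_pmf.prob (random_subset n N') {M. P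
      M}"
  using assms(2,3)
proof (induction N' rule: dec_induct)
  case (step m)
  let ?A = "affine_points n :: (nat \<Rightarrow> 'a) set"
  let ?S = "\<lambda>N. {M. M \<subseteq> ?A \<and> card M = N \<and> P M}"
  define T where "T = CARD('a) ^ n"
  have mT: "m < T" using step.prems by (simp add: T_def)
  have finA: "finite ?A" by (rule finite_affine_points)
  have finS: "finite (?S N)" for N by (rule finite_subset[of _ "Pow ?A"]) (use finA in auto)
  have finM: "finite M" if "M \<subseteq> ?A" for M using that finA finite_subset by blast
  have "card (SIGMA M:?S m. ?A - M) \<le> card (SIGMA M':?S (Suc m). M')"
  proof (rule card_inj_on_le)
    show "inj_on (\<lambda>(M, a). (insert a M, a)) (SIGMA M:?S m. ?A - M)"
    proof (rule inj_onI)
      fix z z' assume z: "z \<in> (SIGMA M:?S m. ?A - M)" "z' \<in> (SIGMA M:?S m. ?A - M)"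
        and eq: "(case z of (M, a) \<Rightarrow> (insert a M, a)) = (case z' of (M, a) \<Rightarrow> (insert a M, a))"
      obtain M a M' a' where z_eq: "z = (M, a)" "z' = (M', a')" by (cases z, cases z')
      have "a \<notin> M" "a' \<notin> M'" using z unfolding z_eq by simp_all
      moreover have "insert a M = insert a' M' \<and> a = a'"
        using eq unfolding z_eq prod.case prod.inject .
      ultimately show "z = z'" unfolding z_eq by (metis insert_ident)
    qed
    show "(\<lambda>(M, a). (insert a M, a)) ` (SIGMA M:?S m. ?A - M) \<subseteq> (SIGMA M':?S (Suc m). M')"
    proof (rule image_subsetI)
      fix z assume z: "z \<in> (SIGMA M:?S m. ?A - M)"
      obtain M a where z_eq: "z = (M, a)" by (cases z)
      have M: "M \<in> ?S m" and a: "a \<in> ?A - M" using z unfolding z_eq by simp_all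
      have "P (insert a M)" using M by (intro mono[OF subset_insertI]) simp
      moreover have "card (insert a M) = Suc m" using M a finM[of M] by simp
      ultimately show "(case z of (M, a) \<Rightarrow> (insert a M, a)) \<in> (SIGMA M':?S (Suc m). M')"
        using M a unfolding z_eq by simp
    qed
    show "finite (SIGMA M':?S (Suc m). M')" using finS finM by (intro finite_SigmaI) auto
  qed
  also have "card (SIGMA M:?S m. ?A - M) = (\<Sum>M\<in>?S m. card (?A - M))"
    using finS finA by (intro card_SigmaI) auto
  also have "\<dots> = (\<Sum>M\<in>?S m. T - m)"
    using finM by (intro sum.cong) (auto simp: card_Diff_subset card_affine_points T_def)
  also have "\<dots> = card (?S m) * (T - m)" by simp
  also have "card (SIGMA M':?S (Suc m). M') = (\<Sum>M'\<in>?S (Suc m). card M')"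
    using finS finM by (intro card_SigmaI) auto
  also have "\<dots> = card (?S (Suc m)) * Suc m" by simp
  finally have "real (card (?S m) * (T - m)) \<le> real (card (?S (Suc m)) * Suc m)"
      by (simp only: of_nat_le_iff)
  then have 1: "real (card (?S m)) * real (T - m) \<le> real (card (?S (Suc m))) * real (Suc m)"
    by (simp only: of_nat_mult)
  obtain T' where T': "T = Suc T'" using mT by (cases T) auto
  have "Suc m * (T choose Suc m) = (T - m) * (T choose m)"
    using Suc_times_binomial_eq[of T' m] binomial_absorb_comp[of T m] unfolding T'
        by (simp add: mult_ac)
  then have "real (Suc m * (T choose Suc m)) = real ((T - m) * (T choose m))" by (simp only:)
  then have 2: "real (Suc m) * real (T choose Suc m) = real (T - m) * real (T choose m)"
    by (simp only: of_nat_mult)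
  have pos: "real (T - m) > 0" "real (T choose m) > 0" "real (T choose Suc m) > 0" "real (Suc m) >
      0"
    using mT by (auto simp: zero_less_binomial)
  have "real (card (?S m)) / real (T choose m) = real (card (?S m)) * real (T - m) / (real (T
      - m) * real (T choose m))"
    using pos by simp
  also have "\<dots> \<le> real (card (?S (Suc m))) * real (Suc m) / (real (T - m) * real (T choose m))"
    using 1 pos by (intro divide_right_mono) auto
  also have "\<dots> = real (card (?S (Suc m))) / real (T choose Suc m)"
    unfolding 2[symmetric] using pos by (simp add: mult.commute)
  finally have "measure_pmf.prob (random_subset n m) {M. P M}
      \<le> measure_pmf.prob (random_subset n (Suc m)) {M. P M}"
    using mT by (simp add: prob_random_subset T_def)
  then show ?case using step by simp
qed simp

text \<open>The reciprocal of the probability of missing a set of density \<open>1 / q ^ t\<close>,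
  hence the weight of a miss that keeps the mean at 1. For \<open>t = 1\<close> it is
  \<open>1 + 1 / (q - 1)\<close>, whose logarithm is the denominator of the threshold
  constant.\<close>

definition tilt :: "real \<Rightarrow> nat \<Rightarrow> real" where
  "tilt q t = 1 / (1 - 1 / q ^ t)"

lemma tilt_bounds:
  assumes "q \<ge> 2" "t > 0"
  shows "1 \<le> tilt q t" "tilt q t \<le> 2" "tilt q t * (1 - 1 / q ^ t) = 1"
proof -
  have "2 \<le> q ^ t" using assms self_le_power[of q t] by simp
  then have "1 / q ^ t \<le> 1 / 2" "1 / q ^ t > 0" by (auto simp: field_simps)
  then show "1 \<le> tilt q t" "tilt q t \<le> 2" "tilt q t * (1 - 1 / q ^ t) = 1"
    unfolding tilt_def by (auto simp: field_simps)
qed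

text \<open>
  A variety \<open>V\<close> defined by \<open>r\<close> biased and \<open>s - r\<close> other polynomials lies in the zero set \<open>W\<close> of
  the biased ones and makes up a proportion of about \<open>1 / q ^ (s - r)\<close> of it. There are few
  choices for \<open>W\<close>, so \<open>W\<close> is hit as often as expected.
\<close>

lemma card_not_piercing_le:
  fixes n k s N :: nat and \<delta> \<beta> \<theta> :: real
  defines "q \<equiv> real CARD('a::prime_field)"
  defines "P \<equiv> {f :: (nat \<Rightarrow> 'a) \<Rightarrow> 'a. poly_fun n k f}"
  defines "B \<equiv> {f \<in> P. biased n \<delta> f}"
  assumes "\<delta> \<ge> 0" "\<beta> \<ge> 1" "\<theta> > 0" "N > 0"
  shows "real (card {x \<in> {..<N} \<rightarrow>\<^sub>E (affine_points n :: (nat \<Rightarrow> 'a) set). \<not> pierces (x ` {..<N})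
      (varieties n k s)})
    \<le> (q ^ n) ^ N * (\<Sum>r\<le>s. real (card B) ^ r * (\<beta> powr (\<theta> / q ^ (k * r) * real N) * exp (- (real N
        * (1 / q ^ (k * r)) * (1 - 1 / \<beta>)))))
    + (q ^ n) ^ N * (\<Sum>r<s. real (card B) ^ r * real (card P) ^ (s - r) *
        (tilt q (s - r) powr (- (\<theta> / q ^ (k * r) * real N)) * exp (real N * (4 * \<delta>))))"
proof -
  let ?A = "affine_points n :: (nat \<Rightarrow> 'a) set"
  let ?F = "{..<N} \<rightarrow>\<^sub>E ?A"
  \<comment> \<open>A proportion \<theta> of the mean number of hits that Warning's bound guarantees
    for \<open>r\<close> equations of degree \<open>k\<close>.\<close>
  define m where "m = (\<lambda>r. \<theta> / q ^ (k * r) * real N)"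
  define b1 where "b1 = (\<lambda>r. (q ^ n) ^ N * (\<beta> powr (m r) * exp (real N * - (1 / q ^ (k * r) * (1
      - 1 / \<beta>)))))"
  define b2 where "b2 = (\<lambda>r. (q ^ n) ^ N * (tilt q (s - r) powr (- m r) * exp (real N * (4 * \<delta>))))"
  have q2: "q \<ge> 2" using CARD_real_ge_2[where 'a = 'a] by (simp add: q_def)
  then have q: "q > 0" by simp
  have finA: "finite ?A" by (rule finite_affine_points)
  have cA: "real (card ?A) = q ^ n" by (simp add: card_affine_points q_def)
  have finF: "finite ?F" using finA by (intro finite_PiE) auto
  have finP: "finite P" "finite B" unfolding B_def P_def using finite_poly_fun[of n k,
      where 'a = 'a] by auto
  \<comment> \<open>The event of few hits depends only on the first \<open>r\<close> polynomials, so
    its union bound runs over \<open>r\<close>-tuples of biased ones; full \<open>s\<close>-tuples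
    enter only the event that many points hit \<open>W\<close> and all avoid the variety.\<close>
  define G1 where "G1 = (\<lambda>r. {g \<in> {..<r} \<rightarrow>\<^sub>E B. zeros n r g \<noteq> {}})"
  define G2 where "G2 = (\<lambda>r. {g \<in> PiE {..<s} (\<lambda>j. if j < r then B else P).
      real (card (zeros n s g)) \<ge> real (card (zeros n r g)) / q ^ (s - r) - 2 * \<delta> * q ^ n})"
  define E1 where "E1 = (\<lambda>r g. {x \<in> ?F. real (hits N x (zeros n r g)) < m r})"
  define E2 where "E2 = (\<lambda>r g. {x \<in> ?F. x ` {..<N} \<inter> zeros n s g = {} \<and> m r
      \<le> real (hits N x (zeros n r g))})"
  have fin1: "finite (G1 r)" for r
    unfolding G1_def by (rule finite_subset[of _ "{..<r} \<rightarrow>\<^sub>E B"]) (use finP in \<open>auto intro!: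
        finite_PiE\<close>)
  have fin2: "finite (G2 r)" for r
    unfolding G2_def by (rule finite_subset[of _ "PiE {..<s} (\<lambda>j. if j < r then B else P)"])
      (use finP in \<open>auto intro!: finite_PiE\<close>)
  have finE: "finite (E1 r g)" "finite (E2 r g)" for r g
    using finF by (auto simp: E1_def E2_def)
  have mpos: "m r > 0" for r using assms q by (simp add: m_def)
  have sub: "{x \<in> ?F. \<not> pierces (x ` {..<N}) (varieties n k s)} \<subseteq>
      (\<Union>r\<in>{..s}. \<Union>g\<in>G1 r. E1 r g) \<union> (\<Union>r\<in>{..<s}. \<Union>g\<in>G2 r. E2 r g)"
  proof
    fix x assume x: "x \<in> {x \<in> ?F. \<not> pierces (x ` {..<N}) (varieties n k s)}"
    then obtain f :: "nat \<Rightarrow> (nat \<Rightarrow> 'a) \<Rightarrow> 'a" where f: "\<forall>j<s. poly_fun n k (f j)" "zeros n s f \<noteq> {}"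
      "x ` {..<N} \<inter> zeros n s f = {}"
      unfolding pierces_def varieties_eq by blast
    obtain g0 r where g0: "r \<le> s" "\<forall>j<s. poly_fun n k (g0 j)" "\<forall>j<r. biased n \<delta> (g0 j)"
      "zeros n s g0 = zeros n s f"
      "real (card (zeros n s g0)) \<ge> real (card (zeros n r g0)) / real CARD('a) ^ (s - r)
          - 2 * \<delta> * real CARD('a) ^ n"
      by (rule ex_biased_basis[OF f(1) \<open>\<delta> \<ge> 0\<close>])
    have Z: "zeros n r (restrict g0 {..<r}) = zeros n r g0" "zeros n r (restrict g0 {..<s})
        = zeros n r g0"
      "zeros n s (restrict g0 {..<s}) = zeros n s g0"
      using g0(1) by (auto simp: zeros_def)
    have sub: "zeros n s g0 \<subseteq> zeros n r g0" using g0(1) by (auto simp: zeros_def)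
    show "x \<in> (\<Union>r\<in>{..s}. \<Union>g\<in>G1 r. E1 r g) \<union> (\<Union>r\<in>{..<s}. \<Union>g\<in>G2 r. E2 r g)"
    proof (cases "real (hits N x (zeros n r g0)) < m r")
      case True
      have "restrict g0 {..<r} \<in> G1 r"
        using g0 sub f(2) by (auto simp: G1_def Z B_def P_def)
      moreover have "x \<in> E1 r (restrict g0 {..<r})" using x True by (simp add: E1_def Z)
      ultimately show ?thesis using g0(1) by blast
    next
      case False
      have "r \<noteq> s"
      \<comment> \<open>For \<open>r = s\<close> the set \<open>W\<close> is the variety itself,
        which is not hit at all; as \<open>m r\<close> is positive, this belongs to the event of few
        hits.\<close>
      proof
        assume "r = s"
        then have "hits N x (zeros n r g0) = 0" using f(3) g0(4) by (auto simp: hits_def)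
        then show False using False mpos[of r] by simp
      qed
      then have "r < s" using g0(1) by simp
      moreover have "restrict g0 {..<s} \<in> G2 r"
        using g0 by (auto simp: G2_def Z B_def P_def q_def)
      moreover have "x \<in> E2 r (restrict g0 {..<s})"
        using x False f(3) g0(4) by (simp add: E2_def Z not_less)
      ultimately show ?thesis by blast
    qed
  qed
  have card1: "real (card (\<Union>g\<in>G1 r. E1 r g)) \<le> real (card B) ^ r * b1 r" for r
  proof -
    have "real (card (\<Union>g\<in>G1 r. E1 r g)) \<le> real (\<Sum>g\<in>G1 r. card (E1 r g))"
      using card_UN_le[OF fin1] by (simp only: of_nat_le_iff)
    also have "\<dots> = (\<Sum>g\<in>G1 r. real (card (E1 r g)))" by simp
    also have "\<dots> \<le> (\<Sum>g\<in>G1 r. b1 r)"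
    proof (rule sum_mono)
      fix g assume g: "g \<in> G1 r"
      then have "\<forall>j<r. poly_fun n k (g j)" by (auto simp: G1_def B_def P_def)
      then have "q ^ n \<le> q ^ (k * r) * real (card (zeros n r g))"
        using card_zeros_ge[of r n k g] g by (simp add: G1_def q_def)
      then have "1 / q ^ (k * r) * real (card ?A) \<le> real (card (zeros n r g))"
        using q unfolding cA by (simp add: field_simps)
      then show "real (card (E1 r g)) \<le> b1 r"
        unfolding E1_def b1_def cA[symmetric]
        by (intro card_few_hits_le finA) (use \<open>\<beta> \<ge> 1\<close> in \<open>auto simp: zeros_def\<close>)
    qed
    also have "\<dots> = real (card (G1 r)) * b1 r"
      by simp
    also have "\<dots> \<le> real (card B) ^ r * b1 r"
    proof (rule mult_right_mono)
      have "card (G1 r) \<le> card ({..<r} \<rightarrow>\<^sub>E B)"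
        unfolding G1_def by (rule card_mono) (use finP in \<open>auto intro!: finite_PiE\<close>)
      also have "\<dots> = card B ^ r" by (simp add: card_PiE)
      finally show "real (card (G1 r)) \<le> real (card B) ^ r" by (metis of_nat_le_iff of_nat_power)
    qed (use q in \<open>auto simp: b1_def b2_def\<close>)
    finally show ?thesis .
  qed
  have card2: "real (card (\<Union>g\<in>G2 r. E2 r g)) \<le> real (card B) ^ r * real (card P) ^ (s - r) * b2 r"
    if r: "r < s" for r
  proof -
    note t = tilt_bounds[OF q2, of "s - r"]
    have "real (card (\<Union>g\<in>G2 r. E2 r g)) \<le> real (\<Sum>g\<in>G2 r. card (E2 r g))"
      using card_UN_le[OF fin2] by (simp only: of_nat_le_iff)
    also have "\<dots> = (\<Sum>g\<in>G2 r. real (card (E2 r g)))" by simp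
    also have "\<dots> \<le> (\<Sum>g\<in>G2 r. b2 r)"
    proof (rule sum_mono)
      fix g assume g: "g \<in> G2 r"
      let ?W = "real (card (zeros n r g))"
      let ?V = "real (card (zeros n s g))"
      have "tilt q (s - r) * (?W - ?V) \<le> tilt q (s - r) * ((1 - 1 / q ^ (s - r)) * ?W
          + 2 * \<delta> * q ^ n)"
        using g t r by (intro mult_left_mono) (auto simp: G2_def algebra_simps)
      also have "\<dots> = (tilt q (s - r) * (1 - 1 / q ^ (s - r))) * ?W + tilt q (s - r) * (2 * \<delta>
          * q ^ n)"
        by (simp only: distrib_left mult.assoc)
      \<comment> \<open>The bound 2 for \<open>tilt\<close> turns the error
        \<open>2 * \<delta>\<close> into the \<open>4 * \<delta>\<close> of the claim.\<close>
      also have "\<dots> \<le> ?W + 2 * (2 * \<delta> * q ^ n)"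
        using t(2,3) r q \<open>\<delta> \<ge> 0\<close> by (intro add_mono mult_right_mono) auto
      finally have "tilt q (s - r) * (?W - ?V) \<le> ?W + 4 * \<delta> * real (card ?A)" by (simp add: cA)
      then show "real (card (E2 r g)) \<le> b2 r"
        unfolding E2_def b2_def cA[symmetric]
        by (intro card_avoiding_le finA) (use t r in \<open>auto simp: zeros_def\<close>)
    qed
    also have "\<dots> = real (card (G2 r)) * b2 r"
      by simp
    also have "\<dots> \<le> real (card B) ^ r * real (card P) ^ (s - r) * b2 r"
    proof (rule mult_right_mono)
      have "card (G2 r) \<le> card (PiE {..<s} (\<lambda>j. if j < r then B else P))"
        unfolding G2_def by (rule card_mono) (use finP in \<open>auto intro!: finite_PiE\<close>)
      also have "\<dots> = (\<Prod>j<s. if j < r then card B else card P)"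
        by (subst card_PiE) (auto intro: prod.cong)
      also have "\<dots> = card B ^ r * card P ^ (s - r)"
      proof -
        have "{..<s} \<inter> {j. j < r} = {..<r}" "{..<s} \<inter> - {j. j < r} = {r..<s}" using r by auto
        then show ?thesis by (simp add: prod.If_cases)
      qed
      finally show "real (card (G2 r)) \<le> real (card B) ^ r * real (card P) ^ (s - r)"
        by (metis of_nat_le_iff of_nat_power of_nat_mult)
    qed (use q in \<open>auto simp: b1_def b2_def\<close>)
    finally show ?thesis .
  qed
  have "real (card {x \<in> ?F. \<not> pierces (x ` {..<N}) (varieties n k s)}) \<le>
      real (card ((\<Union>r\<in>{..s}. \<Union>g\<in>G1 r. E1 r g) \<union> (\<Union>r\<in>{..<s}. \<Union>g\<in>G2 r. E2 r g)))"
    using sub fin1 fin2 finE by (intro of_nat_mono card_mono) auto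
  also have "\<dots> \<le> real (card (\<Union>r\<in>{..s}. \<Union>g\<in>G1 r. E1 r g) + card (\<Union>r\<in>{..<s}. \<Union>g\<in>G2 r. E2 r g))"
    by (intro of_nat_mono card_Un_le)
  also have "\<dots> \<le> real ((\<Sum>r\<le>s. card (\<Union>g\<in>G1 r. E1 r g)) + (\<Sum>r<s. card (\<Union>g\<in>G2 r. E2 r g)))"
    by (intro of_nat_mono add_mono card_UN_le) auto
  also have "\<dots> = (\<Sum>r\<le>s. real (card (\<Union>g\<in>G1 r. E1 r g))) + (\<Sum>r<s. real (card (\<Union>g\<in>G2 r. E2 r g)))"
    by simp
  also have "\<dots> \<le> (\<Sum>r\<le>s. real (card B) ^ r * b1 r) +
     (\<Sum>r<s. real (card B) ^ r * real (card P) ^ (s - r) * b2 r)"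
    by (intro add_mono sum_mono card1 card2) auto
  finally show ?thesis unfolding m_def b1_def b2_def by (simp add: sum_distrib_left mult_ac)
qed

section \<open>Varieties inside a fixed subspace\<close>

definition coord_subspace :: "nat \<Rightarrow> nat \<Rightarrow> (nat \<Rightarrow> 'a::zero) set" where
  "coord_subspace m n = {x \<in> affine_points n. \<forall>i. m \<le> i \<longrightarrow> i < n \<longrightarrow> x i = 0}"

lemma card_coord_subspace_filter:
  assumes "m \<le> n" "\<And>x. R x = R (restrict x {..<m})"
  shows "card {x \<in> coord_subspace m n. R x} = card {y \<in> affine_points m. R y}"
proof (rule bij_betw_same_card[of "\<lambda>x. restrict x {..<m}"])
  let ?ext = "\<lambda>y. \<lambda>i\<in>{..<n}. if i < m then y i else 0"
  have outside: "x i = undefined" if "x \<in> affine_points l" "\<not> i < l" for x :: "nat \<Rightarrow> 'a" and i l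
    using that PiE_arb[of x "{..<l}" "\<lambda>_. UNIV" i] by (simp add: affine_points_def)
  have inv1: "?ext (restrict x {..<m}) = x" if "x \<in> coord_subspace m n" for x :: "nat \<Rightarrow> 'a"
  proof
    fix i
    have "x \<in> affine_points n" "m \<le> i \<longrightarrow> i < n \<longrightarrow> x i = 0" using that unfolding coord_subspace_def
        by blast+
    then show "?ext (restrict x {..<m}) i = x i" using outside[of x n i] by simp
  qed
  have inv2: "restrict (?ext y) {..<m} = y" if "y \<in> affine_points m" for y :: "nat \<Rightarrow> 'a"
  proof
    fix i show "restrict (?ext y) {..<m} i = y i"
      using outside[OF that, of i] assms(1) by (cases "i < m") simp_all
  qed
  have ext: "?ext y \<in> coord_subspace m n" for y :: "nat \<Rightarrow> 'a"
    unfolding coord_subspace_def affine_points_def by simp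
  show "bij_betw (\<lambda>x. restrict x {..<m}) {x \<in> coord_subspace m n. R x} {y \<in> affine_points m. R y}"
  proof (rule bij_betwI[where g = ?ext])
    show "(\<lambda>x. restrict x {..<m}) \<in> {x \<in> coord_subspace m n. R x} \<rightarrow> {y \<in> affine_points m. R y}"
    proof
      fix x assume x: "x \<in> {x \<in> coord_subspace m n. R x}"
      have "restrict x {..<m} \<in> affine_points m" by (simp add: affine_points_def)
      then show "restrict x {..<m} \<in> {y \<in> affine_points m. R y}" using x assms(2)[of x] by simp
    qed
    show "?ext \<in> {y \<in> affine_points m. R y} \<rightarrow> {x \<in> coord_subspace m n. R x}"
    proof
      fix y assume y: "y \<in> {y \<in> affine_points m. R y}"
      then have "R (?ext y)" using assms(2)[of "?ext y"] inv2[of y] by simp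
      then show "?ext y \<in> {x \<in> coord_subspace m n. R x}" using ext by simp
    qed
  next
    fix x assume "x \<in> {x \<in> coord_subspace m n. R x}"
    then show "?ext (restrict x {..<m}) = x" by (intro inv1) simp
  next
    fix y assume "y \<in> {y \<in> affine_points m. R y}"
    then show "restrict (?ext y) {..<m} = y" by (intro inv2) simp
  qed
qed

lemma poly_fun_restrict: "poly_fun m d f \<Longrightarrow> f (restrict x {..<m}) = f x"
  by (erule poly_fun_cong) simp

text \<open>The subspace is cut out by \<open>s - 1\<close> norm forms, one for each block of \<open>k\<close> coordinates.\<close>

lemma coord_subspace_hypersurface_variety:
  fixes f :: "(nat \<Rightarrow> 'a::prime_field) \<Rightarrow> 'a"
  assumes "k > 0" "s > 0" "n = m + (s - 1) * k" "poly_fun m k f"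
    and ne: "\<exists>y\<in>affine_points m. f y = 0"
  shows "{x \<in> coord_subspace m n. f x = 0} \<in> varieties n k s"
proof -
  have "\<forall>j. \<exists>g :: (nat \<Rightarrow> 'a) \<Rightarrow> 'a. j < s - 1 \<longrightarrow> poly_fun n k g \<and> (\<forall>x. g x = 0 \<longleftrightarrow> (\<forall>i<k. x (m + j * k
      + i) = 0))"
  proof
    fix j
    have "m + j * k + k \<le> n" if "j < s - 1"
    proof -
      have "Suc j * k \<le> (s - 1) * k" using that by (intro mult_right_mono) auto
      then show ?thesis using assms(3) by simp
    qed
    then show "\<exists>g :: (nat \<Rightarrow> 'a) \<Rightarrow> 'a. j < s - 1 \<longrightarrow> poly_fun n k g \<and> (\<forall>x. g x = 0 \<longleftrightarrow> (\<forall>i<k. x (m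
        + j * k + i) = 0))"
      using ex_norm_form[OF \<open>k > 0\<close>, of "m + j * k" n, where 'a = 'a] by blast
  qed
  from choice[OF this] obtain g :: "nat \<Rightarrow> (nat \<Rightarrow> 'a) \<Rightarrow> 'a"
    where g: "\<And>j. j < s - 1 \<Longrightarrow> poly_fun n k (g j)"
      "\<And>j x. j < s - 1 \<Longrightarrow> g j x = 0 \<longleftrightarrow> (\<forall>i<k. x (m + j * k + i) = 0)" by blast
  define F where "F = (\<lambda>j. if j < s - 1 then g j else f)"
  have blocks: "(\<forall>j<s - 1. g j x = 0) \<longleftrightarrow> (\<forall>i. m \<le> i \<longrightarrow> i < n \<longrightarrow> x i = 0)" for x
  proof (intro iffI allI impI)
    fix i assume all: "\<forall>j<s - 1. g j x = 0" and i: "m \<le> i" "i < n"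
    define j where "j = (i - m) div k"
    have "j < s - 1" using i assms(1,3) by (simp add: j_def less_mult_imp_div_less)
    moreover have "(i - m) mod k < k" using assms(1) by simp
    ultimately have "x (m + j * k + (i - m) mod k) = 0" using all g(2)[of j x] by blast
    moreover have "m + j * k + (i - m) mod k = i" using i by (simp add: j_def)
    ultimately show "x i = 0" by simp
  next
    fix j assume all: "\<forall>i. m \<le> i \<longrightarrow> i < n \<longrightarrow> x i = 0" and j: "j < s - 1"
    have "m + j * k + i < n" if "i < k" for i
    proof -
      have "Suc j * k \<le> (s - 1) * k" using j by (intro mult_right_mono) auto
      then show ?thesis using assms(3) that by simp
    qed
    then show "g j x = 0" using g(2)[OF j] all by simp
  qed
  have "(\<forall>j<s. F j x = 0) \<longleftrightarrow> (\<forall>j<s - 1. g j x = 0) \<and> f x = 0" for x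
  proof -
    have "(\<forall>j<s. F j x = 0) \<longleftrightarrow> (\<forall>j<Suc (s - 1). F j x = 0)" using assms(2) by simp
    also have "\<dots> \<longleftrightarrow> F (s - 1) x = 0 \<and> (\<forall>j<s - 1. F j x = 0)" by (rule All_less_Suc)
    finally show ?thesis by (auto simp: F_def)
  qed
  then have Z: "zeros n s F = {x \<in> coord_subspace m n. f x = 0}"
    unfolding zeros_def coord_subspace_def blocks by blast
  have "\<forall>j<s. poly_fun n k (F j)"
    using g(1) poly_fun_mono[OF assms(4), of n k] assms(3) by (simp add: F_def)
  moreover have "{x \<in> coord_subspace m n. f x = 0} \<noteq> {}"
  proof -
    have "{y \<in> affine_points m. f y = 0} \<noteq> {}" using ne by blast
    then have "card {y \<in> affine_points m. f y = 0} > 0"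
        by (simp add: card_gt_0_iff finite_affine_points)
    also have "card {y \<in> affine_points m. f y = 0} = card {x \<in> coord_subspace m n. f x = 0}"
      using assms(3) poly_fun_restrict[OF assms(4)] by (intro card_coord_subspace_filter[symmetric])
          auto
    finally show ?thesis by (simp add: card_gt_0_iff)
  qed
  ultimately show ?thesis unfolding varieties_eq using Z by blast
qed

text \<open>Multiplied over a sequence, it vanishes as soon as the sequence meets the zero set of
  \<open>f\<close> in \<open>W\<close>; the factor \<open>c\<close> on the other points of
  \<open>W\<close> compensates for this in the mean.\<close>

definition weight :: "'b set \<Rightarrow> real \<Rightarrow> ('b \<Rightarrow> 'a::zero) \<Rightarrow> 'b \<Rightarrow> real" where
  "weight W c f a = (if a \<notin> W then 1 else if f a = 0 then 0 else c)"

lemma weight_nonneg: "c \<ge> 0 \<Longrightarrow> 0 \<le> weight W c f a"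
  by (simp add: weight_def)

lemma weight_mult: "weight W c f a * weight W c' g a = (if a \<notin> W then 1 else if f a = 0 \<or> g a
    = 0 then 0 else c * c')"
  by (simp add: weight_def)

lemma prod_weight_le_power_hits:
  assumes "c \<ge> 1"
  shows "(\<Prod>i<N. weight W c f (x i)) \<le> c ^ hits N x W"
proof -
  have "(\<Prod>i<N. weight W c f (x i)) \<le> (\<Prod>i<N. if x i \<in> W then c else 1)"
    using assms by (intro prod_mono) (auto simp: weight_def)
  then show ?thesis by (simp add: prod_weight_hits)
qed

lemma prod_weight_mult: "(\<Prod>i<N. weight W (b * c) f (x i)) = b ^ hits N x W * (\<Prod>i<N. weight W c f (x
    i))"
proof -
  have "(\<Prod>i<N. weight W (b * c) f (x i)) = (\<Prod>i<N. (if x i \<in> W then b else 1) * weight W c f (x i))"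
    by (intro prod.cong) (auto simp: weight_def)
  then show ?thesis by (simp add: prod.distrib prod_weight_hits)
qed

text \<open>
  Second moment method. The weights are normalised so that all functions have mean close to 1, and
  the restriction to sequences with at most \<open>\<kappa>\<close> points in the subspace controls the correlated
  pairs.
\<close>

lemma card_piercing_le:
  fixes m n k s N :: nat and \<delta> \<beta> \<kappa> :: real
  defines "q \<equiv> real CARD('a::prime_field)"
  defines "P \<equiv> {f :: (nat \<Rightarrow> 'a) \<Rightarrow> 'a. poly_fun m k f}"
  defines "B \<equiv> {f \<in> P. biased m \<delta> f}"
  defines "Q \<equiv> {f \<in> P. \<not> biased m \<delta> f}"
  assumes k: "k > 0" and s: "s > 0" and n: "n = m + (s - 1) * k" and \<delta>: "0 \<le> \<delta>" "\<delta> < 1 / q"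
      and \<beta>: "\<beta> \<ge> 1" and Q: "Q \<noteq> {}"
  shows "real (card {x \<in> {..<N} \<rightarrow>\<^sub>E (affine_points n :: (nat \<Rightarrow> 'a) set). pierces (x ` {..<N})
      (varieties n k s)})
    \<le> (q ^ n) ^ N * ((exp (real N * (16 * \<delta>)) - 1) + 4 * (real N * \<delta>)
       + q\<^sup>2 * real (card B) / real (card Q) * (tilt q 1 powr \<kappa> * exp (real N * (2 * \<delta>)))
       + 2 * (\<beta> powr (- \<kappa>) * exp (real N * ((\<beta> - 1) / q ^ ((s - 1) * k) + 2 * \<beta> * \<delta>))))"
proof -
  let ?A = "affine_points n :: (nat \<Rightarrow> 'a) set"
  let ?F = "{..<N} \<rightarrow>\<^sub>E ?A"
  define W where "W = (coord_subspace m n :: (nat \<Rightarrow> 'a) set)"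
  define c where "c = tilt q 1"
  have q2: "q \<ge> 2" using CARD_real_ge_2[where 'a = 'a] by (simp add: q_def)
  then have q: "q > 0" by simp
  have c: "1 \<le> c" "c \<le> 2" "c * (1 - 1 / q) = 1" using tilt_bounds[OF q2, of 1] by (auto simp: c_def)
  have finA: "finite ?A" by (rule finite_affine_points)
  have finF: "finite ?F" using finA by (intro finite_PiE) auto
  have WA: "W \<subseteq> ?A" by (auto simp: W_def coord_subspace_def)
  have mn: "m \<le> n" using n by simp
  have cA: "real (card ?A) = q ^ n" by (simp add: card_affine_points q_def)
  have cW: "real (card W) = q ^ m"
    using card_coord_subspace_filter[OF mn, of "\<lambda>_ :: nat \<Rightarrow> 'a. True"]
        by (simp add: W_def card_affine_points q_def)
  have WT: "q ^ m \<le> q ^ n" using q2 mn by (intro power_increasing) auto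
  have Ww: "q ^ m = q ^ n / q ^ ((s - 1) * k)" using q by (simp add: n power_add)
  have finP: "finite P" "finite B" "finite Q"
    unfolding B_def Q_def P_def using finite_poly_fun[of m k, where 'a = 'a] by auto
  define a where "a = real (card Q)"
  have a: "a > 0" using Q finP by (simp add: a_def card_gt_0_iff)
  define T where "T = (q ^ n) ^ N"
  have T: "T > 0" using q by (simp add: T_def)
  define wt where "wt = (\<lambda>(f :: (nat \<Rightarrow> 'a) \<Rightarrow> 'a) x. \<Prod>i<N. weight W c f (x i))"
  have wt_nonneg: "wt f x \<ge> 0" for f :: "(nat \<Rightarrow> 'a) \<Rightarrow> 'a" and x
    using c by (auto simp: wt_def intro!: prod_nonneg weight_nonneg)
  \<comment> \<open>If all varieties are met, every weight is 0 and so is \<open>tot\<close>,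
    whereas its mean should be close to \<open>a\<close>, the number of unbiased
    polynomials.\<close>
  define tot where "tot = (\<lambda>x. if real (hits N x W) \<le> \<kappa> then \<Sum>f\<in>Q. wt f x else 0)"
  have zeroset: "\<bar>real (card {x \<in> W. f x \<noteq> 0}) - (1 - 1 / q) * q ^ m\<bar> \<le> \<delta> * q ^ m" if "f \<in> Q" for f
  proof -
    have f: "poly_fun m k f" "\<not> biased m \<delta> f" using that by (auto simp: Q_def P_def)
    have "card {x \<in> W. f x \<noteq> 0} = card {y \<in> affine_points m. f y \<noteq> 0}"
      unfolding W_def using poly_fun_restrict[OF f(1)] by (intro card_coord_subspace_filter mn) auto
    also have "{y \<in> affine_points m. f y \<noteq> 0} = affine_points m - {y \<in> affine_points m. f y = 0}"
        by auto
    also have "card \<dots> = CARD('a) ^ m - card {y \<in> affine_points m. f y = 0}"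
      by (subst card_Diff_subset) (auto simp: finite_affine_points card_affine_points)
    finally have "real (card {x \<in> W. f x \<noteq> 0}) = q ^ m - real (card {y \<in> affine_points m. f y = 0})"
      using card_mono[of "affine_points m" "{y \<in> affine_points m. f y = 0}"]
      by (simp add: of_nat_diff finite_affine_points card_affine_points q_def)
    then show ?thesis using card_zero_approx[OF f(2)]
        by (simp add: q_def algebra_simps abs_minus_commute)
  qed
  have sum_weight: "(\<Sum>x\<in>?A. weight W b f x) = q ^ n - q ^ m + b * real (card {x \<in> W. f x \<noteq> 0})"
    for b and f :: "(nat \<Rightarrow> 'a) \<Rightarrow> 'a"
    unfolding weight_def using sum_if_subset[OF finA WA, of "\<lambda>x. f x = 0" b] by (simp add: cA cW)
  have mean_lower: "(1 - real N * (2 * \<delta>)) * T \<le> (\<Sum>x\<in>?F. wt f x)" if f: "f \<in> Q" for f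
  proof -
    have "c * ((1 - 1 / q) * q ^ m - \<delta> * q ^ m) \<le> c * real (card {x \<in> W. f x \<noteq> 0})"
      using zeroset[OF f] c by (intro mult_left_mono) auto
    also have "c * ((1 - 1 / q) * q ^ m - \<delta> * q ^ m) = (c * (1 - 1 / q)) * q ^ m - c * (\<delta> * q ^ m)"
      by (simp add: algebra_simps)
    finally have "q ^ m - c * (\<delta> * q ^ m) \<le> c * real (card {x \<in> W. f x \<noteq> 0})"
        by (simp only: c(3) mult_1_left)
    moreover have "c * (\<delta> * q ^ m) \<le> 2 * (\<delta> * q ^ n)"
      using c \<delta> WT q by (intro mult_mono) auto
    ultimately have "q ^ n * (1 + - (2 * \<delta>)) \<le> (\<Sum>x\<in>?A. weight W c f x)"
      unfolding sum_weight by (simp add: algebra_simps)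
    moreover have d1: "- 1 \<le> - (2 * \<delta>)"
    proof -
      have "1 / q \<le> 1 / 2" using q2 by (simp add: field_simps)
      then show ?thesis using \<delta> by linarith
    qed
    ultimately have "(q ^ n * (1 + - (2 * \<delta>))) ^ N \<le> (\<Sum>x\<in>?A. weight W c f x) ^ N"
      using q by (intro power_mono) auto
    also have "\<dots> = (\<Sum>x\<in>?F. wt f x)"
      unfolding wt_def by (rule sum_prod_sequences[OF finA, symmetric])
    finally have "T * (1 + - (2 * \<delta>)) ^ N \<le> (\<Sum>x\<in>?F. wt f x)" by (simp add: power_mult_distrib T_def)
    moreover have "T * (1 + real N * (- (2 * \<delta>))) \<le> T * (1 + - (2 * \<delta>)) ^ N"
      using T d1 by (intro mult_left_mono Bernoulli_inequality) auto
    ultimately show ?thesis by (simp add: mult.commute)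
  qed
  \<comment> \<open>For \<open>b = 1\<close> this leads to the plain mean;
    \<open>b = \<beta>\<close> puts an extra factor on each hit and serves to bound what the
    truncation discards.\<close>
  have sum_upper: "(\<Sum>x\<in>?A. weight W (b * c) f x) \<le> q ^ n * (1 + ((b - 1) / q ^ ((s - 1) * k)
      + 2 * b * \<delta>))"
    if f: "f \<in> Q" and b: "b \<ge> 1" for f b
  proof -
    have "b * c * real (card {x \<in> W. f x \<noteq> 0}) \<le> b * c * ((1 - 1 / q) * q ^ m + \<delta> * q ^ m)"
      using zeroset[OF f] c b by (intro mult_left_mono) auto
    also have "\<dots> = b * ((c * (1 - 1 / q)) * q ^ m) + b * (c * (\<delta> * q ^ m))"
      by (simp add: algebra_simps)
    also have "\<dots> \<le> b * q ^ m + b * (2 * (\<delta> * q ^ n))"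
      using c \<delta> WT q b by (intro add_mono mult_left_mono mult_mono) auto
    finally have "(\<Sum>x\<in>?A. weight W (b * c) f x) \<le> q ^ n + (b - 1) * q ^ m + b * (2 * (\<delta> * q ^ n))"
      unfolding sum_weight by (simp add: algebra_simps)
    also have "\<dots> = q ^ n * (1 + ((b - 1) / q ^ ((s - 1) * k) + 2 * b * \<delta>))"
      unfolding Ww by (simp add: algebra_simps)
    finally show ?thesis .
  qed
  have mean_upper: "(\<Sum>x\<in>?F. \<Prod>i<N. weight W (b * c) f (x i)) \<le> T * exp (real N * ((b - 1) / q ^ ((s
      - 1) * k) + 2 * b * \<delta>))"
    if f: "f \<in> Q" and b: "b \<ge> 1" for f b
  proof -
    let ?e = "(b - 1) / q ^ ((s - 1) * k) + 2 * b * \<delta>"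
    have "(\<Sum>x\<in>?A. weight W (b * c) f x) \<le> q ^ n * exp ?e"
      by (rule order_trans[OF sum_upper[OF that]]) (use q in \<open>intro mult_left_mono
          exp_ge_add_one_self; simp\<close>)
    then have "(\<Sum>x\<in>?A. weight W (b * c) f x) ^ N \<le> (q ^ n * exp ?e) ^ N"
      using b c by (intro power_mono sum_nonneg weight_nonneg) auto
    then show ?thesis
      by (simp add: sum_prod_sequences[OF finA] power_mult_distrib T_def exp_of_nat_mult[symmetric])
  qed
  have pair_upper: "(\<Sum>x\<in>?F. wt f x * wt g x) \<le> T * exp (real N * (16 * \<delta>))"
    if fg: "f \<in> Q" "g \<in> Q" "unbiased_pair m \<delta> f g" for f g
  proof -
    have p: "poly_fun m k f" "poly_fun m k g" using fg by (auto simp: Q_def P_def)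
    have "card {x \<in> W. \<not> (f x = 0 \<or> g x = 0)} = card {y \<in> affine_points m. \<not> (f y = 0 \<or> g y = 0)}"
      unfolding W_def using poly_fun_restrict[OF p(1)] poly_fun_restrict[OF p(2)]
      by (intro card_coord_subspace_filter mn) simp
    then have "real (card {x \<in> W. \<not> (f x = 0 \<or> g x = 0)}) \<le> ((1 - 1 / q)\<^sup>2 + 4 * \<delta>) * q ^ m"
      using card_both_nonzero_le[OF fg(3) \<delta>(1)] by (simp add: q_def)
    then have "c * c * real (card {x \<in> W. \<not> (f x = 0 \<or> g x = 0)}) \<le> c * c * (((1 - 1 / q)\<^sup>2
        + 4 * \<delta>) * q ^ m)"
      using c by (intro mult_left_mono) auto
    also have "\<dots> = (c * (1 - 1 / q)) * (c * (1 - 1 / q)) * q ^ m + c * c * (4 * \<delta> * q ^ m)"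
      by (simp add: algebra_simps power2_eq_square)
    \<comment> \<open>Here \<open>c \<le> 2\<close> turns the \<open>4 * \<delta>\<close> of the
      pair estimate into \<open>16 * \<delta>\<close>.\<close>
    also have "\<dots> \<le> q ^ m + 2 * 2 * (4 * \<delta> * q ^ n)"
      unfolding c(3) using c \<delta> WT q by (intro add_mono mult_mono) auto
    finally have "(\<Sum>x\<in>?A. weight W c f x * weight W c g x) \<le> q ^ n * (1 + 16 * \<delta>)"
      unfolding weight_mult sum_if_subset[OF finA WA] cA cW by (simp add: algebra_simps)
    also have "\<dots> \<le> q ^ n * exp (16 * \<delta>)" using q by (intro mult_left_mono exp_ge_add_one_self) auto
    finally have "(\<Sum>x\<in>?A. weight W c f x * weight W c g x) ^ N \<le> (q ^ n * exp (16 * \<delta>)) ^ N"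
      using c by (intro power_mono sum_nonneg mult_nonneg_nonneg weight_nonneg) auto
    then show ?thesis
      using sum_prod_sequences[OF finA, where h = "\<lambda>x. weight W c f x * weight W c g x" and N = N]
      by (simp add: wt_def prod.distrib power_mult_distrib T_def exp_of_nat_mult[symmetric])
  qed
  have tot_lower: "(\<Sum>x\<in>?F. tot x) \<ge> a * (T * (1 - 2 * (real N * \<delta>)
      - \<beta> powr (- \<kappa>) * exp (real N * ((\<beta> - 1) / q ^ ((s - 1) * k) + 2 * \<beta> * \<delta>))))" (is "_
          \<ge> a * (T * (_ - ?tail))")
  proof -
    have "(\<Sum>x\<in>?F. if real (hits N x W) \<le> \<kappa> then wt f x else 0) \<ge> T * (1 - 2 * (real N * \<delta>) - ?tail)"
        if f: "f \<in> Q" for f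
    proof -
      \<comment> \<open>Discarded sequences have more than \<kappa> hits, where
        \<open>\<beta> powr (real (hits N x W) - \<kappa>)\<close> is at least 1, so the loss is
        dominated by the weight with the extra factor \<beta> per hit.\<close>
      have "(\<Sum>x\<in>?F. if real (hits N x W) \<le> \<kappa> then wt f x else 0) \<ge>
          (\<Sum>x\<in>?F. wt f x - \<beta> powr (- \<kappa>) * (\<Prod>i<N. weight W (\<beta> * c) f (x i)))"
      proof (rule sum_mono)
        fix x
        have e: "\<beta> powr (- \<kappa>) * (\<Prod>i<N. weight W (\<beta> * c) f (x i)) = (\<beta> powr (real (hits N x W)
            - \<kappa>)) * wt f x"
          using \<beta> unfolding prod_weight_mult wt_def
              by (simp add: powr_diff powr_minus powr_realpow field_simps)
        show "wt f x - \<beta> powr (- \<kappa>) * (\<Prod>i<N. weight W (\<beta> * c) f (x i)) \<le> (if real (hits N x W)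
            \<le> \<kappa> then wt f x else 0)"
        proof (cases "real (hits N x W) \<le> \<kappa>")
          case False
          then have "1 \<le> \<beta> powr (real (hits N x W) - \<kappa>)" using \<beta> by (intro ge_one_powr_ge_zero) auto
          then have "1 * wt f x \<le> \<beta> powr (real (hits N x W) - \<kappa>) * wt f x" using wt_nonneg
              by (intro mult_right_mono) auto
          then show ?thesis using False unfolding e by simp
        qed (use wt_nonneg[of f x] in \<open>simp add: e\<close>)
      qed
      also have "(\<Sum>x\<in>?F. wt f x - \<beta> powr (- \<kappa>) * (\<Prod>i<N. weight W (\<beta> * c) f (x i))) =
         (\<Sum>x\<in>?F. wt f x) - \<beta> powr (- \<kappa>) * (\<Sum>x\<in>?F. \<Prod>i<N. weight W (\<beta> * c) f (x i))"
        by (simp add: sum_subtractf sum_distrib_left)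
      finally have 1: "(\<Sum>x\<in>?F. wt f x) - \<beta> powr (- \<kappa>) * (\<Sum>x\<in>?F. \<Prod>i<N. weight W (\<beta> * c) f (x i))
        \<le> (\<Sum>x\<in>?F. if real (hits N x W) \<le> \<kappa> then wt f x else 0)" .
      have 2: "\<beta> powr (- \<kappa>) * (\<Sum>x\<in>?F. \<Prod>i<N. weight W (\<beta> * c) f (x i)) \<le>
         \<beta> powr (- \<kappa>) * (T * exp (real N * ((\<beta> - 1) / q ^ ((s - 1) * k) + 2 * \<beta> * \<delta>)))"
        by (intro mult_left_mono mean_upper f \<beta>) auto
      have "T * (1 - 2 * (real N * \<delta>) - ?tail) = (1 - real N * (2 * \<delta>)) * T -
         \<beta> powr (- \<kappa>) * (T * exp (real N * ((\<beta> - 1) / q ^ ((s - 1) * k) + 2 * \<beta> * \<delta>)))"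
        by (simp add: algebra_simps)
      then show ?thesis using 1 2 mean_lower[OF f] by linarith
    qed
    then have "(\<Sum>f\<in>Q. T * (1 - 2 * (real N * \<delta>) - ?tail)) \<le> (\<Sum>f\<in>Q. \<Sum>x\<in>?F. if real (hits N x W)
        \<le> \<kappa> then wt f x else 0)"
      by (rule sum_mono)
    also have "\<dots> = (\<Sum>x\<in>?F. \<Sum>f\<in>Q. if real (hits N x W) \<le> \<kappa> then wt f x else 0)" by (rule sum.swap)
    also have "\<dots> = (\<Sum>x\<in>?F. tot x)" by (intro sum.cong) (auto simp: tot_def)
    finally show ?thesis by (simp add: a_def)
  qed
  define D where "D = {(f, g) \<in> Q \<times> Q. \<not> unbiased_pair m \<delta> f g}"
  have D: "real (card D) \<le> q\<^sup>2 * real (card B) * a"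
  proof -
    have "card D \<le> CARD('a) ^ 2 * card B * card Q"
      unfolding D_def Q_def B_def P_def by (rule card_not_unbiased_pairs_le)
    then have "real (card D) \<le> real (CARD('a) ^ 2 * card B * card Q)" by (simp only: of_nat_le_iff)
    then show ?thesis by (simp add: q_def a_def)
  qed
  have tot_square: "(\<Sum>x\<in>?F. (tot x)\<^sup>2) \<le> a\<^sup>2 * (T * exp (real N * (16 * \<delta>))) +
      q\<^sup>2 * real (card B) * a * (c powr \<kappa> * (T * exp (real N * (2 * \<delta>))))"
  proof -
    let ?Y = "\<lambda>z x. if real (hits N x W) \<le> \<kappa> then wt (fst z) x * wt (snd z) x else 0"
    have sq: "(tot x)\<^sup>2 = (\<Sum>z\<in>Q \<times> Q. ?Y z x)" for x
      by (simp add: tot_def power2_eq_square sum_product sum.cartesian_product case_prod_beta)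
    have good: "(\<Sum>x\<in>?F. ?Y z x) \<le> T * exp (real N * (16 * \<delta>))" if z: "z \<in> Q \<times> Q - D" for z
    proof -
      have "(\<Sum>x\<in>?F. ?Y z x) \<le> (\<Sum>x\<in>?F. wt (fst z) x * wt (snd z) x)"
        using wt_nonneg by (intro sum_mono) auto
      also have "\<dots> \<le> T * exp (real N * (16 * \<delta>))"
        using z by (intro pair_upper) (auto simp: D_def)
      finally show ?thesis .
    qed
    \<comment> \<open>For correlated pairs the second weight is replaced by its maximum
      \<open>c powr \<kappa>\<close> on the truncated sequences, and only the first one is
      averaged.\<close>
    have bad: "(\<Sum>x\<in>?F. ?Y z x) \<le> c powr \<kappa> * (T * exp (real N * (2 * \<delta>)))" if z: "z \<in> D" for z
    proof -
      have "(\<Sum>x\<in>?F. ?Y z x) \<le> (\<Sum>x\<in>?F. c powr \<kappa> * wt (fst z) x)"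
      proof (rule sum_mono)
        fix x
        show "?Y z x \<le> c powr \<kappa> * wt (fst z) x"
        proof (cases "real (hits N x W) \<le> \<kappa>")
          case True
          have "wt (snd z) x \<le> c ^ hits N x W" unfolding wt_def
              by (rule prod_weight_le_power_hits) (use c in auto)
          also have "\<dots> = c powr real (hits N x W)" using c by (simp add: powr_realpow)
          also have "\<dots> \<le> c powr \<kappa>" using True c by (intro powr_mono) auto
          finally have "wt (fst z) x * wt (snd z) x \<le> wt (fst z) x * c powr \<kappa>" using wt_nonneg
              by (intro mult_left_mono) auto
          then show ?thesis using True by (simp add: mult.commute)
        qed (use wt_nonneg[of "fst z" x] in simp)
      qed
      also have "\<dots> = c powr \<kappa> * (\<Sum>x\<in>?F. \<Prod>i<N. weight W (1 * c) (fst z) (x i))"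
        by (simp add: sum_distrib_left wt_def)
      also have "\<dots> \<le> c powr \<kappa> * (T * exp (real N * ((1 - 1) / q ^ ((s - 1) * k) + 2 * 1 * \<delta>)))"
        using z by (intro mult_left_mono mean_upper) (auto simp: D_def)
      finally show ?thesis by simp
    qed
    have finQQ: "finite (Q \<times> Q)" using finP by simp
    have DQ: "D \<subseteq> Q \<times> Q" by (auto simp: D_def)
    have "(\<Sum>x\<in>?F. (tot x)\<^sup>2) = (\<Sum>z\<in>Q \<times> Q. \<Sum>x\<in>?F. ?Y z x)" unfolding sq by (rule sum.swap)
    also have "\<dots> = (\<Sum>z\<in>Q \<times> Q - D. \<Sum>x\<in>?F. ?Y z x) + (\<Sum>z\<in>D. \<Sum>x\<in>?F. ?Y z x)"
      by (rule sum.subset_diff[OF DQ finQQ])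
    also have "\<dots> \<le> (\<Sum>z\<in>Q \<times> Q - D. T * exp (real N * (16 * \<delta>))) + (\<Sum>z\<in>D. c powr \<kappa> * (T * exp (real N
        * (2 * \<delta>))))"
      by (intro add_mono sum_mono good bad)
    also have "\<dots> = real (card (Q \<times> Q - D)) * (T * exp (real N * (16 * \<delta>))) + real (card D)
        * (c powr \<kappa> * (T * exp (real N * (2 * \<delta>))))"
      by simp
    also have "\<dots> \<le> a\<^sup>2 * (T * exp (real N * (16 * \<delta>))) + q\<^sup>2 * real (card B) * a * (c powr \<kappa> * (T
        * exp (real N * (2 * \<delta>))))"
    proof (intro add_mono mult_right_mono D)
      have "card (Q \<times> Q - D) \<le> card (Q \<times> Q)" by (intro card_mono finQQ) auto
      then have "real (card (Q \<times> Q - D)) \<le> real (card (Q \<times> Q))" by (simp only: of_nat_le_iff)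
      then show "real (card (Q \<times> Q - D)) \<le> a\<^sup>2"
          by (simp add: a_def card_cartesian_product power2_eq_square)
    qed (use T in auto)
    finally show ?thesis .
  qed
  have tot_eq_0: "tot x = 0" if x: "x \<in> ?F" "pierces (x ` {..<N}) (varieties n k s)" for x
  proof -
    have "wt f x = 0" if f: "f \<in> Q" for f
    proof -
      have pf: "poly_fun m k f" "\<not> biased m \<delta> f" using f by (auto simp: Q_def P_def)
      \<comment> \<open>A variety of the family must be nonempty; \<open>\<delta> < 1 / q\<close>
        excludes an unbiased polynomial without zeros.\<close>
      have "\<exists>y\<in>affine_points m. f y = 0"
      proof (rule ccontr)
        assume "\<not> (\<exists>y\<in>affine_points m. f y = 0)"
        then have "{y \<in> affine_points m. f y = 0} = {}" by blast
        then have "card {y \<in> affine_points m. f y = 0} = 0" by (simp only: card.empty)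
        then have "\<bar>0 - q ^ m / q\<bar> \<le> \<delta> * q ^ m"
          using card_zero_approx[OF pf(2)] by (simp only: q_def of_nat_0)
        then have "q ^ m / q \<le> \<delta> * q ^ m" using q by simp
        then have "q ^ m * (1 / q) \<le> q ^ m * \<delta>" by (simp add: mult.commute)
        then have "1 / q \<le> \<delta>" using q by (subst (asm) mult_le_cancel_left_pos) auto
        then show False using \<delta> by simp
      qed
      then have "{y \<in> coord_subspace m n. f y = 0} \<in> varieties n k s"
        by (rule coord_subspace_hypersurface_variety[OF k s n pf(1)])
      then have "x ` {..<N} \<inter> {y \<in> coord_subspace m n. f y = 0} \<noteq> {}"
        using x(2) unfolding pierces_def by blast
      then obtain i where "i < N" "x i \<in> W" "f (x i) = 0" unfolding W_def by blast
      then show "wt f x = 0" unfolding wt_def by (intro prod_zero) (auto simp: weight_def)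
    qed
    then show ?thesis by (simp add: tot_def)
  qed
  let ?E = "{x \<in> ?F. pierces (x ` {..<N}) (varieties n k s)}"
  \<comment> \<open>Chebyshev around \<open>a\<close>: on the event \<open>tot\<close> is 0, so the
    deviation is exactly \<open>a\<close>.\<close>
  have "real (card ?E) * a\<^sup>2 = (\<Sum>x\<in>?E. (tot x - a)\<^sup>2)" using tot_eq_0 by simp
  also have "\<dots> \<le> (\<Sum>x\<in>?F. (tot x - a)\<^sup>2)" using finF by (intro sum_mono2) auto
  also have "\<dots> = (\<Sum>x\<in>?F. (tot x)\<^sup>2) - 2 * a * (\<Sum>x\<in>?F. tot x) + real (card ?F) * a\<^sup>2"
    by (simp add: power2_diff sum.distrib sum_subtractf sum_distrib_left[symmetric]
        sum_distrib_right[symmetric] mult_ac)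
  also have "real (card ?F) = T" by (simp add: card_PiE card_affine_points T_def q_def)
  also have "(\<Sum>x\<in>?F. (tot x)\<^sup>2) - 2 * a * (\<Sum>x\<in>?F. tot x) + T * a\<^sup>2 \<le>
      (a\<^sup>2 * (T * exp (real N * (16 * \<delta>))) + q\<^sup>2 * real (card B) * a * (c powr \<kappa> * (T * exp (real N
          * (2 * \<delta>)))))
      - 2 * a * (a * (T * (1 - 2 * (real N * \<delta>)
      - \<beta> powr (- \<kappa>) * exp (real N * ((\<beta> - 1) / q ^ ((s - 1) * k) + 2 * \<beta> * \<delta>))))) + T * a\<^sup>2"
    using tot_square tot_lower a by (intro add_right_mono diff_mono mult_left_mono) auto
  also have "\<dots> = (T * ((exp (real N * (16 * \<delta>)) - 1) + 4 * (real N * \<delta>)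
       + q\<^sup>2 * real (card B) / a * (c powr \<kappa> * exp (real N * (2 * \<delta>)))
       + 2 * (\<beta> powr (- \<kappa>) * exp (real N * ((\<beta> - 1) / q ^ ((s - 1) * k) + 2 * \<beta> * \<delta>))))) * a\<^sup>2"
  proof -
    have "(a\<^sup>2 * (T * e1) + q2 * b * a * (l * (T * e2))) - 2 * a * (a * (T * (1 - 2 * u - e3)))
        + T * a\<^sup>2 =
      (T * ((e1 - 1) + 4 * u + q2 * b / a * (l * e2) + 2 * e3)) * a\<^sup>2" for e1 q2 b l e2 u e3 :: real
    proof -
      have "q2 * b / a * (l * e2) * a\<^sup>2 = q2 * b * a * (l * e2)"
        using a by (simp add: power2_eq_square)
      then have "T * (q2 * b / a * (l * e2) * a\<^sup>2) = T * (q2 * b * a * (l * e2))" by (rule arg_cong)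
      then show ?thesis by (simp only: power2_eq_square) (simp add: algebra_simps)
    qed
    from this show ?thesis .
  qed
  finally show ?thesis
    using a by (subst (asm) mult_le_cancel_right_pos) (auto simp: T_def a_def c_def)
qed

section \<open>Asymptotics\<close>

text \<open>The main error terms will be brought to this form with a binomial coefficient as
  \<open>C n\<close>, so that only the sign of the limit of \<open>g\<close> matters.\<close>

lemma exp_mult_tendsto_0:
  fixes C g :: "nat \<Rightarrow> real"
  assumes "filterlim C at_top sequentially" "g \<longlonglongrightarrow> L" "L < 0"
  shows "(\<lambda>n. exp (C n * g n)) \<longlonglongrightarrow> 0"
proof -
  have "filterlim (\<lambda>n. g n * C n) at_bot sequentially"
    by (rule filterlim_tendsto_neg_mult_at_bot[OF assms(2,3,1)])
  then show ?thesis by (intro filterlim_compose[OF exp_at_bot]) (simp add: mult.commute)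
qed

lemma binomial_over_power_tendsto: "(\<lambda>n. real (n choose k) / real n ^ k) \<longlonglongrightarrow> 1 / fact k"
proof (induction k)
  case (Suc k)
  have "(\<lambda>n. real (n choose k) / real n ^ k * ((real n - real k) / real n / real (Suc k)))
      \<longlonglongrightarrow> 1 / fact k * (1 / real (Suc k))"
    by (intro tendsto_mult Suc tendsto_divide) (real_asymp, auto)
  moreover have "eventually (\<lambda>n. real (n choose k) / real n ^ k * ((real n - real k) / real n
      / real (Suc k)) = real (n choose Suc k) / real n ^ Suc k) sequentially"
    using eventually_ge_at_top[of "Suc k"]
  proof eventually_elim
    case (elim n)
    obtain n' where n': "n = Suc n'" using elim by (cases n) auto
    have "Suc k * (n choose Suc k) = (n - k) * (n choose k)"
      using Suc_times_binomial_eq[of n' k] binomial_absorb_comp[of n k] unfolding n'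
          by (simp add: mult_ac)
    then have "real (Suc k * (n choose Suc k)) = real ((n - k) * (n choose k))" by (simp only:)
    then have "real (Suc k) * real (n choose Suc k) = (real n - real k) * real (n choose k)"
      using elim by (simp only: of_nat_mult of_nat_diff[of k n] Suc_leD)
    then have "real (n choose Suc k) = (real n - real k) * real (n choose k) / real (Suc k)"
      by (metis nonzero_mult_div_cancel_left of_nat_0_neq)
    then show ?case by (simp add: mult_ac del: of_nat_Suc)
  qed
  ultimately have "(\<lambda>n. real (n choose Suc k) / real n ^ Suc k) \<longlonglongrightarrow> 1 / fact k * (1 / real (Suc k))"
    by (rule Lim_transform_eventually)
  then show ?case by (simp add: mult.commute)
qed simp

lemma binomial_add_ratio_tendsto: "(\<lambda>n. real ((n + a) choose k) / real (n choose k)) \<longlonglongrightarrow> 1"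
proof -
  have 1: "(\<lambda>n. real ((n + a) choose k) / real (n + a) ^ k) \<longlonglongrightarrow> 1 / fact k"
    using LIMSEQ_ignore_initial_segment[OF binomial_over_power_tendsto, of a k] .
  have 2: "(\<lambda>n. (real (n + a) / real n) ^ k) \<longlonglongrightarrow> 1 ^ k"
    by (intro tendsto_power) real_asymp
  have "(\<lambda>n. real ((n + a) choose k) / real (n + a) ^ k * (real (n + a) / real n) ^ k
      / (real (n choose k) / real n ^ k))
      \<longlonglongrightarrow> 1 / fact k * 1 ^ k / (1 / fact k)"
    by (intro tendsto_divide tendsto_mult 1 2 binomial_over_power_tendsto) simp
  then have "(\<lambda>n. real ((n + a) choose k) / real (n + a) ^ k * (real (n + a) / real n) ^ k
      / (real (n choose k) / real n ^ k)) \<longlonglongrightarrow> 1"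
    by simp
  moreover have "eventually (\<lambda>n. real ((n + a) choose k) / real (n + a) ^ k * (real (n
      + a) / real n) ^ k / (real (n choose k) / real n ^ k)
      = real ((n + a) choose k) / real (n choose k)) sequentially"
    using eventually_gt_at_top[of 0] by eventually_elim (simp add: power_divide)
  ultimately show ?thesis by (rule Lim_transform_eventually)
qed

lemma binomial_diff_ratio_tendsto: "(\<lambda>n. real ((n - a) choose k) / real (n choose k)) \<longlonglongrightarrow> 1"
proof (rule LIMSEQ_offset[of _ a])
  have "(\<lambda>n. inverse (real ((n + a) choose k) / real (n choose k))) \<longlonglongrightarrow> inverse 1"
    by (intro tendsto_inverse binomial_add_ratio_tendsto) simp
  then show "(\<lambda>n. real ((n + a - a) choose k) / real ((n + a) choose k)) \<longlonglongrightarrow> 1" by simp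
qed

lemma binomial_at_top:
  assumes "k > 0"
  shows "filterlim (\<lambda>n. real (n choose k)) at_top sequentially"
proof -
  have "filterlim (\<lambda>n. real (n choose k) / real n ^ k * real n ^ k) at_top sequentially"
    by (rule filterlim_tendsto_pos_mult_at_top[OF binomial_over_power_tendsto])
      (use assms in \<open>auto intro!: filterlim_pow_at_top filterlim_real_sequentially\<close>)
  moreover have "eventually (\<lambda>n. real (n choose k) / real n ^ k * real n ^ k
      = real (n choose k)) sequentially"
    using eventually_gt_at_top[of 0] by eventually_elim simp
  ultimately show ?thesis by (simp cong: filterlim_cong)
qed

lemma power_over_exp_sqrt_tendsto_0: "(\<lambda>n. real n ^ j / 2 powr sqrt (real n)) \<longlonglongrightarrow> 0"
proof -
  have "((\<lambda>x :: real. x ^ (2 * j) / exp x) \<longlongrightarrow> 0) at_top" by (rule tendsto_power_div_exp_0)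
  moreover have "filterlim (\<lambda>n. ln 2 * sqrt (real n)) at_top sequentially" by real_asymp
  ultimately have "(\<lambda>n. (ln 2 * sqrt (real n)) ^ (2 * j) / exp (ln 2 * sqrt (real n))) \<longlonglongrightarrow> 0"
    by (rule filterlim_compose)
  then have "(\<lambda>n. (1 / ln 2) ^ (2 * j) * ((ln 2 * sqrt (real n)) ^ (2 * j) / exp (ln 2
      * sqrt (real n)))) \<longlonglongrightarrow> (1 / ln 2) ^ (2 * j) * 0"
    by (intro tendsto_mult tendsto_const)
  moreover have "(1 / ln 2) ^ (2 * j) * ((ln 2 * sqrt (real n)) ^ (2 * j) / exp (ln 2
      * sqrt (real n))) = real n ^ j / 2 powr sqrt (real n)" for n
  proof -
    have "sqrt (real n) ^ (2 * j) = real n ^ j" by (simp add: power_mult)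
    then show ?thesis by (simp add: power_mult_distrib power_one_over powr_def mult.commute)
  qed
  ultimately show ?thesis by simp
qed

text \<open>Says that a single unbiased equation is the hardest case. For \<open>t = 1\<close> both
  sides agree. For \<open>t \<ge> 2\<close> elementary bounds for the logarithm reduce it to
  \<open>t \<le> (q - 1) * q ^ (t - 2)\<close>, where \<open>t = 2\<close> needs
  \<open>q \<ge> 3\<close>, after \<open>q ^ (k * (t - 1))\<close> has been bounded below by its
  value for \<open>k = 2\<close>.\<close>

lemma tilt_key_ineq:
  assumes "q \<ge> 3" "k \<ge> 2" "t > 0"
  shows "real t * ln (tilt q 1) \<le> q ^ (k * (t - 1)) * ln (tilt q t)"
proof (cases "t = 1")
  case False
  then obtain u where u: "t = u + 2" using assms(3)
      by (metis One_nat_def Suc_pred add_2_eq_Suc' less_antisym not_gr_zero)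
  have q: "q > 1" "q > 0" using assms by auto
  have "tilt q 1 = 1 + 1 / (q - 1)" using q by (simp add: tilt_def field_simps)
  moreover have "ln (1 + 1 / (q - 1)) \<le> 1 / (q - 1)" using q by (intro ln_add_one_self_le_self) simp
  ultimately have 1: "ln (tilt q 1) \<le> 1 / (q - 1)" by simp
  have x: "0 < 1 / q ^ t" "1 / q ^ t < 1" using q assms(3) by auto
  have "ln (1 - 1 / q ^ t) \<le> (1 - 1 / q ^ t) - 1" using x by (intro ln_le_minus_one) auto
  then have 2: "1 / q ^ t \<le> ln (tilt q t)" using x by (simp add: tilt_def ln_div)
  have "real u + 2 \<le> 2 * 3 ^ u" by (induction u) auto
  also have "\<dots> \<le> (q - 1) * q ^ u" using assms(1) by (intro mult_mono power_mono) auto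
  finally have 3: "real t \<le> (q - 1) * q ^ u" by (simp add: u)
  have "real t * ln (tilt q 1) \<le> real t * (1 / (q - 1))" using 1 by (intro mult_left_mono) auto
  also have "\<dots> \<le> q ^ u" using 3 q by (simp add: field_simps)
  also have "\<dots> = q ^ (2 * (t - 1)) * (1 / q ^ t)" using q
      by (simp add: u power_add[symmetric] field_simps)
  also have "\<dots> \<le> q ^ (k * (t - 1)) * (1 / q ^ t)"
    using q assms(2) by (intro mult_right_mono power_increasing) auto
  also have "\<dots> \<le> q ^ (k * (t - 1)) * ln (tilt q t)" using 2 q by (intro mult_left_mono) auto
  finally show ?thesis .
qed simp

(* HOL-Algebra's constant would shadow the number-theoretic one. *)
hide_const (open) Divisibility.prime

text \<open>The limit is taken along all integers, where \<open>p * ln (1 + 1 / (p - 1))\<close>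
  tends to 1, and the filter is restricted to primes only at the end.\<close>

lemma threshold_const_asymp_equiv:
  "(\<lambda>p. threshold_const p k s) \<sim>[inf at_top (principal {p. prime p})] (\<lambda>p. real p ^ ((s - 1) * k
      + 1) * ln (real p))"
proof (rule asymp_equivI')
  have "(\<lambda>p. 1 / (real p * ln (1 + inverse (real p - 1)))) \<longlonglongrightarrow> 1" by real_asymp
  moreover have "eventually (\<lambda>p. 1 / (real p * ln (1 + inverse (real p - 1))) =
      threshold_const p k s / (real p ^ ((s - 1) * k + 1) * ln (real p))) at_top"
    using eventually_ge_at_top[of 2] by eventually_elim (simp add: threshold_const_def)
  ultimately have "((\<lambda>p. threshold_const p k s / (real p ^ ((s - 1) * k
      + 1) * ln (real p))) \<longlongrightarrow> 1) at_top"
    by (rule Lim_transform_eventually)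
  then show "((\<lambda>p. threshold_const p k s / (real p ^ ((s - 1) * k + 1) * ln (real p))) \<longlongrightarrow> 1) (inf
      at_top (principal {p. prime p}))"
    by (rule filterlim_mono) auto
qed

text \<open>
  The level is \<open>o(1 / N)\<close> for \<open>N = O(n ^ k)\<close> points, so that the deviations of all \<open>N\<close> points add
  up to \<open>o(1)\<close>; still, about \<open>sqrt n\<close> directions suffice to determine the polynomials biased at
  this level.
\<close>

definition bias_level :: "nat \<Rightarrow> nat \<Rightarrow> real" where
  "bias_level k n = 1 / real n ^ (k + 1)"

text \<open>The exponent of the bound in \<open>card_biased_le\<close> for
  \<open>d = nat \<lfloor>sqrt (real n)\<rfloor>\<close>: 1 for the additive constant, and for each
  direction \<open>n\<close> plus the exponent of the number of derivatives, of degree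
  \<open>k - 1\<close>.\<close>

definition bias_exponent :: "nat \<Rightarrow> nat \<Rightarrow> nat" where
  "bias_exponent k n = 1 + nat \<lfloor>sqrt (real n)\<rfloor> * (n + ((n + (k - 1)) choose (k - 1)))"

text \<open>The exponent has order at most \<open>n ^ (k - 1)\<close> times \<open>sqrt n\<close>;
  \<open>k \<ge> 2\<close> is what lets this order absorb the \<open>n\<close> spent on each
  direction.\<close>

lemma bias_exponent_over_binomial_tendsto:
  assumes "k \<ge> 2"
  shows "(\<lambda>n. real (bias_exponent k n) / real (n choose k)) \<longlonglongrightarrow> 0"
proof -
  define j where "j = k - 1"
  have k: "k = Suc j" "j \<ge> 1" using assms by (auto simp: j_def)
  have "(\<lambda>n. real (bias_exponent k n) / real n ^ k) \<longlonglongrightarrow> 0"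
  proof (rule tendsto_sandwich)
    show "eventually (\<lambda>n. 0 \<le> real (bias_exponent k n) / real n ^ k) sequentially" by simp
    show "eventually (\<lambda>n. real (bias_exponent k n) / real n ^ k \<le>
        1 / real n + sqrt (real n) / real n * (1 + real ((n + j) choose j)
            / real n ^ j)) sequentially"
      using eventually_ge_at_top[of 1]
    proof eventually_elim
      case (elim n)
      define B where "B = real ((n + j) choose j)"
      have n: "real n \<ge> 1" using elim by simp
      have "real (nat \<lfloor>sqrt (real n)\<rfloor>) \<le> sqrt (real n)" by simp
      then have "real (nat \<lfloor>sqrt (real n)\<rfloor>) * (real n + B) \<le> sqrt (real n) * (real n + B)"
        by (intro mult_right_mono) (auto simp: B_def)
      also have "\<dots> \<le> sqrt (real n) * (real n ^ j + B)"
        using n k(2) self_le_power[of "real n" j] by (intro mult_left_mono add_right_mono) auto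
      finally have "real (bias_exponent k n) \<le> real n ^ j + sqrt (real n) * (real n ^ j + B)"
        using one_le_power[OF n, of j] by (simp add: bias_exponent_def B_def j_def[symmetric] del:
            One_nat_def)
      then have "real (bias_exponent k n) / real n ^ k \<le> (real n ^ j + sqrt (real n) * (real n ^ j
          + B)) / real n ^ k"
        by (intro divide_right_mono) auto
      also have "\<dots> = 1 / real n + sqrt (real n) / real n * (1 + B / real n ^ j)"
        using n by (simp add: k(1) field_simps)
      finally show ?case by (simp add: B_def)
    qed
    have "(\<lambda>n. real ((n + j) choose j) / real (n choose j) * (real (n choose j) / real n ^ j))
        \<longlonglongrightarrow> 1 * (1 / fact j)"
      by (intro tendsto_mult binomial_add_ratio_tendsto binomial_over_power_tendsto)
    moreover have "eventually (\<lambda>n. real ((n + j) choose j) / real (n choose j) * (real (n choose j)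
        / real n ^ j) =
        real ((n + j) choose j) / real n ^ j) sequentially"
      using eventually_ge_at_top[of j] by eventually_elim simp
    ultimately have B: "(\<lambda>n. real ((n + j) choose j) / real n ^ j) \<longlonglongrightarrow> 1 * (1 / fact j)"
      by (rule Lim_transform_eventually)
    have "(\<lambda>n. 1 / real n + sqrt (real n) / real n * (1 + real ((n + j) choose j) / real n ^ j)) \<longlonglongrightarrow>
        0 + 0 * (1 + 1 * (1 / fact j))"
      by (intro tendsto_add tendsto_mult B tendsto_const) real_asymp+
    then show "(\<lambda>n. 1 / real n + sqrt (real n) / real n * (1 + real ((n + j) choose j)
        / real n ^ j)) \<longlonglongrightarrow> 0" by simp
  qed simp
  then have "(\<lambda>n. real (bias_exponent k n) / real n ^ k / (real (n choose k) / real n ^ k))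
      \<longlonglongrightarrow> 0 / (1 / fact k)"
    by (rule tendsto_divide[OF _ binomial_over_power_tendsto]) simp
  moreover have "eventually (\<lambda>n. real (bias_exponent k n) / real n ^ k / (real (n choose k)
      / real n ^ k) =
      real (bias_exponent k n) / real (n choose k)) sequentially"
    using eventually_gt_at_top[of 0] by eventually_elim simp
  ultimately have "(\<lambda>n. real (bias_exponent k n) / real (n choose k)) \<longlonglongrightarrow> 0 / (1 / fact k)"
    by (rule Lim_transform_eventually)
  then show ?thesis by simp
qed

lemma eventually_card_biased_le:
  assumes "k \<ge> 2"
  shows "eventually (\<lambda>n. real (card {f :: (nat \<Rightarrow> 'a::prime_field) \<Rightarrow> 'a. poly_fun n k f
      \<and> biased n (bias_level k n) f})
    \<le> real CARD('a) ^ bias_exponent k n) sequentially"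
proof -
  define q where "q = real CARD('a)"
  have q: "q \<ge> 2" using CARD_real_ge_2[where 'a = 'a] by (simp add: q_def)
  define j where "j = k - 1"
  have k: "k = Suc j" using assms by (simp add: j_def)
  \<comment> \<open>Twice the 32 of \<open>card_biased_le\<close>; the factor 2 makes up for
    rounding \<open>sqrt (real n)\<close> down to \<open>d\<close>.\<close>
  define K where "K = 64 * q ^ (j + 4)"
  have "eventually (\<lambda>n. real n ^ (2 * (k + 1)) / 2 powr sqrt (real n) < 1 / K) sequentially"
    by (rule order_tendstoD(2)[OF power_over_exp_sqrt_tendsto_0]) (use q in \<open>simp add: K_def\<close>)
  with eventually_ge_at_top[of 1] show ?thesis
  proof eventually_elim
    case (elim n)
    define d where "d = nat \<lfloor>sqrt (real n)\<rfloor>"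
    have n: "real n > 0" using elim by simp
    have "sqrt (real n) \<le> real d + 1" unfolding d_def by linarith
    then have "2 powr sqrt (real n) \<le> 2 powr (real d + 1)" by (intro powr_mono) auto
    also have "\<dots> = 2 * 2 ^ d" by (simp add: powr_add powr_realpow)
    also have "\<dots> \<le> 2 * q ^ d" using q by (intro mult_left_mono power_mono) auto
    finally have 1: "2 powr sqrt (real n) \<le> 2 * q ^ d" .
    have "K > 0" using q by (simp add: K_def)
    then have "K * real n ^ (2 * (k + 1)) < 2 powr sqrt (real n)" using elim(2)
        by (simp add: field_simps)
    then have "32 * q ^ (j + 4) * real n ^ (2 * (k + 1)) < q ^ d" using 1 by (simp add: K_def)
    then have "32 * q ^ (j + 4) < q ^ d / real n ^ (2 * (k + 1))" using n
        by (simp add: pos_less_divide_eq)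
    also have "\<dots> = q ^ d * (bias_level k n)\<^sup>2"
      by (simp add: bias_level_def power_divide power_mult[symmetric] power_add[symmetric]
          algebra_simps power2_eq_square mult_2_right)
    finally have "32 * q ^ (j + 4) < q ^ d * (bias_level k n)\<^sup>2" .
    then have "card {f :: (nat \<Rightarrow> 'a) \<Rightarrow> 'a. poly_fun n (Suc j) f \<and> biased n (bias_level k n) f}
        \<le> CARD('a) * (CARD('a) ^ n * CARD('a) ^ ((n + j) choose j)) ^ d"
      using n unfolding q_def by (intro card_biased_le) (auto simp: bias_level_def)
    also have "\<dots> = CARD('a) ^ bias_exponent k n"
      by (simp add: bias_exponent_def d_def j_def power_add[symmetric] power_mult[symmetric]
          mult.commute)
    finally have "real (card {f :: (nat \<Rightarrow> 'a) \<Rightarrow> 'a. poly_fun n (Suc j) f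
        \<and> biased n (bias_level k n) f}) \<le> real (CARD('a) ^ bias_exponent k n)"
      by (simp only: of_nat_le_iff)
    then show ?case by (simp add: k)
  qed
qed

lemma bias_level_tendsto_0: "(\<lambda>n. bias_level k n) \<longlonglongrightarrow> 0"
proof -
  have "filterlim (\<lambda>n. real n ^ (k + 1)) at_top sequentially"
    by (intro filterlim_pow_at_top filterlim_real_sequentially) simp
  then show ?thesis unfolding bias_level_def
    by (intro tendsto_divide_0[OF tendsto_const] filterlim_at_top_imp_at_infinity)
qed

lemma ln_ge_one_minus_inverse:
  assumes "\<beta> > 0"
  shows "1 - 1 / \<beta> \<le> ln (\<beta> :: real)"
  using ln_le_minus_one[of "1 / \<beta>"] assms by (simp add: ln_div)

lemma power_eq_exp_ln: "(q :: real) > 0 \<Longrightarrow> q ^ m = exp (real m * ln q)"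
  by (simp add: exp_of_nat_mult)

lemma threshold_const_eq:
  assumes "p \<ge> 2"
  shows "threshold_const p k s = real p ^ ((s - 1) * k) * ln (real p) / ln (tilt (real p) 1)"
proof -
  have "1 + inverse (real p - 1) = tilt (real p) 1"
    using assms by (simp add: tilt_def field_simps)
  then show ?thesis by (simp add: threshold_const_def)
qed

lemma tilt_gt_1: "q \<ge> 2 \<Longrightarrow> t > 0 \<Longrightarrow> 1 < tilt q t"
proof -
  assume "q \<ge> 2" "t > 0"
  then have "2 \<le> q ^ t" using self_le_power[of q t] by simp
  then show ?thesis unfolding tilt_def by (simp add: field_simps)
qed

section \<open>Above the threshold: the union bound vanishes\<close>

lemma not_piercing_density_tendsto_0:
  fixes k s :: nat and \<epsilon> :: real
  defines "q \<equiv> real CARD('a::prime_field)"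
  defines "N \<equiv> \<lambda>n. nat \<lceil>(threshold_const CARD('a) k s + \<epsilon>) * real (n choose k)\<rceil>"
  assumes q3: "q \<ge> 3" and k: "k \<ge> 2" and s: "s \<ge> 1" and \<epsilon>: "\<epsilon> > 0"
  shows "(\<lambda>n. real (card {x \<in> {..<N n} \<rightarrow>\<^sub>E (affine_points n :: (nat \<Rightarrow> 'a) set).
    \<not> pierces (x ` {..<N n}) (varieties n k s)}) / (q ^ n) ^ N n) \<longlonglongrightarrow> 0"
proof -
  have q: "q \<ge> 2" "q > 0" using q3 by auto
  define c where "c = threshold_const CARD('a) k s"
  define l where "l = (\<lambda>t. ln (tilt q t))"
  have l: "l t > 0" if "t > 0" for t using tilt_gt_1[OF q(1) that] by (simp add: l_def)
  have c_eq: "c = q ^ ((s - 1) * k) * ln q / l 1"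
    unfolding c_def l_def q_def by (rule threshold_const_eq) (rule two_le_CARD)
  have c: "c > 0" using q l[of 1] by (simp add: c_eq)
  define C where "C = (\<lambda>n. real (n choose k))"
  have Ctop: "filterlim C at_top sequentially" unfolding C_def
      by (rule binomial_at_top) (use k in simp)
  have C1: "eventually (\<lambda>n. C n \<ge> 1) sequentially" using Ctop by (simp add: filterlim_at_top)
  \<comment> \<open>Requiring only a proportion \<theta> of the expected hits replaces
    \<open>c + \<epsilon>\<close> by \<open>c + \<epsilon> / 2\<close>, which still exceeds
    \<open>c\<close>.\<close>
  define \<theta> where "\<theta> = (c + \<epsilon> / 2) / (c + \<epsilon>)"
  have \<theta>: "0 < \<theta>" "\<theta> < 1" "\<theta> * (c + \<epsilon>) = c + \<epsilon> / 2" using c \<epsilon> by (simp_all add: \<theta>_def)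
  \<comment> \<open>Any \<beta> strictly between 1 and \<open>1 / \<theta>\<close> makes the
    Chernoff exponent negative; this is the midpoint.\<close>
  define \<beta> where "\<beta> = (1 + 1 / \<theta>) / 2"
  have "1 / \<theta> > 1" using \<theta> by simp
  then have \<beta>: "\<beta> > 1" by (simp add: \<beta>_def)
  have "\<theta> * \<beta> = (\<theta> + 1) / 2" using \<theta>(1) by (simp add: \<beta>_def distrib_left)
  then have \<theta>\<beta>: "\<theta> * \<beta> < 1" using \<theta>(2) by simp
  have \<beta>_neg: "\<theta> * ln \<beta> - (1 - 1 / \<beta>) < 0"
  proof -
    have "\<theta> * ln \<beta> \<le> \<theta> * (\<beta> - 1)" using \<theta> \<beta> by (intro mult_left_mono ln_le_minus_one) auto
    also have "\<theta> < 1 / \<beta>" using \<beta> \<theta>\<beta> by (simp add: pos_less_divide_eq)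
    then have "\<theta> * (\<beta> - 1) < 1 / \<beta> * (\<beta> - 1)" using \<beta> by (intro mult_strict_right_mono) auto
    also have "1 / \<beta> * (\<beta> - 1) = 1 - 1 / \<beta>" using \<beta> by (simp add: diff_divide_distrib)
    finally show ?thesis by simp
  qed
  define x where "x = (\<lambda>n. real (N n) / C n)"
  define y where "y = (\<lambda>n. real (bias_exponent k n) / C n)"
  define z where "z = (\<lambda>n. real ((n + k) choose k) / C n)"
  define \<delta> where "\<delta> = (\<lambda>n. bias_level k n)"
  have y: "y \<longlonglongrightarrow> 0" unfolding y_def C_def by (rule bias_exponent_over_binomial_tendsto[OF k])
  have z: "z \<longlonglongrightarrow> 1" unfolding z_def C_def by (rule binomial_add_ratio_tendsto)
  have \<delta>: "\<delta> \<longlonglongrightarrow> 0" unfolding \<delta>_def by (rule bias_level_tendsto_0)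
  have \<delta>0: "\<delta> n \<ge> 0" for n by (simp add: \<delta>_def bias_level_def)
  have x: "x \<longlonglongrightarrow> c + \<epsilon>"
  proof (rule tendsto_sandwich)
    show "eventually (\<lambda>n. c + \<epsilon> \<le> x n) sequentially" using C1
    proof eventually_elim
      case (elim n)
      have "(c + \<epsilon>) * C n \<le> real (N n)" unfolding N_def c_def C_def by linarith
      then show ?case using elim by (simp add: x_def pos_le_divide_eq)
    qed
    show "eventually (\<lambda>n. x n \<le> c + \<epsilon> + 1 / C n) sequentially" using C1
    proof eventually_elim
      case (elim n)
      have "(c + \<epsilon>) * C n \<ge> 0" using c \<epsilon> elim by simp
      then have "real (N n) \<le> (c + \<epsilon>) * C n + 1" unfolding N_def c_def C_def by linarith
      then show ?case using elim by (simp add: x_def pos_divide_le_eq distrib_right)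
    qed
    have "(\<lambda>n. c + \<epsilon> + 1 / C n) \<longlonglongrightarrow> c + \<epsilon> + 0"
      by (intro tendsto_add tendsto_const tendsto_divide_0[OF tendsto_const]
          filterlim_at_top_imp_at_infinity Ctop)
    then show "(\<lambda>n. c + \<epsilon> + 1 / C n) \<longlonglongrightarrow> c + \<epsilon>" by simp
  qed simp
  \<comment> \<open>Bounds for the logarithms of the two kinds of summands, divided by
    \<open>C n\<close>. In the limit only the hits and the \<open>s - r\<close> remaining
    polynomials count, since \<open>y\<close> and \<delta> tend to 0.\<close>
  define g1 where "g1 = (\<lambda>r n. real r * y n * ln q + x n * (1 / q ^ (k * r)) * (\<theta> * ln \<beta> - (1
      - 1 / \<beta>)))"
  define g2 where "g2 = (\<lambda>r n. real r * y n * ln q + real (s - r) * z n * ln q + 4 * x n * \<delta> n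
      - \<theta> / q ^ (k * r) * x n * l (s - r))"
  have lim1: "(\<lambda>n. exp (C n * g1 r n)) \<longlonglongrightarrow> 0" for r
  proof (rule exp_mult_tendsto_0[OF Ctop])
    show "g1 r \<longlonglongrightarrow> real r * 0 * ln q + (c + \<epsilon>) * (1 / q ^ (k * r)) * (\<theta> * ln \<beta> - (1 - 1 / \<beta>))"
      unfolding g1_def by (intro tendsto_add tendsto_mult x y tendsto_const)
    show "real r * 0 * ln q + (c + \<epsilon>) * (1 / q ^ (k * r)) * (\<theta> * ln \<beta> - (1 - 1 / \<beta>)) < 0"
      using \<beta>_neg c \<epsilon> q by (simp add: mult_pos_neg divide_neg_pos)
  qed
  have lim2: "(\<lambda>n. exp (C n * g2 r n)) \<longlonglongrightarrow> 0" if r: "r < s" for r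
  proof (rule exp_mult_tendsto_0[OF Ctop])
    show "g2 r \<longlonglongrightarrow> real r * 0 * ln q + real (s - r) * 1 * ln q + 4 * (c + \<epsilon>) * 0 - \<theta> / q ^ (k * r)
        * (c + \<epsilon>) * l (s - r)"
      unfolding g2_def by (intro tendsto_add tendsto_diff tendsto_mult x y z \<delta> tendsto_const)
    define t where "t = s - r"
    have t: "t > 0" using r by (simp add: t_def)
    have key: "real t * l 1 \<le> q ^ (k * (t - 1)) * l t"
      unfolding l_def by (rule tilt_key_ineq[OF q3 k t])
    have "k * r + k * (t - 1) = (s - 1) * k"
    proof -
      have "r + (t - 1) = s - 1" using r by (simp add: t_def)
      then show ?thesis by (metis distrib_left mult.commute)
    qed
    then have pw: "q ^ ((s - 1) * k) = q ^ (k * r) * q ^ (k * (t - 1))"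
        by (simp add: power_add[symmetric])
    \<comment> \<open>The chain compares the entropy of \<open>t\<close> unbiased polynomials, per
      unit of \<open>C n\<close>, with the gain from \<open>c / q ^ (k * r)\<close> hits of
      \<open>W\<close>, each of which misses a set of proportion \<open>1 / q ^ t\<close>. For
      \<open>t = 1\<close> equality with \<open>c\<close> is the definition of the constant.\<close>
    have "real t * ln q = real t * l 1 * (ln q / l 1)" using l[of 1] by simp
    also have "\<dots> \<le> q ^ (k * (t - 1)) * l t * (ln q / l 1)"
      using key q l[of 1] by (intro mult_right_mono) auto
    also have "\<dots> = c / q ^ (k * r) * l t"
    proof -
      define u v where "u = q ^ (k * r)" and "v = q ^ (k * (t - 1))"
      have "u \<noteq> 0" using q by (simp add: u_def)
      then show ?thesis unfolding c_eq pw u_def[symmetric] v_def[symmetric] by simp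
    qed
    also have "\<dots> < (c + \<epsilon> / 2) / q ^ (k * r) * l t"
      using l[OF t] \<epsilon> q by (intro mult_strict_right_mono divide_strict_right_mono) auto
    also have "\<dots> = \<theta> / q ^ (k * r) * (c + \<epsilon>) * l t" unfolding \<theta>(3)[symmetric] by simp
    finally show "real r * 0 * ln q + real (s - r) * 1 * ln q + 4 * (c + \<epsilon>) * 0 - \<theta> / q ^ (k * r)
        * (c + \<epsilon>) * l (s - r) < 0"
      by (simp add: t_def)
  qed
  let ?E = "\<lambda>n. {x \<in> {..<N n} \<rightarrow>\<^sub>E (affine_points n :: (nat \<Rightarrow> 'a) set). \<not> pierces (x ` {..<N n})
      (varieties n k s)}"
  let ?R = "\<lambda>n. (\<Sum>r\<le>s. exp (C n * g1 r n)) + (\<Sum>r<s. exp (C n * g2 r n))"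
  have bound: "eventually (\<lambda>n. real (card (?E n)) / (q ^ n) ^ N n \<le> ?R n) sequentially"
    using C1 eventually_card_biased_le[OF k, where 'a = 'a]
  proof eventually_elim
    case (elim n)
    define P where "P = {f :: (nat \<Rightarrow> 'a) \<Rightarrow> 'a. poly_fun n k f}"
    define B where "B = {f \<in> P. biased n (\<delta> n) f}"
    have C: "C n > 0" using elim by simp
    have Ceq: "real (N n) = C n * x n" "real (bias_exponent k n) = C n * y n" "real ((n
        + k) choose k) = C n * z n"
      using C by (auto simp: x_def y_def z_def)
    have "0 < (c + \<epsilon>) * C n" using c \<epsilon> C by simp
    then have Npos: "N n > 0" unfolding N_def c_def C_def by linarith
    have B: "real (card B) \<le> exp (C n * y n * ln q)"
    proof -
      have "B = {f :: (nat \<Rightarrow> 'a) \<Rightarrow> 'a. poly_fun n k f \<and> biased n (bias_level k n) f}"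
        unfolding B_def P_def \<delta>_def by simp
      then have "real (card B) \<le> q ^ bias_exponent k n" using elim(2) unfolding q_def by simp
      also have "\<dots> = exp (C n * y n * ln q)" using q unfolding Ceq(2)[symmetric]
          by (intro power_eq_exp_ln)
      finally show ?thesis .
    qed
    have Br: "real (card B) ^ r \<le> exp (real r * (C n * y n * ln q))" for r
      using power_mono[OF B, of r] by (simp add: exp_of_nat_mult)
    have P: "real (card P) ^ t \<le> exp (real t * (C n * z n * ln q))" for t
    proof -
      have "card P \<le> CARD('a) ^ ((n + k) choose k)" unfolding P_def by (rule card_poly_fun)
      then have "real (card P) \<le> real (CARD('a) ^ ((n + k) choose k))" by (simp only: of_nat_le_iff)
      also have "\<dots> = q ^ ((n + k) choose k)" by (simp add: q_def)
      also have "\<dots> = exp (C n * z n * ln q)" using q unfolding Ceq(3)[symmetric]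
          by (intro power_eq_exp_ln)
      finally show ?thesis using power_mono[of "real (card P)" _ t] by (simp add: exp_of_nat_mult)
    qed
    have t1: "real (card B) ^ r * (\<beta> powr (\<theta> / q ^ (k * r) * real (N n)) * exp (- (real (N n) * (1
        / q ^ (k * r)) * (1 - 1 / \<beta>))))
      \<le> exp (C n * g1 r n)" for r
    proof -
      have "\<beta> powr (\<theta> / q ^ (k * r) * real (N n)) = exp (\<theta> / q ^ (k * r) * (C n * x n) * ln \<beta>)"
        using \<beta> by (simp add: powr_def Ceq)
      then have "real (card B) ^ r * (\<beta> powr (\<theta> / q ^ (k * r) * real (N n)) * exp (- (real (N n)
          * (1 / q ^ (k * r)) * (1 - 1 / \<beta>))))
        \<le> exp (real r * (C n * y n * ln q)) * (exp (\<theta> / q ^ (k * r) * (C n * x n) * ln \<beta>)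
            * exp (- ((C n * x n) * (1 / q ^ (k * r)) * (1 - 1 / \<beta>))))"
        using Br[of r] by (simp add: Ceq mult_right_mono)
      also have "\<dots> = exp (C n * g1 r n)"
      proof -
        have "a1 * (c1 * y1 * L) + (\<theta> / K * (c1 * x1) * b1 + - (c1 * x1 * (1 / K) * (1 - j))) =
          c1 * (a1 * y1 * L + x1 * (1 / K) * (\<theta> * b1 - (1 - j)))" if "K \<noteq> 0"
              for a1 c1 y1 L K x1 b1 j :: real
          using that by (simp add: field_simps)
        then show ?thesis unfolding exp_add[symmetric] g1_def using q(2) by simp
      qed
      finally show ?thesis .
    qed
    have t2: "real (card B) ^ r * real (card P) ^ (s - r) *
        (tilt q (s - r) powr (- (\<theta> / q ^ (k * r) * real (N n))) * exp (real (N n) * (4 * \<delta> n)))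
            \<le> exp (C n * g2 r n)"
      if r: "r < s" for r
    proof -
      have "tilt q (s - r) powr (- (\<theta> / q ^ (k * r) * real (N n))) = exp (- (\<theta> / q ^ (k * r) * (C n
          * x n)) * l (s - r))"
        using tilt_gt_1[OF q(1), of "s - r"] r by (simp add: powr_def Ceq l_def)
      then have "real (card B) ^ r * real (card P) ^ (s - r) *
        (tilt q (s - r) powr (- (\<theta> / q ^ (k * r) * real (N n))) * exp (real (N n) * (4 * \<delta> n)))
        \<le> exp (real r * (C n * y n * ln q)) * exp (real (s - r) * (C n * z n * ln q)) *
          (exp (- (\<theta> / q ^ (k * r) * (C n * x n)) * l (s - r)) * exp ((C n * x n) * (4 * \<delta> n)))"
        using Br[of r] P[of "s - r"] by (simp only: Ceq) (intro mult_mono; simp)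
      also have "\<dots> = exp (C n * g2 r n)"
      proof -
        have "a1 * (c1 * y1 * L) + a2 * (c1 * z1 * L) + (- (\<theta> / K * (c1 * x1)) * l1 + c1 * x1 * (4
            * d1)) =
          c1 * (a1 * y1 * L + a2 * z1 * L + 4 * x1 * d1 - \<theta> / K * x1 * l1)"
          if "K \<noteq> 0" for a1 a2 c1 y1 z1 L K x1 l1 d1 :: real
          using that by (simp add: field_simps)
        then show ?thesis unfolding exp_add[symmetric] g2_def using q(2) by simp
      qed
      finally show ?thesis .
    qed
    have "real (card (?E n)) \<le>
      (q ^ n) ^ N n * (\<Sum>r\<le>s. real (card B) ^ r * (\<beta> powr (\<theta> / q ^ (k * r) * real (N n))
          * exp (- (real (N n) * (1 / q ^ (k * r)) * (1 - 1 / \<beta>)))))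
      + (q ^ n) ^ N n * (\<Sum>r<s. real (card B) ^ r * real (card P) ^ (s - r) *
        (tilt q (s - r) powr (- (\<theta> / q ^ (k * r) * real (N n))) * exp (real (N n) * (4 * \<delta> n))))"
      unfolding q_def B_def P_def by (rule card_not_piercing_le) (use \<delta>0 \<beta> \<theta> Npos in auto)
    also have "\<dots> \<le> (q ^ n) ^ N n * (\<Sum>r\<le>s. exp (C n * g1 r n)) + (q ^ n) ^ N n * (\<Sum>r<s. exp (C n
        * g2 r n))"
      using q by (intro add_mono mult_left_mono sum_mono t1 t2) auto
    also have "\<dots> = ?R n * (q ^ n) ^ N n" by (simp add: algebra_simps)
    finally show ?case using q by (simp add: pos_divide_le_eq)
  qed
  have "?R \<longlonglongrightarrow> (\<Sum>r\<le>s. 0) + (\<Sum>r<s. 0)"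
    by (intro tendsto_add tendsto_sum lim1 lim2) auto
  then have lim: "?R \<longlonglongrightarrow> 0" by simp
  have nonneg: "eventually (\<lambda>n. 0 \<le> real (card (?E n)) / (q ^ n) ^ N n) sequentially"
    using q(2) by simp
  show ?thesis by (rule tendsto_sandwich[OF nonneg bound tendsto_const lim])
qed

section \<open>Below the threshold: the second moment argument\<close>

lemma piercing_density_tendsto_0:
  fixes k s :: nat and c' :: real and N :: "nat \<Rightarrow> nat"
  defines "q \<equiv> real CARD('a::prime_field)"
  assumes k: "k \<ge> 2" and s: "s \<ge> 1" and c': "0 < c'" "c' < threshold_const CARD('a) k s"
    and N: "eventually (\<lambda>n. real (N n) \<le> c' * real (n choose k)) sequentially"
  shows "(\<lambda>n. real (card {x \<in> {..<N n} \<rightarrow>\<^sub>E (affine_points n :: (nat \<Rightarrow> 'a) set).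
    pierces (x ` {..<N n}) (varieties n k s)}) / (q ^ n) ^ N n) \<longlonglongrightarrow> 0"
proof -
  have q: "q \<ge> 2" "q > 0" using CARD_real_ge_2[where 'a = 'a] by (auto simp: q_def)
  define c where "c = threshold_const CARD('a) k s"
  define l where "l = ln (tilt q 1)"
  have l: "l > 0" using tilt_gt_1[OF q(1), of 1] by (simp add: l_def)
  define b where "b = (s - 1) * k"
  have c_eq: "c = q ^ b * ln q / l"
    unfolding c_def l_def q_def b_def by (rule threshold_const_eq) (rule two_le_CARD)
  have c: "c > 0" "c' < c" using c' by (auto simp: c_def)
  define \<rho> where "\<rho> = c' / c"
  have \<rho>: "0 < \<rho>" "\<rho> < 1" using c c' by (auto simp: \<rho>_def)
  \<comment> \<open>In units of \<open>C n * ln q / l\<close>, the mean number of hits is at most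
    \<rho>, and the truncation level \<kappa> will be \<theta>. Then
    \<open>\<rho> < \<theta>\<close> makes more than \<kappa> hits unlikely, and
    \<open>\<theta> < 1\<close> keeps \<open>tilt q 1 powr \<kappa>\<close>, which is
    \<open>q powr (\<theta> * C n)\<close>, well below the number of unbiased polynomials.\<close>
  define \<theta> where "\<theta> = (1 + \<rho>) / 2"
  have \<theta>: "\<rho> < \<theta>" "\<theta> < 1" using \<rho> by (auto simp: \<theta>_def)
  \<comment> \<open>Again a midpoint, now of 1 and \<open>\<theta> / \<rho>\<close>, which makes the
    exponent of the upper tail negative.\<close>
  define \<beta> where "\<beta> = (1 + \<theta> / \<rho>) / 2"
  have "\<theta> / \<rho> > 1" using \<theta> \<rho> by simp
  then have \<beta>: "\<beta> > 1" by (simp add: \<beta>_def)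
  have "\<rho> * \<beta> = (\<rho> + \<theta>) / 2" using \<rho>(1) by (simp add: \<beta>_def distrib_left)
  then have \<rho>\<beta>: "\<rho> * \<beta> < \<theta>" using \<theta>(1) by simp
  have \<beta>_neg: "\<rho> * (\<beta> - 1) - \<theta> * ln \<beta> < 0"
  proof -
    have "\<rho> < \<theta> / \<beta>" using \<beta> \<rho>\<beta> by (simp add: pos_less_divide_eq)
    then have "\<rho> * (\<beta> - 1) < \<theta> / \<beta> * (\<beta> - 1)" using \<beta> by (intro mult_strict_right_mono) auto
    also have "\<dots> = \<theta> * (1 - 1 / \<beta>)" using \<beta> by (simp add: right_diff_distrib diff_divide_distrib)
    also have "\<dots> \<le> \<theta> * ln \<beta>" using \<beta> \<theta> \<rho> by (intro mult_left_mono ln_ge_one_minus_inverse) auto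
    finally show ?thesis by simp
  qed
  define C where "C = (\<lambda>n. real (n choose k))"
  have Ctop: "filterlim C at_top sequentially" unfolding C_def
      by (rule binomial_at_top) (use k in simp)
  \<comment> \<open>The dimension of the subspace. The subtraction is truncated, so the estimates
    are only made for \<open>n \<ge> b\<close>.\<close>
  define m where "m = (\<lambda>n. n - b)"
  have mtop: "filterlim m at_top sequentially" unfolding m_def
      by (rule filterlim_minus_const_nat_at_top)
  define \<delta> where "\<delta> = (\<lambda>n. bias_level k (m n))"
  have \<delta>: "\<delta> \<longlonglongrightarrow> 0" unfolding \<delta>_def by (rule filterlim_compose[OF bias_level_tendsto_0 mtop])
  have \<delta>0: "\<delta> n \<ge> 0" for n by (simp add: \<delta>_def bias_level_def)
  define v where "v = (\<lambda>n. C (m n) / C n)"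
  have v: "v \<longlonglongrightarrow> 1" unfolding v_def C_def m_def by (rule binomial_diff_ratio_tendsto)
  define y where "y = (\<lambda>n. real (bias_exponent k (m n)) / C (m n))"
  have y: "y \<longlonglongrightarrow> 0"
    using filterlim_compose[OF bias_exponent_over_binomial_tendsto[OF k] mtop]
        unfolding y_def C_def .
  have Cm1: "eventually (\<lambda>n. C (m n) \<ge> 1 \<and> C n \<ge> 1 \<and> m n \<ge> 1) sequentially"
  proof -
    have "eventually (\<lambda>n. C (m n) \<ge> 1) sequentially"
      using filterlim_compose[OF Ctop mtop] by (simp add: filterlim_at_top)
    moreover have "eventually (\<lambda>n. C n \<ge> 1) sequentially" using Ctop by (simp add: filterlim_at_top)
    moreover have "eventually (\<lambda>n. m n \<ge> 1) sequentially" using mtop by (simp add: filterlim_at_top)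
    ultimately show ?thesis by eventually_elim simp
  qed
  \<comment> \<open>The accumulated bias: \<open>N n\<close> is at most of order
    \<open>n ^ k\<close>, while \<delta> has order \<open>1 / n ^ (k + 1)\<close>.\<close>
  define u where "u = (\<lambda>n. real (N n) * \<delta> n)"
  have u: "u \<longlonglongrightarrow> 0"
  proof (rule tendsto_sandwich)
    show "eventually (\<lambda>n. 0 \<le> u n) sequentially" by (simp add: u_def \<delta>0)
    show "eventually (\<lambda>n. u n \<le> c' * (inverse (v n) * (C (m n) / real (m n) ^ k) * (1
        / real (m n)))) sequentially"
      using N Cm1
    proof eventually_elim
      case (elim n)
      have "u n \<le> c' * C n * \<delta> n" unfolding u_def using elim(1) \<delta>0
          by (intro mult_right_mono) (auto simp: C_def)
      also have "\<dots> = c' * (inverse (v n) * (C (m n) / real (m n) ^ k) * (1 / real (m n)))"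
        using elim(2) by (simp add: \<delta>_def bias_level_def v_def field_simps)
      finally show ?case .
    qed
    have "(\<lambda>n. C (m n) / real (m n) ^ k) \<longlonglongrightarrow> 1 / fact k"
      using filterlim_compose[OF binomial_over_power_tendsto mtop] unfolding C_def .
    moreover have "(\<lambda>n. 1 / real (m n)) \<longlonglongrightarrow> 0"
      using filterlim_compose[OF lim_1_over_n mtop] .
    ultimately have "(\<lambda>n. c' * (inverse (v n) * (C (m n) / real (m n) ^ k) * (1 / real (m n)))) \<longlonglongrightarrow>
        c' * (inverse 1 * (1 / fact k) * 0)"
      by (intro tendsto_mult tendsto_const tendsto_inverse v) auto
    then show "(\<lambda>n. c' * (inverse (v n) * (C (m n) / real (m n) ^ k) * (1 / real (m n)))) \<longlonglongrightarrow> 0"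
        by simp
  qed simp
  define \<kappa> where "\<kappa> = (\<lambda>n. \<theta> * C n * ln q / l)"
  \<comment> \<open>Eventually the biased polynomials number at most half of the lower bound for the
    number of all polynomials, which leaves enough unbiased ones.\<close>
  have lim_half: "(\<lambda>n. exp (C (m n) * ((y n - 1) * ln q))) \<longlonglongrightarrow> 0"
  proof (rule exp_mult_tendsto_0)
    show "filterlim (\<lambda>n. C (m n)) at_top sequentially" by (rule filterlim_compose[OF Ctop mtop])
    show "(\<lambda>n. (y n - 1) * ln q) \<longlonglongrightarrow> (0 - 1) * ln q"
        by (intro tendsto_mult tendsto_diff y tendsto_const)
    show "(0 - 1) * ln q < 0" using q by simp
  qed
  define g1 where "g1 = (\<lambda>n. ln q * (y n * v n - v n + \<theta>))"
  have lim1: "(\<lambda>n. exp (C n * g1 n)) \<longlonglongrightarrow> 0"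
  proof (rule exp_mult_tendsto_0[OF Ctop])
    show "g1 \<longlonglongrightarrow> ln q * (0 * 1 - 1 + \<theta>)"
      unfolding g1_def by (intro tendsto_mult tendsto_add tendsto_diff y v tendsto_const)
    show "ln q * (0 * 1 - 1 + \<theta>) < 0" using \<theta> q by (simp add: mult_pos_neg)
  qed
  define g2 where "g2 = ln q / l * (\<rho> * (\<beta> - 1) - \<theta> * ln \<beta>)"
  have lim2: "(\<lambda>n. exp (C n * g2)) \<longlonglongrightarrow> 0"
  proof (rule exp_mult_tendsto_0[OF Ctop tendsto_const])
    have "ln q / l > 0" using q l by simp
    then show "g2 < 0" unfolding g2_def using \<beta>_neg by (rule mult_pos_neg)
  qed
  let ?E = "\<lambda>n. {x \<in> {..<N n} \<rightarrow>\<^sub>E (affine_points n :: (nat \<Rightarrow> 'a) set). pierces (x ` {..<N n})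
      (varieties n k s)}"
  let ?R = "\<lambda>n. (exp (16 * u n) - 1) + 4 * u n + 2 * q\<^sup>2 * exp (C n * g1 n) * exp (2 * u n)
     + 2 * (exp (C n * g2) * exp (2 * \<beta> * u n))"
  have "eventually (\<lambda>n. exp (C (m n) * ((y n - 1) * ln q)) < 1 / 2) sequentially"
    by (rule order_tendstoD(2)[OF lim_half]) simp
  moreover have "eventually (\<lambda>n. \<delta> n < 1 / q) sequentially"
    by (rule order_tendstoD(2)[OF \<delta>]) (use q in simp)
  moreover have "eventually (\<lambda>n. real (card {f :: (nat \<Rightarrow> 'a) \<Rightarrow> 'a. poly_fun (m n) k f
      \<and> biased (m n) (\<delta> n) f})
      \<le> q ^ bias_exponent k (m n)) sequentially"
    using eventually_compose_filterlim[OF eventually_card_biased_le[OF k, where 'a = 'a] mtop]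
        by (simp add: \<delta>_def q_def)
  ultimately have bound: "eventually (\<lambda>n. real (card (?E n)) / (q ^ n) ^ N n \<le> ?R n) sequentially"
    using N Cm1 eventually_ge_at_top[of b]
  proof eventually_elim
    case (elim n)
    define P where "P = {f :: (nat \<Rightarrow> 'a) \<Rightarrow> 'a. poly_fun (m n) k f}"
    define B where "B = {f \<in> P. biased (m n) (\<delta> n) f}"
    define Q where "Q = {f \<in> P. \<not> biased (m n) (\<delta> n) f}"
    have finP: "finite P" unfolding P_def by (rule finite_poly_fun)
    have C: "C n > 0" "C (m n) > 0" using elim(5) by auto
    have Ceq: "real (bias_exponent k (m n)) = C (m n) * y n" "C (m n) = C n * v n"
      using C by (auto simp: y_def v_def)
    have B: "real (card B) \<le> exp (C (m n) * y n * ln q)"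
    proof -
      have "B = {f :: (nat \<Rightarrow> 'a) \<Rightarrow> 'a. poly_fun (m n) k f \<and> biased (m n) (\<delta> n) f}"
        unfolding B_def P_def by simp
      then have "real (card B) \<le> q ^ bias_exponent k (m n)" using elim(3) by simp
      also have "\<dots> = exp (C (m n) * y n * ln q)" using q unfolding Ceq(1)[symmetric]
          by (intro power_eq_exp_ln)
      finally show ?thesis .
    qed
    have P: "exp (C (m n) * ln q) \<le> real (card P)"
    proof -
      have "CARD('a) ^ (m n choose k) \<le> card P" unfolding P_def by (rule card_poly_fun_ge)
      then have "real (CARD('a) ^ (m n choose k)) \<le> real (card P)" by (simp only: of_nat_le_iff)
      moreover have "real (CARD('a) ^ (m n choose k)) = exp (C (m n) * ln q)"
        using power_eq_exp_ln[OF q(2), of "m n choose k"] by (simp add: q_def C_def)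
      ultimately show ?thesis by (simp only:)
    qed
    have "exp (C (m n) * y n * ln q) = exp (C (m n) * ((y n - 1) * ln q)) * exp (C (m n) * ln q)"
      unfolding exp_add[symmetric] by (simp add: algebra_simps)
    also have "\<dots> \<le> 1 / 2 * exp (C (m n) * ln q)" using elim(1) by (intro mult_right_mono) auto
    finally have half: "real (card B) \<le> exp (C (m n) * ln q) / 2" using B by simp
    have "card P = card B + card Q"
    proof -
      have "P = B \<union> Q" "B \<inter> Q = {}" by (auto simp: B_def Q_def)
      then show ?thesis using finP by (metis card_Un_disjoint finite_Un)
    qed
    then have Q: "real (card Q) \<ge> exp (C (m n) * ln q) / 2" using P half by simp
    then have Qpos: "real (card Q) > 0" using exp_gt_zero[of "C (m n) * ln q"] by linarith
    then have Qne: "Q \<noteq> {}" by auto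
    have nm: "n = m n + (s - 1) * k" using elim(6) by (simp add: m_def b_def)
    have main: "real (card (?E n)) \<le> (q ^ n) ^ N n * ((exp (real (N n) * (16 * \<delta> n)) - 1)
        + 4 * (real (N n) * \<delta> n)
       + q\<^sup>2 * real (card B) / real (card Q) * (tilt q 1 powr \<kappa> n * exp (real (N n) * (2 * \<delta> n)))
       + 2 * (\<beta> powr (- \<kappa> n) * exp (real (N n) * ((\<beta> - 1) / q ^ ((s - 1) * k) + 2 * \<beta> * \<delta> n))))"
      unfolding q_def B_def Q_def P_def
      by (rule card_piercing_le) (use k s nm \<delta>0 \<beta> elim(2) Qne in \<open>auto simp: q_def Q_def P_def\<close>)
    have "real (card B) / real (card Q) \<le> exp (C (m n) * y n * ln q) / (exp (C (m n) * ln q) / 2)"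
      using B Q by (intro frac_le) auto
    also have "\<dots> = 2 * exp (C (m n) * y n * ln q - C (m n) * ln q)" by (simp add: exp_diff)
    finally have "real (card B) / real (card Q) * tilt q 1 powr \<kappa> n \<le> 2 * exp (C (m n) * y n * ln q
        - C (m n) * ln q) * exp (\<theta> * C n * ln q)"
      using l tilt_gt_1[OF q(1), of 1] by (intro mult_mono) (auto simp: powr_def \<kappa>_def l_def)
    also have "\<dots> = 2 * exp (C n * g1 n)"
      unfolding Ceq(2) g1_def mult.assoc exp_add[symmetric] by (simp add: algebra_simps)
    finally have "q\<^sup>2 * exp (2 * u n) * (real (card B) / real (card Q) * tilt q 1 powr \<kappa> n)
        \<le> q\<^sup>2 * exp (2 * u n) * (2 * exp (C n * g1 n))"
      by (intro mult_left_mono) auto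
    then have r1: "q\<^sup>2 * real (card B) / real (card Q) * (tilt q 1 powr \<kappa> n * exp (real (N n) * (2
        * \<delta> n)))
       \<le> 2 * q\<^sup>2 * exp (C n * g1 n) * exp (2 * u n)"
      by (simp add: u_def mult_ac)
    have "real (N n) * ((\<beta> - 1) / q ^ b) \<le> c' * C n * ((\<beta> - 1) / q ^ b)"
      using elim(4) \<beta> q by (intro mult_right_mono) (auto simp: C_def)
    also have "\<dots> = C n * (ln q / l * (\<rho> * (\<beta> - 1)))"
    proof -
      have "c' = \<rho> * c" using c by (simp add: \<rho>_def)
      then have e: "c' / q ^ b = \<rho> * (ln q / l)" using q by (simp add: c_eq)
      have "c' * C n * ((\<beta> - 1) / q ^ b) = c' / q ^ b * (C n * (\<beta> - 1))" by simp
      then show ?thesis unfolding e by simp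
    qed
    finally have "- \<kappa> n * ln \<beta> + real (N n) * ((\<beta> - 1) / q ^ b) \<le> C n * g2"
      by (simp add: g2_def \<kappa>_def algebra_simps)
    then have "exp (- \<kappa> n * ln \<beta> + real (N n) * ((\<beta> - 1) / q ^ b)) * exp (2 * \<beta> * u n)
        \<le> exp (C n * g2) * exp (2 * \<beta> * u n)"
      by (intro mult_right_mono) auto
    moreover have "\<beta> powr (- \<kappa> n) * exp (real (N n) * ((\<beta> - 1) / q ^ ((s - 1) * k) + 2 * \<beta> * \<delta> n)) =
       exp (- \<kappa> n * ln \<beta> + real (N n) * ((\<beta> - 1) / q ^ b)) * exp (2 * \<beta> * u n)"
    proof -
      have "\<beta> powr (- \<kappa> n) = exp (- \<kappa> n * ln \<beta>)" using \<beta> by (simp add: powr_def)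
      then show ?thesis by (simp add: u_def b_def exp_add[symmetric] algebra_simps)
    qed
    ultimately have r2: "\<beta> powr (- \<kappa> n) * exp (real (N n) * ((\<beta> - 1) / q ^ ((s - 1) * k)
        + 2 * \<beta> * \<delta> n)) \<le> exp (C n * g2) * exp (2 * \<beta> * u n)"
      by simp
    have "real (card (?E n)) \<le> (q ^ n) ^ N n * ?R n"
      by (rule order_trans[OF main], intro mult_left_mono add_mono r1 r2 order_refl)
        (use q r2 in \<open>auto simp: u_def mult_ac\<close>)
    then show ?case using q by (simp add: pos_divide_le_eq mult.commute)
  qed
  have "?R \<longlonglongrightarrow> (exp (16 * 0) - 1) + 4 * 0 + 2 * q\<^sup>2 * 0 * exp (2 * 0) + 2 * (0 * exp (2 * \<beta> * 0))"
    by (intro tendsto_add tendsto_diff tendsto_mult tendsto_exp tendsto_const u lim1 lim2)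
  then have lim: "?R \<longlonglongrightarrow> 0" by simp
  have nonneg: "eventually (\<lambda>n. 0 \<le> real (card (?E n)) / (q ^ n) ^ N n) sequentially"
    using q(2) by simp
  show ?thesis by (rule tendsto_sandwich[OF nonneg bound tendsto_const lim])
qed

section \<open>Transfer to random subsets\<close>

lemma eventually_square_le_power:
  fixes N :: "nat \<Rightarrow> nat"
  assumes "q \<ge> 2" and N: "eventually (\<lambda>n. real (N n) \<le> K * real (n choose k)) sequentially"
  shows "eventually (\<lambda>n. 2 * N n ^ 2 \<le> q ^ n) sequentially"
proof -
  define K' where "K' = \<bar>K\<bar> + 1"
  have K': "K' > 0" by (simp add: K'_def)
  have "eventually (\<lambda>n. real n ^ (2 * k) / 2 powr sqrt (real n) < 1 / (2 * K'\<^sup>2)) sequentially"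
    by (rule order_tendstoD(2)[OF power_over_exp_sqrt_tendsto_0]) (use K' in simp)
  with N eventually_ge_at_top[of "max k 1"] show ?thesis
  proof eventually_elim
    case (elim n)
    have "real (N n) \<le> K * real (n choose k)" by fact
    also have "\<dots> \<le> K' * real (n choose k)" by (intro mult_right_mono) (auto simp: K'_def)
    also have "real (n choose k) \<le> real (n ^ k)"
      using elim(2) by (intro of_nat_mono binomial_le_pow) simp
    then have "K' * real (n choose k) \<le> K' * real n ^ k" using K' by (simp add: mult_left_mono)
    finally have "(real (N n))\<^sup>2 \<le> (K' * real n ^ k)\<^sup>2" by (rule power_mono) simp
    then have "2 * (real (N n))\<^sup>2 \<le> 2 * K'\<^sup>2 * real n ^ (2 * k)"
      by (simp add: power_mult_distrib power_mult[symmetric] mult.commute)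
    also have "\<dots> < 2 powr sqrt (real n)" using elim(3) K'
        by (simp add: pos_divide_less_eq pos_less_divide_eq mult_ac)
    also have "\<dots> \<le> 2 powr real n"
    proof (intro powr_mono)
      have "real n \<ge> 1" using elim(2) by simp
      then show "sqrt (real n) \<le> real n" by (simp add: real_le_rsqrt sqrt_le_D real_sqrt_le_iff
          self_le_power real_le_lsqrt)
    qed simp
    also have "\<dots> = 2 ^ n" by (simp add: powr_realpow)
    also have "\<dots> \<le> real q ^ n" using assms(1) by (intro power_mono) auto
    finally have "real (2 * N n ^ 2) \<le> real (q ^ n)" by simp
    then show ?case by (simp only: of_nat_le_iff)
  qed
qed

lemma pierces_mono: "M \<subseteq> M' \<Longrightarrow> pierces M F \<Longrightarrow> pierces M' F"
  unfolding pierces_def by blast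

text \<open>The comparison with sequences needs \<open>2 * N ^ 2 \<le> q ^ n\<close>, with
  \<open>q\<close> the order of the field, and fails for large sets. It is therefore applied to
  \<open>N0\<close>, the least size above the threshold, and monotonicity of piercing extends the
  bound to \<open>N n\<close>.\<close>

lemma prob_pierces_tendsto_1:
  fixes k s :: nat and \<epsilon> :: real and N :: "nat \<Rightarrow> nat"
  assumes q3: "CARD('a::prime_field) \<ge> 3" and k: "k \<ge> 2" and s: "s \<ge> 1" and \<epsilon>: "\<epsilon> > 0"
    and le: "\<And>n. N n \<le> CARD('a) ^ n"
    and N: "eventually (\<lambda>n. real (N n) \<ge> (threshold_const CARD('a) k s
        + \<epsilon>) * real (n choose k)) sequentially"
  shows "(\<lambda>n. measure_pmf.prob (random_subset n (N n))
    {M. pierces M (varieties n k s :: (nat \<Rightarrow> 'a) set set)}) \<longlonglongrightarrow> 1"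
proof -
  define c where "c = threshold_const CARD('a) k s"
  define N0 where "N0 = (\<lambda>n. nat \<lceil>(c + \<epsilon>) * real (n choose k)\<rceil>)"
  define D where "D = (\<lambda>n. real (card {x \<in> {..<N0 n} \<rightarrow>\<^sub>E (affine_points n :: (nat \<Rightarrow> 'a) set).
    \<not> pierces (x ` {..<N0 n}) (varieties n k s)}) / (real CARD('a) ^ n) ^ N0 n)"
  have D: "D \<longlonglongrightarrow> 0"
    unfolding D_def N0_def c_def by (rule not_piercing_density_tendsto_0) (use q3 k s \<epsilon> in auto)
  have c: "c \<ge> 0" unfolding c_def threshold_const_def using q3 by simp
  have N0: "eventually (\<lambda>n. real (N0 n) \<le> (c + \<epsilon> + 1) * real (n choose k)) sequentially"
    using eventually_ge_at_top[of k]
  proof eventually_elim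
    case (elim n)
    have "real (n choose k) \<ge> 1" using elim by (simp add: Suc_le_eq zero_less_binomial)
    moreover have "(c + \<epsilon>) * real (n choose k) \<ge> 0" using c \<epsilon> by simp
    ultimately show ?case unfolding N0_def by (simp add: distrib_right) linarith
  qed
  have lower: "eventually (\<lambda>n. 1 - 2 * D n \<le> measure_pmf.prob (random_subset n (N n))
    {M. pierces M (varieties n k s :: (nat \<Rightarrow> 'a) set set)}) sequentially"
    using eventually_square_le_power[OF two_le_CARD[where 'a = 'a] N0] N
  proof eventually_elim
    case (elim n)
    let ?P = "\<lambda>M. pierces M (varieties n k s :: (nat \<Rightarrow> 'a) set set)"
    have "measure_pmf.prob (random_subset n (N0 n)) {M. \<not> ?P M} \<le> 2 * D n"
      unfolding D_def by (rule prob_random_subset_le_sequences) (rule elim(1))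
    moreover have "measure_pmf.prob (random_subset n (N0 n)) {M. \<not> ?P M} =
        1 - measure_pmf.prob (random_subset n (N0 n)) {M. ?P M}"
    proof -
      have "{M. \<not> ?P M} = UNIV - {M. ?P M}" by blast
      then show ?thesis using measure_pmf.prob_compl[of "{M. ?P M}" "random_subset n (N0 n)"]
          by simp
    qed
    moreover have "measure_pmf.prob (random_subset n (N0 n)) {M. ?P M}
        \<le> measure_pmf.prob (random_subset n (N n)) {M. ?P M}"
    proof (rule prob_random_subset_mono[OF pierces_mono])
      show "N0 n \<le> N n" unfolding N0_def using elim(2)
          by (simp add: c_def nat_le_iff ceiling_le_iff)
    qed (use le in auto)
    ultimately show ?case by linarith
  qed
  have lim: "(\<lambda>n. 1 - 2 * D n) \<longlonglongrightarrow> 1"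
    using tendsto_diff[OF tendsto_const tendsto_mult[OF tendsto_const D], of 1 2] by simp
  have upper: "eventually (\<lambda>n. measure_pmf.prob (random_subset n (N n))
    {M. pierces M (varieties n k s :: (nat \<Rightarrow> 'a) set set)} \<le> 1) sequentially" by simp
  show ?thesis by (rule tendsto_sandwich[OF lower upper lim tendsto_const])
qed

lemma prob_pierces_tendsto_0:
  fixes k s :: nat and \<epsilon> :: real and N :: "nat \<Rightarrow> nat"
  assumes k: "k \<ge> 2" and s: "s \<ge> 1" and \<epsilon>: "\<epsilon> > 0"
    and N: "eventually (\<lambda>n. real (N n) \<le> (threshold_const CARD('a::prime_field) k s
        - \<epsilon>) * real (n choose k)) sequentially"
  shows "(\<lambda>n. measure_pmf.prob (random_subset n (N n))
    {M. pierces M (varieties n k s :: (nat \<Rightarrow> 'a) set set)}) \<longlonglongrightarrow> 0"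
proof -
  define c where "c = threshold_const CARD('a) k s"
  have c: "c > 0"
    unfolding c_def threshold_const_eq[OF two_le_CARD]
    using CARD_real_ge_2[where 'a = 'a] tilt_gt_1[of "real CARD('a)" 1] by simp
  \<comment> \<open>The maximum keeps \<open>c'\<close> positive even when \<epsilon> exceeds
    \<open>c\<close>.\<close>
  define c' where "c' = max (c - \<epsilon>) (c / 2)"
  have c': "0 < c'" "c' < threshold_const CARD('a) k s" using c \<epsilon>
      by (auto simp: c'_def c_def[symmetric])
  have N': "eventually (\<lambda>n. real (N n) \<le> c' * real (n choose k)) sequentially"
    using N
  proof eventually_elim
    case (elim n)
    also have "(threshold_const CARD('a) k s - \<epsilon>) * real (n choose k) \<le> c' * real (n choose k)"
      by (intro mult_right_mono) (auto simp: c'_def c_def)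
    finally show ?case .
  qed
  define D where "D = (\<lambda>n. real (card {x \<in> {..<N n} \<rightarrow>\<^sub>E (affine_points n :: (nat \<Rightarrow> 'a) set).
    pierces (x ` {..<N n}) (varieties n k s)}) / (real CARD('a) ^ n) ^ N n)"
  have D: "D \<longlonglongrightarrow> 0"
    unfolding D_def by (rule piercing_density_tendsto_0[OF k s c' N'])
  have upper: "eventually (\<lambda>n. measure_pmf.prob (random_subset n (N n))
    {M. pierces M (varieties n k s :: (nat \<Rightarrow> 'a) set set)} \<le> 2 * D n) sequentially"
    using eventually_square_le_power[OF two_le_CARD[where 'a = 'a] N']
  proof eventually_elim
    case (elim n)
    show ?case unfolding D_def by (rule prob_random_subset_le_sequences) (rule elim)
  qed
  have lower: "eventually (\<lambda>n. 0 \<le> measure_pmf.prob (random_subset n (N n))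
    {M. pierces M (varieties n k s :: (nat \<Rightarrow> 'a) set set)}) sequentially" by simp
  have "(\<lambda>n. 2 * D n) \<longlonglongrightarrow> 0" using tendsto_mult[OF tendsto_const D, of 2] by simp
  then show ?thesis by (rule tendsto_sandwich[OF lower upper tendsto_const])
qed

theorem theorem1p1:
  fixes k s :: nat
  assumes "2 \<le> k" and "1 \<le> s"
  shows
    "(odd CARD('p::prime_card) \<and> k < CARD('p) \<longrightarrow>
       (\<forall>\<epsilon>::real. \<epsilon> > 0 \<longrightarrow>
         (\<forall>N :: nat \<Rightarrow> nat. (\<forall>n. N n \<le> CARD('p) ^ n) \<longrightarrow>
           ((\<forall>\<^sub>F n in sequentially.
               real (N n) \<ge> (threshold_const CARD('p) k s + \<epsilon>) * real (n choose k)) \<longrightarrow>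
             (\<lambda>n. measure_pmf.prob (random_subset n (N n))
                    {M. pierces M (varieties n k s :: (nat \<Rightarrow> 'p mod_ring) set set)})
               \<longlonglongrightarrow> 1) \<and>
           ((\<forall>\<^sub>F n in sequentially.
               real (N n) \<le> (threshold_const CARD('p) k s - \<epsilon>) * real (n choose k)) \<longrightarrow>
             (\<lambda>n. measure_pmf.prob (random_subset n (N n))
                    {M. pierces M (varieties n k s :: (nat \<Rightarrow> 'p mod_ring) set set)})
               \<longlonglongrightarrow> 0))))
     \<and>
     (\<lambda>p. threshold_const p k s)
       \<sim>[inf at_top (principal {p. prime p})]
       (\<lambda>p. real p ^ ((s - 1) * k + 1) * ln (real p))"
proof (intro conjI impI allI)
  fix \<epsilon> :: real and N :: "nat \<Rightarrow> nat"
  assume p: "odd CARD('p) \<and> k < CARD('p)" and \<epsilon>: "\<epsilon> > 0" and le: "\<forall>n. N n \<le> CARD('p) ^ n"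
    and N: "\<forall>\<^sub>F n in sequentially. real (N n) \<ge> (threshold_const CARD('p) k s
        + \<epsilon>) * real (n choose k)"
  have "CARD('p mod_ring) \<ge> 3" using p assms by simp
  then show "(\<lambda>n. measure_pmf.prob (random_subset n (N n))
      {M. pierces M (varieties n k s :: (nat \<Rightarrow> 'p mod_ring) set set)}) \<longlonglongrightarrow> 1"
    by (rule prob_pierces_tendsto_1[OF _ assms \<epsilon>]) (use le N in simp_all)
next
  fix \<epsilon> :: real and N :: "nat \<Rightarrow> nat"
  assume \<epsilon>: "\<epsilon> > 0"
    and N: "\<forall>\<^sub>F n in sequentially. real (N n) \<le> (threshold_const CARD('p) k s
        - \<epsilon>) * real (n choose k)"
  show "(\<lambda>n. measure_pmf.prob (random_subset n (N n))
      {M. pierces M (varieties n k s :: (nat \<Rightarrow> 'p mod_ring) set set)}) \<longlonglongrightarrow> 0"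
    by (rule prob_pierces_tendsto_0[OF assms \<epsilon>]) (use N in simp)
qed (rule threshold_const_asymp_equiv)

end
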